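(* Let $a,b,n$ be positive integers. Then the inverse Kazhdan–Lusztig polynomial of the $(a,b)$-Catalan matroid satisfies $$Q_{C_n^{a,b}}(t)=\sum_{\lambda\vdash n}\frac1{z_\lambda}\,Q_{U_\lambda^{a,b}}(t),$$ where the sum is over all partitions $\lambda=(\lambda_1,\dots,\lambda_k)$ of $n$ and $Q_{U_\lambda^{a,b}}(t)=\prod_{j=1}^k Q_{U_{\lambda_j}^{a,b}}(t)$.
   Context: For $m\ge1$, $U_m^{a,b}=U_{mb,m(a+b)}$ is the uniform matroid of rank $mb$ on $m(a+b)$ elements. For $S\subseteq[N]$, the Schubert matroid $\mathrm{SM}_N(S)$ is the matroid on $[N]$ whose bases are the $T\subseteq[N]$ with $|T|=|S|$ such that for every $i$ the $i$-th smallest element of $T$ is at most the $i$-th smallest element of $S$. The $(a,b)$-Catalan matroid $C_n^{a,b}$ is $\mathrm{SM}_{n(a+b)}(S)$ where $S$ has indicator vector $(0^a,1^b,\dots,0^a,1^b)$ ($n$ blocks of $a$ zeros followed by $b$ ones). For a partition $\lambda$ of $n$ in which $i$ appears $\alpha_i$ times, $z_\lambda=\prod_i i^{\alpha_i}\alpha_i!$. The Kazhdan–Lusztig polynomial $P_M(t)\in\mathbb Z[t]$ of a loopless matroid $M$ is the unique assignment such that: $P_M(t)=1$ if $\mathrm{rk}(M)=0$; $\deg P_M<\frac12\mathrm{rk}(M)$ if $\mathrm{rk}(M)>0$; and $t^{\mathrm{rk}(M)}P_M(t^{-1})=\sum_{F}\chi_{M|F}(t)\,P_{M/F}(t)$,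 the sum over all flats $F$ of $M$, where $M|F$ is the restriction to $F$, $M/F$ the contraction by $F$, and $\chi$ the characteristic polynomial. The inverse Kazhdan–Lusztig polynomial $Q_M(t)$ of a loopless matroid is defined recursively by $Q_M(t)=1$ if $\mathrm{rk}(M)=0$ and $\sum_F(-1)^{\mathrm{rk}(F)}P_{M|F}(t)\,Q_{M/F}(t)=0$ (sum over all flats $F$) if $\mathrm{rk}(M)>0$. *)

theory Defs
  imports "HOL-Computational_Algebra.Polynomial" "HOL-Library.Multiset"
begin

section \<open>Finite matroids given by their bases\<close>

datatype 'a matroid = Matroid (ground: "'a set") (bases: "'a set set")

text \<open>The datatype only carries the data; the matroid axioms are the following predicate.\<close>

definition is_matroid :: "'a matroid \<Rightarrow> bool" where
  "is_matroid M \<longleftrightarrow>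
     finite (ground M) \<and> bases M \<noteq> {} \<and> (\<forall>B\<in>bases M. B \<subseteq> ground M) \<and>
     (\<forall>B\<in>bases M. \<forall>B'\<in>bases M. \<forall>x\<in>B - B'. \<exists>y\<in>B' - B. insert y (B - {x}) \<in> bases M)"

definition loopless :: "'a matroid \<Rightarrow> bool" where
  "loopless M \<longleftrightarrow> (\<forall>e\<in>ground M. \<exists>B\<in>bases M. e \<in> B)"

definition rank_of :: "'a matroid \<Rightarrow> 'a set \<Rightarrow> nat" where
  "rank_of M X = Max ((\<lambda>B. card (B \<inter> X)) ` bases M)"

abbreviation rk :: "'a matroid \<Rightarrow> nat" where
  "rk M \<equiv> rank_of M (ground M)"

definition flats :: "'a matroid \<Rightarrow> 'a set set" where
  "flats M = {F. F \<subseteq> ground M \<and> (\<forall>e\<in>ground M - F. rank_of M F < rank_of M (insert e F))}"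

text \<open>Restriction to and contraction by a set \<open>F\<close>: in both cases only those bases
  are used that meet \<open>F\<close> in a maximal independent subset of \<open>F\<close>.\<close>

definition restrict_to :: "'a matroid \<Rightarrow> 'a set \<Rightarrow> 'a matroid" where
  "restrict_to M F = Matroid F {B \<inter> F | B. B \<in> bases M \<and> card (B \<inter> F) = rank_of M F}"

definition contract_by :: "'a matroid \<Rightarrow> 'a set \<Rightarrow> 'a matroid" where
  "contract_by M F =
     Matroid (ground M - F) {B - F | B. B \<in> bases M \<and> card (B \<inter> F) = rank_of M F}"

definition char_poly_matroid :: "'a matroid \<Rightarrow> int poly" where
  "char_poly_matroid M =
     (\<Sum>A\<in>Pow (ground M). (-1) ^ card A * monom 1 (rk M - rank_of M A))"


section \<open>Kazhdan--Lusztig and inverse Kazhdan--Lusztig polynomials\<close>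

text \<open>\<open>rev_poly r p\<close> is $t^r p(t^{-1})$, provided that \<open>degree p \<le> r\<close>.\<close>

definition rev_poly :: "nat \<Rightarrow> int poly \<Rightarrow> int poly" where
  "rev_poly r p = (\<Sum>i\<le>degree p. monom (coeff p i) (r - i))"

text \<open>The assignments below are functions on all of \<open>'a matroid\<close>; the value \<open>0\<close> outside the
  loopless matroids is a convention which makes them unique as functions.
  All restrictions to flats and contractions by flats of a loopless
  matroid are again loopless matroids over the same type.\<close>

definition is_KL_assignment :: "('a matroid \<Rightarrow> int poly) \<Rightarrow> bool" where
  "is_KL_assignment P \<longleftrightarrow>
     (\<forall>M. is_matroid M \<and> loopless M \<longrightarrow>
        (rk M = 0 \<longrightarrow> P M = 1) \<and>
        (rk M > 0 \<longrightarrow> 2 * degree (P M) < rk M) \<and>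
        rev_poly (rk M) (P M) =
          (\<Sum>F\<in>flats M. char_poly_matroid (restrict_to M F) * P (contract_by M F))) \<and>
     (\<forall>M. \<not> (is_matroid M \<and> loopless M) \<longrightarrow> P M = 0)"

definition KL_poly :: "'a matroid \<Rightarrow> int poly" where
  "KL_poly = (THE P. is_KL_assignment P)"

definition is_inverse_KL_assignment :: "('a matroid \<Rightarrow> int poly) \<Rightarrow> bool" where
  "is_inverse_KL_assignment Q \<longleftrightarrow>
     (\<forall>M. is_matroid M \<and> loopless M \<longrightarrow>
        (rk M = 0 \<longrightarrow> Q M = 1) \<and>
        (rk M > 0 \<longrightarrow>
          (\<Sum>F\<in>flats M.
             (-1) ^ rank_of M F * KL_poly (restrict_to M F) * Q (contract_by M F)) = 0)) \<and>
     (\<forall>M. \<not> (is_matroid M \<and> loopless M) \<longrightarrow> Q M = 0)"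

definition inverse_KL_poly :: "'a matroid \<Rightarrow> int poly" where
  "inverse_KL_poly = (THE Q. is_inverse_KL_assignment Q)"


section \<open>Uniform, Schubert and Catalan matroids\<close>

definition uniform_matroid :: "nat \<Rightarrow> nat \<Rightarrow> nat matroid" where
  "uniform_matroid k N = Matroid {1..N} {T. T \<subseteq> {1..N} \<and> card T = k}"

definition U_matroid :: "nat \<Rightarrow> nat \<Rightarrow> nat \<Rightarrow> nat matroid" where
  "U_matroid a b m = uniform_matroid (m * b) (m * (a + b))"

definition schubert_matroid :: "nat \<Rightarrow> nat set \<Rightarrow> nat matroid" where
  "schubert_matroid N S =
     Matroid {1..N}
       {T. T \<subseteq> {1..N} \<and> card T = card S \<and>
           (\<forall>i<card S. sorted_list_of_set T ! i \<le> sorted_list_of_set S ! i)}"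

definition catalan_indicator :: "nat \<Rightarrow> nat \<Rightarrow> nat \<Rightarrow> nat list" where
  "catalan_indicator a b n = concat (replicate n (replicate a 0 @ replicate b 1))"

text \<open>Lists are indexed from \<open>0\<close>, ground sets from \<open>1\<close>.\<close>

definition catalan_matroid :: "nat \<Rightarrow> nat \<Rightarrow> nat \<Rightarrow> nat matroid" where
  "catalan_matroid a b n =
     schubert_matroid (n * (a + b)) {i\<in>{1..n * (a + b)}. catalan_indicator a b n ! (i - 1) = 1}"


section \<open>Integer partitions\<close>

definition partitions_of :: "nat \<Rightarrow> nat multiset set" where
  "partitions_of n = {p. (\<forall>i\<in>#p. 0 < i) \<and> sum_mset p = n}"

definition z_partition :: "nat multiset \<Rightarrow> nat" where
  "z_partition p = (\<Prod>i\<in>set_mset p. i ^ count p i * fact (count p i))"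

lemma finite_partitions_of: "finite (partitions_of n)"
proof -
  have size_le: "(\<forall>i\<in>#p. 0 < i) \<Longrightarrow> size p \<le> sum_mset p" for p :: "nat multiset"
    by (induction p) force+
  have "partitions_of n \<subseteq> mset ` {xs. set xs \<subseteq> {..n} \<and> length xs \<le> n}"
  proof
    fix p assume p: "p \<in> partitions_of n"
    obtain xs where xs: "p = mset xs" by (metis ex_mset)
    have "length xs \<le> n"
      using p size_le[of p] by (simp add: partitions_of_def xs)
    moreover have "set xs \<subseteq> {..n}"
      using p member_le_sum_list by (fastforce simp: partitions_of_def xs sum_mset_sum_list)
    ultimately show "p \<in> mset ` {xs. set xs \<subseteq> {..n} \<and> length xs \<le> n}"
      using xs by blast
  qed
  then show ?thesis
    by (rule finite_subset) (simp add: finite_lists_length_le)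
qed

end

theory Submission
  imports Defs "HOL-Library.Poly_Mapping" "HOL-Library.Function_Algebras"
begin

text \<open>Write \<open>q = (-1)^r Q\<close>. Inverting the Kazhdan--Lusztig relation in the incidence algebra gives
  \<open>q(X) = (\<Sum>Z \<subseteq> A \<subseteq> X. (-1)^(card A - card Z) * t^(rk X - rk A) * t^(rk Z) * q(Z)(1/t))\<close>. With the
  degree bound, this expresses every coefficient of \<open>Q\<close> as a sum over chains of subsets whose weights
  depend only on the ranks along the chain and the signs of the members. So \<open>Q\<close> inherits linear
  relations between the numbers of chains with prescribed ranks, and it is multiplicative.

  In the Catalan matroid the corank of \<open>X\<close> is the maximal partial sum of the numbers
  \<open>b - card (X \<inter> B)\<close> over the blocks \<open>B\<close>; in the uniform matroid it is the positive part of their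
  total. Spitzer's identity relates the distributions of these two quantities. It holds jointly
  along a chain, since taking positive parts is a Rota--Baxter operator even on vectors, as long
  as they are decreasing. This gives \<open>n * Q(C n) = (\<Sum>m = 1..n. Q(U m) * Q(C (n - m)))\<close>, which is also
  the recursion satisfied by the sum over partitions.\<close>

section \<open>Independent sets and rank\<close>

text \<open>The flats of the Catalan and of the uniform matroid differ, so recursions over flats
  cannot be compared term by term. Over all subsets of one ground set, every matroid involved lives
  on the same Boolean lattice and only the rank function changes. The blocks then act as the times
  of a random walk whose step is the vector of the numbers \<open>b - card (X \<inter> B)\<close>,
  one entry for each member \<open>X\<close> of a chain, and the law of a step is a signed count of
  chains. Steps in different blocks are independent, because a chain in a disjoint union is a pair
  of chains and the sign is a product; they are identically distributed, because blocks are
  translates of each other. In its classical form Spitzer's identity gives the laws of the maxima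
  the generating function exp(sum of x^m / m times the law of the positive part of the m-th sum).
  The numbers z_lambda come from this exponential, since exp(sum of p_m x^m / m) has the
  coefficients sum of p_lambda / z_lambda. Applying x d/dx removes all denominators, and the
  resulting recursion is what is proved for integer polynomials.\<close>

definition indep :: "'a matroid \<Rightarrow> 'a set \<Rightarrow> bool" where
  "indep M I \<longleftrightarrow> (\<exists>B\<in>bases M. I \<subseteq> B)"

lemma matroid_finite_ground: "is_matroid M \<Longrightarrow> finite (ground M)"
  and matroid_basis_subset: "is_matroid M \<Longrightarrow> B \<in> bases M \<Longrightarrow> B \<subseteq> ground M"
  and matroid_bases_nonempty: "is_matroid M \<Longrightarrow> bases M \<noteq> {}"
  and matroid_exchange: "is_matroid M \<Longrightarrow> B \<in> bases M \<Longrightarrow> B' \<in> bases M \<Longrightarrow> x \<in> B - B' \<Longrightarrow>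
     \<exists>y\<in>B' - B. insert y (B - {x}) \<in> bases M"
  by (auto simp: is_matroid_def)

lemma finite_basis: "is_matroid M \<Longrightarrow> B \<in> bases M \<Longrightarrow> finite B"
  by (meson finite_subset matroid_basis_subset matroid_finite_ground)

lemma finite_bases: "is_matroid M \<Longrightarrow> finite (bases M)"
  by (rule finite_subset[of _ "Pow (ground M)"])
    (auto dest: matroid_basis_subset simp: matroid_finite_ground)

lemma card_basis_le:
  assumes M: "is_matroid M" and B: "B \<in> bases M" "B' \<in> bases M"
  shows "card B \<le> card B'"
  using B
proof (induction "card (B - B')" arbitrary: B rule: less_induct)
  case less
  note fin = finite_basis[OF M]
  show ?case
  proof (cases "B - B' = {}")
    case True
    then show ?thesis using fin less.prems by (intro card_mono) auto
  next
    case False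
    then obtain x where x: "x \<in> B - B'" by blast
    then obtain y where y: "y \<in> B' - B" "insert y (B - {x}) \<in> bases M"
      using matroid_exchange[OF M] less.prems by meson
    have "insert y (B - {x}) - B' = (B - B') - {x}" using y by auto
    then have "card (insert y (B - {x}) - B') < card (B - B')"
      using x fin[OF less.prems(1)] by (metis card_Diff1_less finite_Diff)
    from less.hyps[OF this y(2) less.prems(2)] have "card (insert y (B - {x})) \<le> card B'" .
    moreover have "card (insert y (B - {x})) = card B"
      using x y fin[OF less.prems(1)]
      by (metis DiffD1 DiffD2 card_Suc_Diff1 card_insert_disjoint finite_Diff insert_Diff insert_iff)
    ultimately show ?thesis by simp
  qed
qed

lemma card_basis_eq:
  "is_matroid M \<Longrightarrow> B \<in> bases M \<Longrightarrow> B' \<in> bases M \<Longrightarrow> card B = card B'"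
  by (simp add: card_basis_le le_antisym)

lemma indep_subset: "indep M J \<Longrightarrow> I \<subseteq> J \<Longrightarrow> indep M I"
  unfolding indep_def by blast

lemma indep_finite: "is_matroid M \<Longrightarrow> indep M I \<Longrightarrow> finite I"
  unfolding indep_def by (meson finite_basis finite_subset)

lemma indep_ground: "is_matroid M \<Longrightarrow> indep M I \<Longrightarrow> I \<subseteq> ground M"
  unfolding indep_def using matroid_basis_subset by blast

text \<open>Let \<open>B2\<close> be a basis through \<open>J\<close>. Among the bases through
  \<open>I\<close> take \<open>B1\<close> with the fewest elements outside
  \<open>B2 \<union> I\<close>; exchange against \<open>B2\<close> shows that there are none. If
  nothing from \<open>J\<close> could be added to \<open>I\<close>, then \<open>B1 - I\<close> and
  \<open>J\<close> would be disjoint subsets of \<open>B2\<close>, together larger than a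
  basis.\<close>

lemma indep_augment:
  assumes M: "is_matroid M" and I: "indep M I" and J: "indep M J" and less: "card I < card J"
  shows "\<exists>y\<in>J - I. indep M (insert y I)"
proof -
  obtain B2 where B2: "B2 \<in> bases M" "J \<subseteq> B2" using J unfolding indep_def by blast
  define f where "f B = card (B - (B2 \<union> I))" for B
  obtain B1 where B1: "B1 \<in> bases M" "I \<subseteq> B1"
    and min: "\<And>B. B \<in> bases M \<Longrightarrow> I \<subseteq> B \<Longrightarrow> f B1 \<le> f B"
  proof -
    obtain B where "B \<in> bases M \<and> I \<subseteq> B" using I unfolding indep_def by blast
    from ex_has_least_nat[of "\<lambda>B. B \<in> bases M \<and> I \<subseteq> B", OF this, of f]
    show ?thesis using that by blast
  qed
  have fin: "finite B1" "finite B2" using finite_basis[OF M] B1 B2 by auto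
  show ?thesis
  proof (rule ccontr)
    assume "\<not> ?thesis"
    then have disj: "B1 \<inter> (J - I) = {}"
      using B1 unfolding indep_def by blast
    have sub: "B1 \<subseteq> B2 \<union> I"
    proof (rule ccontr)
      assume "\<not> B1 \<subseteq> B2 \<union> I"
      then obtain x where x: "x \<in> B1" "x \<notin> B2" "x \<notin> I" by blast
      then obtain y where y: "y \<in> B2 - B1" "insert y (B1 - {x}) \<in> bases M"
        using matroid_exchange[OF M B1(1) B2(1)] by blast
      have "insert y (B1 - {x}) - (B2 \<union> I) = (B1 - (B2 \<union> I)) - {x}" using y by auto
      then have "f (insert y (B1 - {x})) < f B1"
        unfolding f_def using x fin by (simp add: card_Diff1_less del: card_Diff_insert)
      moreover have "f B1 \<le> f (insert y (B1 - {x}))"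
        using min[OF y(2)] x B1 by blast
      ultimately show False by simp
    qed
    have "(B1 - I) \<inter> J = {}" using disj by blast
    then have "card (B1 - I) + card J = card ((B1 - I) \<union> J)"
      using fin B2 by (metis card_Un_disjoint finite_Diff finite_subset)
    also have "\<dots> \<le> card B2" using sub B2 fin by (intro card_mono) auto
    also have "\<dots> = card B1" using card_basis_eq[OF M] B1 B2 by blast
    also have "\<dots> = card (B1 - I) + card I"
      using B1 fin by (metis card_Diff_subset card_mono finite_subset le_add_diff_inverse2)
    finally show False using less by simp
  qed
qed

lemma rank_of_bound:
  assumes "is_matroid M" "B \<in> bases M"
  shows "card (B \<inter> X) \<le> rank_of M X"
  unfolding rank_of_def using assms by (intro Max_ge) (auto simp: finite_bases)

lemma rank_of_attained:
  assumes "is_matroid M"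
  obtains B where "B \<in> bases M" "card (B \<inter> X) = rank_of M X"
proof -
  have "rank_of M X \<in> (\<lambda>B. card (B \<inter> X)) ` bases M"
    unfolding rank_of_def using assms
    by (intro Max_in) (auto simp: finite_bases matroid_bases_nonempty)
  then show ?thesis using that by fastforce
qed

lemma rank_of_eqI:
  assumes "is_matroid M" "\<And>B. B \<in> bases M \<Longrightarrow> card (B \<inter> X) \<le> k"
    "\<exists>B\<in>bases M. card (B \<inter> X) = k"
  shows "rank_of M X = k"
  unfolding rank_of_def using assms by (intro Max_eqI) (auto simp: finite_bases)

lemma indep_card_le_rank:
  assumes M: "is_matroid M" and "indep M I" "I \<subseteq> X"
  shows "card I \<le> rank_of M X"
proof -
  obtain B where B: "B \<in> bases M" "I \<subseteq> B" using assms unfolding indep_def by blast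
  have "card I \<le> card (B \<inter> X)" using assms B finite_basis[OF M B(1)] by (intro card_mono) auto
  also have "\<dots> \<le> rank_of M X" using rank_of_bound[OF M B(1)] .
  finally show ?thesis .
qed

lemma indep_extend:
  assumes M: "is_matroid M" and "indep M I" "I \<subseteq> X"
  shows "\<exists>J. indep M J \<and> I \<subseteq> J \<and> J \<subseteq> X \<and> card J = rank_of M X"
proof -
  obtain B where B: "B \<in> bases M" "card (B \<inter> X) = rank_of M X" using rank_of_attained[OF M] .
  have iB: "indep M (B \<inter> X)" using B unfolding indep_def by blast
  show ?thesis
    using assms(2,3)
  proof (induction "rank_of M X - card I" arbitrary: I rule: less_induct)
    case less
    show ?case
    proof (cases "card I = rank_of M X")
      case True then show ?thesis using less.prems by blast
    next
      case False
      then have lt: "card I < rank_of M X" using indep_card_le_rank[OF M less.prems] by simp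
      then obtain y where y: "y \<in> B \<inter> X - I" "indep M (insert y I)"
        using indep_augment[OF M less.prems(1) iB] B by auto
      have "card (insert y I) = Suc (card I)" using y indep_finite[OF M less.prems(1)] by auto
      then have "\<exists>J. indep M J \<and> insert y I \<subseteq> J \<and> J \<subseteq> X \<and> card J = rank_of M X"
        using less.hyps[of "insert y I"] lt y less.prems by simp
      then show ?thesis by blast
    qed
  qed
qed

lemma card_basis:
  assumes M: "is_matroid M" and B: "B \<in> bases M"
  shows "card B = rk M"
proof -
  obtain B' where B': "B' \<in> bases M" "card (B' \<inter> ground M) = rk M"
    using rank_of_attained[OF M] .
  then have "B' \<inter> ground M = B'" using matroid_basis_subset[OF M] by blast
  then show ?thesis using B' card_basis_eq[OF M B B'(1)] by simp
qed

lemma indep_basis: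
  assumes M: "is_matroid M"
  shows "B \<in> bases M \<longleftrightarrow> indep M B \<and> card B = rk M"
proof
  assume r: "indep M B \<and> card B = rk M"
  then obtain B' where B': "B' \<in> bases M" "B \<subseteq> B'" unfolding indep_def by blast
  then have "B = B'" using card_basis[OF M B'(1)] finite_basis[OF M B'(1)] r
    by (simp add: card_subset_eq)
  then show "B \<in> bases M" using B' by simp
qed (auto simp: indep_def card_basis[OF M])

lemma indep_iff_rank:
  assumes M: "is_matroid M" and "I \<subseteq> ground M"
  shows "indep M I \<longleftrightarrow> rank_of M I = card I"
proof
  assume "rank_of M I = card I"
  moreover obtain B where B: "B \<in> bases M" "card (B \<inter> I) = rank_of M I"
    using rank_of_attained[OF M] .
  moreover have "finite I" using assms matroid_finite_ground finite_subset by blast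
  ultimately have "B \<inter> I = I" by (simp add: card_subset_eq)
  then show "indep M I" using B unfolding indep_def by blast
next
  assume i: "indep M I"
  then obtain J where "indep M J" "I \<subseteq> J" "J \<subseteq> I" "card J = rank_of M I"
    using indep_extend[OF M i order_refl] by blast
  moreover from this have "J = I" by blast
  ultimately show "rank_of M I = card I" by simp
qed

text \<open>Bases are the sets whose rank and size both equal the rank of the matroid, so the rank
  function determines them. Equalities between iterated minors thus become arithmetic of
  ranks.\<close>

lemma matroid_eqI:
  assumes "is_matroid M" "is_matroid N" "ground M = ground N"
    and "\<And>X. X \<subseteq> ground M \<Longrightarrow> rank_of M X = rank_of N X"
  shows "M = N"
proof (rule matroid.expand, intro conjI)
  have char: "B \<in> bases L \<longleftrightarrow> B \<subseteq> ground L \<and> rank_of L B = card B \<and> card B = rk L"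
    if L: "is_matroid L" for B and L :: "'a matroid"
    using indep_basis[OF L, of B] indep_iff_rank[OF L, of B] indep_ground[OF L, of B] by blast
  have "B \<in> bases M \<longleftrightarrow> B \<in> bases N" for B
    unfolding char[OF assms(1)] char[OF assms(2)] using assms(3,4) by auto
  then show "bases M = bases N" by blast
qed fact

lemma rank_of_mono:
  assumes "is_matroid M" "X \<subseteq> Y"
  shows "rank_of M X \<le> rank_of M Y"
proof -
  obtain B where B: "B \<in> bases M" "card (B \<inter> X) = rank_of M X" using rank_of_attained[OF assms(1)] .
  have "card (B \<inter> X) \<le> card (B \<inter> Y)" using assms finite_basis[OF _ B(1)]
    by (intro card_mono) auto
  then show ?thesis using B rank_of_bound[OF assms(1) B(1), of Y] by simp
qed

lemma rank_of_empty [simp]: "is_matroid M \<Longrightarrow> rank_of M {} = 0"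
  by (rule rank_of_eqI) (use matroid_bases_nonempty in auto)

lemma rank_of_le_card: "is_matroid M \<Longrightarrow> finite X \<Longrightarrow> rank_of M X \<le> card X"
  by (metis Int_lower2 card_mono rank_of_attained)

lemma ground_restrict [simp]: "ground (restrict_to M F) = F"
  and ground_contract [simp]: "ground (contract_by M F) = ground M - F"
  by (simp_all add: restrict_to_def contract_by_def)

text \<open>In terms of independent sets, the exchange axiom of a restriction follows from
  \<open>indep_augment\<close>; the quantifier over bases of \<open>M\<close> in
  \<open>restrict_to\<close> hides this.\<close>

lemma bases_restrict:
  assumes M: "is_matroid M"
  shows "bases (restrict_to M F) = {J. indep M J \<and> J \<subseteq> F \<and> card J = rank_of M F}"
proof -
  have "\<exists>B\<in>bases M. J = B \<inter> F \<and> card (B \<inter> F) = rank_of M F"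
    if J: "indep M J" "J \<subseteq> F" "card J = rank_of M F" for J
  proof -
    obtain B where B: "B \<in> bases M" "J \<subseteq> B" using J unfolding indep_def by blast
    have "J \<subseteq> B \<inter> F" using B J by blast
    moreover have "card (B \<inter> F) \<le> card J" using rank_of_bound[OF M B(1)] J by simp
    ultimately have "J = B \<inter> F"
      using finite_basis[OF M B(1)] by (simp add: card_seteq)
    then show ?thesis using J B by auto
  qed
  then show ?thesis by (auto simp: restrict_to_def) (auto simp: indep_def)
qed

lemma is_matroid_restrict:
  assumes M: "is_matroid M" and F: "F \<subseteq> ground M"
  shows "is_matroid (restrict_to M F)"
  unfolding is_matroid_def
proof (intro conjI ballI)
  show "finite (ground (restrict_to M F))"
    using assms matroid_finite_ground finite_subset by auto
  have "indep M {}" using matroid_bases_nonempty[OF M] unfolding indep_def by blast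
  then obtain J where "indep M J" "J \<subseteq> F" "card J = rank_of M F"
    using indep_extend[OF M, of "{}" F] by blast
  then show "bases (restrict_to M F) \<noteq> {}" by (auto simp: bases_restrict[OF M])
next
  fix B B' x
  assume B: "B \<in> bases (restrict_to M F)" "B' \<in> bases (restrict_to M F)" "x \<in> B - B'"
  then have B1: "indep M B" "B \<subseteq> F" "card B = rank_of M F"
    and B2: "indep M B'" "B' \<subseteq> F" "card B' = rank_of M F"
    by (auto simp: bases_restrict[OF M])
  have fin: "finite B" using indep_finite[OF M B1(1)] .
  have c: "card (B - {x}) < card B'"
    using B B1 B2 fin by (metis DiffD1 card_Diff1_less)
  have "indep M (B - {x})" using B1(1) by (rule indep_subset) auto
  from indep_augment[OF M this B2(1) c]
  obtain y where y: "y \<in> B' - (B - {x})" "indep M (insert y (B - {x}))" by blast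
  have "y \<in> B' - B" using y B by auto
  moreover have "card (insert y (B - {x})) = card B"
    using \<open>y \<in> B' - B\<close> B fin
    by (metis DiffD1 DiffD2 card_Suc_Diff1 card_insert_disjoint finite_Diff)
  ultimately show "\<exists>y\<in>B' - B. insert y (B - {x}) \<in> bases (restrict_to M F)"
    using y B1 B2 by (intro bexI[of _ y]) (auto simp: bases_restrict[OF M])
qed (auto simp: bases_restrict[OF M])

lemma rank_of_restrict:
  assumes M: "is_matroid M" and F: "F \<subseteq> ground M" and X: "X \<subseteq> F"
  shows "rank_of (restrict_to M F) X = rank_of M X"
proof (rule rank_of_eqI[OF is_matroid_restrict[OF M F]])
  fix B assume "B \<in> bases (restrict_to M F)"
  then have "indep M (B \<inter> X)" by (auto simp: bases_restrict[OF M] intro: indep_subset)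
  then show "card (B \<inter> X) \<le> rank_of M X" using indep_card_le_rank[OF M] by blast
next
  have "indep M {}" using matroid_bases_nonempty[OF M] unfolding indep_def by blast
  then obtain I where I: "indep M I" "I \<subseteq> X" "card I = rank_of M X"
    using indep_extend[OF M, of "{}" X] by blast
  then obtain J where J: "indep M J" "I \<subseteq> J" "J \<subseteq> F" "card J = rank_of M F"
    using indep_extend[OF M I(1), of F] X by blast
  have "indep M (J \<inter> X)" using J by (auto intro: indep_subset)
  then have "card (J \<inter> X) \<le> card I" using I indep_card_le_rank[OF M] by auto
  moreover have "card I \<le> card (J \<inter> X)"
    using I J indep_finite[OF M J(1)] by (intro card_mono) auto
  ultimately show "\<exists>B\<in>bases (restrict_to M F). card (B \<inter> X) = rank_of M X"
    using J I by (intro bexI[of _ J]) (auto simp: bases_restrict[OF M])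
qed

text \<open>Extend a maximal independent subset of \<open>X\<close> inside \<open>Y\<close>, then to
  a basis. The rank formula for contractions needs one basis that is optimal for both members of a
  flag.\<close>

lemma basis_through_flag:
  assumes M: "is_matroid M" and "X \<subseteq> Y" "Y \<subseteq> ground M"
  obtains B where "B \<in> bases M" "card (B \<inter> X) = rank_of M X" "card (B \<inter> Y) = rank_of M Y"
proof -
  have "indep M {}" using matroid_bases_nonempty[OF M] unfolding indep_def by blast
  then obtain I where I: "indep M I" "I \<subseteq> X" "card I = rank_of M X"
    using indep_extend[OF M, of "{}" X] by blast
  then obtain J where J: "indep M J" "I \<subseteq> J" "J \<subseteq> Y" "card J = rank_of M Y"
    using indep_extend[OF M I(1), of Y] assms by blast
  obtain B where B: "B \<in> bases M" "J \<subseteq> B" using J unfolding indep_def by blast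
  have fin: "finite B" using finite_basis[OF M B(1)] .
  have "card I \<le> card (B \<inter> X)" by (rule card_mono) (use fin I J B in auto)
  moreover have "card J \<le> card (B \<inter> Y)" by (rule card_mono) (use fin J B in auto)
  ultimately show ?thesis using that[OF B(1)] rank_of_bound[OF M B(1)] I J
    by (metis le_antisym)
qed

lemma is_matroid_contract:
  assumes M: "is_matroid M" and F: "F \<subseteq> ground M"
  shows "is_matroid (contract_by M F)"
proof -
  have "indep M {}" using matroid_bases_nonempty[OF M] unfolding indep_def by blast
  then obtain I where I: "indep M I" "I \<subseteq> F" "card I = rank_of M F"
    using indep_extend[OF M, of "{}" F] by blast
  \<comment> \<open>The part inside \<open>F\<close> of a basis that is optimal for \<open>F\<close>
    can be replaced by the fixed set \<open>I\<close>. Any two bases of the contraction therefore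
    lift to bases of \<open>M\<close> with the same trace on \<open>F\<close>, and an exchange
    between these lifts never touches \<open>F\<close>.\<close>
  have sw: "I \<union> (B - F) \<in> bases M" if B: "B \<in> bases M" "card (B \<inter> F) = rank_of M F" for B
  proof -
    have finB: "finite B" and finI: "finite I" using finite_basis[OF M B(1)] indep_finite[OF M I(1)] .
    have iB: "indep M B" using B unfolding indep_def by blast
    obtain J where J: "indep M J" "I \<subseteq> J" "J \<subseteq> I \<union> B" "card J = rank_of M (I \<union> B)"
      using indep_extend[OF M I(1), of "I \<union> B"] by blast
    have cJ: "card J \<ge> rk M" using J(4) indep_card_le_rank[OF M iB, of "I \<union> B"]
        card_basis[OF M B(1)] by simp
    moreover have cJ2: "card J \<le> rk M" using indep_card_le_rank[OF M J(1)] indep_ground[OF M J(1)] by simp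
    ultimately have Jb: "J \<in> bases M" using indep_basis[OF M] J by simp
    have finJ: "finite J" using indep_finite[OF M J(1)] .
    have "card (J \<inter> F) \<le> card I" using rank_of_bound[OF M Jb] I by simp
    then have "J \<inter> F = I" using J I finJ by (metis card_seteq finite_Int le_inf_iff)
    then have sub: "J \<subseteq> I \<union> (B - F)" using J by blast
    have "card (I \<union> (B - F)) \<le> card I + card (B - F)" by (rule card_Un_le)
    also have "card (B - F) = card B - card (B \<inter> F)"
      by (metis Diff_Int2 Int_commute card_Diff_subset_Int finB finite_Int inf.idem)
    also have "card I + (card B - card (B \<inter> F)) = card B"
      using B I card_mono[OF finB, of "B \<inter> F"] by simp
    also have "\<dots> = card J" using card_basis[OF M B(1)] cJ cJ2 by simp
    finally have "I \<union> (B - F) = J" using sub finB finI by (metis card_seteq finite_Diff finite_UnI)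
    then show ?thesis using Jb by simp
  qed
  show ?thesis unfolding is_matroid_def
  proof (intro conjI ballI)
    show "finite (ground (contract_by M F))" using matroid_finite_ground[OF M] by simp
    obtain B where "B \<in> bases M" "card (B \<inter> F) = rank_of M F" using rank_of_attained[OF M] .
    then show "bases (contract_by M F) \<noteq> {}" by (auto simp: contract_by_def)
  next
    fix B assume "B \<in> bases (contract_by M F)"
    then show "B \<subseteq> ground (contract_by M F)"
      using matroid_basis_subset[OF M] by (auto simp: contract_by_def)
  next
    fix C C' x
    assume C: "C \<in> bases (contract_by M F)" "C' \<in> bases (contract_by M F)" and x: "x \<in> C - C'"
    then have C1: "I \<union> C \<in> bases M" "C \<inter> F = {}" "I \<union> C' \<in> bases M" "C' \<inter> F = {}"
      using sw by (auto simp: contract_by_def)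
    have "x \<in> (I \<union> C) - (I \<union> C')" using x C1 I by blast
    then obtain y where y: "y \<in> (I \<union> C') - (I \<union> C)" "insert y ((I \<union> C) - {x}) \<in> bases M"
      using matroid_exchange[OF M C1(1) C1(3)] by blast
    have "insert y (C - {x}) = insert y ((I \<union> C) - {x}) - F" using y x C1 I by auto
    moreover have "card (insert y ((I \<union> C) - {x}) \<inter> F) = rank_of M F"
    proof -
      have "insert y ((I \<union> C) - {x}) \<inter> F = I" using y x C1 I by auto
      then show ?thesis using I by simp
    qed
    ultimately have "insert y (C - {x}) \<in> bases (contract_by M F)"
      using y(2) by (auto simp: contract_by_def)
    then show "\<exists>y\<in>C' - C. insert y (C - {x}) \<in> bases (contract_by M F)" using y by blast
  qed
qed

lemma rank_of_contract:
  assumes M: "is_matroid M" and F: "F \<subseteq> ground M" and X: "X \<subseteq> ground M"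
  shows "rank_of (contract_by M F) X = rank_of M (X \<union> F) - rank_of M F"
proof (rule rank_of_eqI[OF is_matroid_contract[OF M F]])
  have split: "card (B \<inter> (X \<union> F)) = card ((B - F) \<inter> X) + card (B \<inter> F)" if "B \<in> bases M" for B
  proof -
    have "B \<inter> (X \<union> F) = ((B - F) \<inter> X) \<union> (B \<inter> F)" by auto
    moreover have "finite B" using finite_basis[OF M that] .
    ultimately show ?thesis by (metis (no_types, lifting) Diff_Int_distrib Diff_disjoint Int_commute
          card_Un_disjoint finite_Diff finite_Int inf_assoc inf_bot_left inf_bot_right inf_left_commute)
  qed
  fix C assume "C \<in> bases (contract_by M F)"
  then obtain B where B: "B \<in> bases M" "card (B \<inter> F) = rank_of M F" "C = B - F"
    by (auto simp: contract_by_def)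
  then show "card (C \<inter> X) \<le> rank_of M (X \<union> F) - rank_of M F"
    using split[OF B(1)] rank_of_bound[OF M B(1), of "X \<union> F"] by simp
next
  obtain B where B: "B \<in> bases M" "card (B \<inter> F) = rank_of M F"
    "card (B \<inter> (X \<union> F)) = rank_of M (X \<union> F)"
    using basis_through_flag[OF M, of F "X \<union> F"] F X by blast
  have "B \<inter> (X \<union> F) = ((B - F) \<inter> X) \<union> (B \<inter> F)" by auto
  moreover have "finite B" using finite_basis[OF M B(1)] .
  moreover have "((B - F) \<inter> X) \<inter> (B \<inter> F) = {}" by auto
  ultimately have "card (B \<inter> (X \<union> F)) = card ((B - F) \<inter> X) + card (B \<inter> F)"
    by (metis card_Un_disjoint finite_Diff finite_Int)
  then show "\<exists>C\<in>bases (contract_by M F). card (C \<inter> X) = rank_of M (X \<union> F) - rank_of M F"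
    using B by (intro bexI[of _ "B - F"]) (auto simp: contract_by_def)
qed

section \<open>Reversal of polynomials and convolution of interval functions\<close>

lemma coeff_rev_poly:
  assumes "degree p \<le> r"
  shows "coeff (rev_poly r p) e = (if e \<le> r then coeff p (r - e) else 0)"
proof -
  have "coeff (rev_poly r p) e = (\<Sum>i\<le>degree p. if r - i = e then coeff p i else 0)"
    by (simp add: rev_poly_def coeff_sum)
  also have "\<dots> = (\<Sum>i\<le>degree p. if i = r - e then (if e \<le> r then coeff p (r - e) else 0) else 0)"
    by (intro sum.cong) (use assms in auto)
  also have "\<dots> = (if e \<le> r then coeff p (r - e) else 0)"
    by (auto simp: coeff_eq_0)
  finally show ?thesis .
qed

lemma rev_poly_0 [simp]: "rev_poly r 0 = 0"
  by (simp add: rev_poly_def)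

lemma rev_poly_sum:
  assumes "\<And>i. i \<in> I \<Longrightarrow> degree (f i) \<le> r"
  shows "rev_poly r (\<Sum>i\<in>I. f i) = (\<Sum>i\<in>I. rev_poly r (f i))"
proof (cases "finite I")
  case True
  then have "degree (\<Sum>i\<in>I. f i) \<le> r" using assms by (intro degree_sum_le)
  then show ?thesis by (intro poly_eqI) (simp add: coeff_rev_poly coeff_sum assms)
qed simp

text \<open>Brings in \<open>reflect_poly\<close>, whose multiplicativity is known, at the cost of a
  power of t; this is how \<open>rev_poly_mult\<close> is obtained.\<close>

lemma rev_poly_reflect:
  assumes "degree p \<le> r"
  shows "rev_poly r p = monom 1 (r - degree p) * reflect_poly p"
proof (rule poly_eqI)
  fix e
  show "coeff (rev_poly r p) e = coeff (monom 1 (r - degree p) * reflect_poly p) e"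
  proof (cases "r - degree p \<le> e")
    case True
    then show ?thesis using assms
      by (auto simp: coeff_rev_poly coeff_monom_mult coeff_reflect_poly intro: arg_cong[of _ _ "coeff p"])
  next
    case False
    then show ?thesis using assms
      by (auto simp: coeff_rev_poly coeff_monom_mult coeff_reflect_poly coeff_eq_0)
  qed
qed

lemma rev_poly_mult:
  assumes "degree p \<le> r" "degree q \<le> s"
  shows "rev_poly (r + s) (p * q) = rev_poly r p * rev_poly s q"
proof (cases "p = 0 \<or> q = 0")
  case False
  then have d: "degree (p * q) = degree p + degree q" by (simp add: degree_mult_eq)
  have "rev_poly (r + s) (p * q) = monom 1 (r + s - (degree p + degree q)) * (reflect_poly p * reflect_poly q)"
    using assms d by (simp add: rev_poly_reflect reflect_poly_mult)
  also have "monom (1::int) (r + s - (degree p + degree q)) =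
      monom 1 (r - degree p) * monom 1 (s - degree q)"
    using assms by (simp add: mult_monom)
  finally show ?thesis using assms by (simp add: rev_poly_reflect mult_ac)
qed auto

lemma rev_poly_monom: "e \<le> r \<Longrightarrow> rev_poly r (monom c e) = monom c (r - e)"
  by (intro poly_eqI) (auto simp: coeff_rev_poly degree_monom_le[THEN order_trans])

lemma rev_poly_uminus: "degree p \<le> r \<Longrightarrow> rev_poly r (- p) = - rev_poly r p"
  by (intro poly_eqI) (simp add: coeff_rev_poly)

lemma rev_poly_mult_const: "degree p \<le> r \<Longrightarrow> rev_poly r ((-1) ^ k * p) = (-1) ^ k * rev_poly r p"
  by (cases "even k") (simp_all add: rev_poly_uminus)

section \<open>Alternating sums and the incidence algebra of the Boolean lattice\<close>

lemma finite_set_interval: "finite G \<Longrightarrow> finite {F..G::'a set}"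
  by (rule finite_subset[of _ "Pow G"]) auto

text \<open>Adding or removing \<open>e\<close> is an involution of the interval that flips the sign
  of \<open>g\<close>. It accounts for the vanishing of characteristic polynomials of matroids with
  loops, for Moebius inversion, and for the removal of chain steps without a drop in rank.\<close>

lemma alternating_interval_sum:
  fixes g :: "'a set \<Rightarrow> 'b::ab_group_add"
  assumes "finite G" "e \<in> G" "e \<notin> F"
    and "\<And>A. F \<subseteq> A \<Longrightarrow> A \<subseteq> G \<Longrightarrow> e \<notin> A \<Longrightarrow> g (insert e A) = - g A"
  shows "sum g {F..G} = 0"
proof -
  have fin: "finite {F..G}" using assms(1) by (rule finite_set_interval)
  have dec: "{F..G} = {F..G - {e}} \<union> insert e ` {F..G - {e}}"
  proof (intro set_eqI iffI)
    fix A assume A: "A \<in> {F..G}"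
    show "A \<in> {F..G - {e}} \<union> insert e ` {F..G - {e}}"
    proof (cases "e \<in> A")
      case True
      then have "A = insert e (A - {e})" by blast
      moreover have "A - {e} \<in> {F..G - {e}}" using A assms(3) by auto
      ultimately show ?thesis by blast
    qed (use A in auto)
  next
    fix A assume "A \<in> {F..G - {e}} \<union> insert e ` {F..G - {e}}"
    then show "A \<in> {F..G}" using assms(2) by auto
  qed
  have inj: "inj_on (insert e) {F..G - {e}}"
    by (intro inj_onI) (auto simp: insert_ident)
  have "sum g {F..G} = sum g {F..G - {e}} + sum g (insert e ` {F..G - {e}})"
    unfolding dec using fin assms(1) by (intro sum.union_disjoint) (auto simp: finite_set_interval)
  also have "sum g (insert e ` {F..G - {e}}) = (\<Sum>A\<in>{F..G - {e}}. - g A)"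
    unfolding sum.reindex[OF inj] using assms by (intro sum.cong) auto
  finally show ?thesis by (simp add: sum_negf)
qed

text \<open>The product of the incidence algebra, with unit \<open>delta\<close>. Values at pairs
  with \<open>\<not> F \<subseteq> G\<close> are left unconstrained, so the unit laws carry the
  hypothesis \<open>F \<subseteq> G\<close>.\<close>

definition conv :: "('a set \<Rightarrow> 'a set \<Rightarrow> int poly) \<Rightarrow> ('a set \<Rightarrow> 'a set \<Rightarrow> int poly) \<Rightarrow>
    'a set \<Rightarrow> 'a set \<Rightarrow> int poly" where
  "conv f g F G = (\<Sum>H\<in>{F..G}. f F H * g H G)"

definition delta :: "'a set \<Rightarrow> 'a set \<Rightarrow> int poly" where
  "delta F G = (if F = G then 1 else 0)"

lemma conv_assoc:
  assumes "finite G"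
  shows "conv (conv f g) h F G = conv f (conv g h) F G"
proof -
  have down: "{F..H} = {L\<in>{F..G}. L \<subseteq> H}" and up: "{H..G} = {L\<in>{F..G}. H \<subseteq> L}"
    if "H \<in> {F..G}" for H
    using that by (simp_all add: set_eq_iff) (blast+)
  have "conv (conv f g) h F G = (\<Sum>H\<in>{F..G}. \<Sum>L\<in>{L\<in>{F..G}. L \<subseteq> H}. f F L * g L H * h H G)"
    unfolding conv_def sum_distrib_right by (intro sum.cong down refl)
  also have "\<dots> = (\<Sum>L\<in>{F..G}. \<Sum>H\<in>{H\<in>{F..G}. L \<subseteq> H}. f F L * g L H * h H G)"
    by (rule sum.swap_restrict) (simp_all add: assms finite_set_interval)
  also have "\<dots> = conv f (conv g h) F G"
    unfolding conv_def sum_distrib_left mult.assoc by (intro sum.cong up[symmetric] refl)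
  finally show ?thesis .
qed

lemma conv_delta_left: "finite G \<Longrightarrow> F \<subseteq> G \<Longrightarrow> conv delta f F G = f F G"
  by (simp add: conv_def delta_def finite_set_interval if_distrib[of "\<lambda>x. x * _"] cong: if_cong)

lemma conv_delta_right: "finite G \<Longrightarrow> F \<subseteq> G \<Longrightarrow> conv f delta F G = f F G"
  by (simp add: conv_def delta_def finite_set_interval if_distrib[of "\<lambda>x. _ * x"] cong: if_cong)

lemma conv_cong:
  assumes "\<And>H. F \<subseteq> H \<Longrightarrow> H \<subseteq> G \<Longrightarrow> f F H = f' F H" "\<And>H. F \<subseteq> H \<Longrightarrow> H \<subseteq> G \<Longrightarrow> g H G = g' H G"
  shows "conv f g F G = conv f' g' F G"
  unfolding conv_def using assms by (intro sum.cong) auto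

text \<open>The term \<open>H = F\<close> of the convolution isolates \<open>g F G\<close>, because
  \<open>f F F = 1\<close>; all other terms concern shorter intervals and agree by
  induction.\<close>

lemma conv_cancel_left:
  assumes "finite E" "\<And>F. F \<subseteq> E \<Longrightarrow> f F F = 1"
    and "\<And>F G. F \<subseteq> G \<Longrightarrow> G \<subseteq> E \<Longrightarrow> conv f g F G = conv f h F G"
  shows "F \<subseteq> G \<Longrightarrow> G \<subseteq> E \<Longrightarrow> g F G = h F G"
proof (induction "card (G - F)" arbitrary: F rule: less_induct)
  case less
  have fG: "finite G" using less.prems assms(1) finite_subset by blast
  have IH: "g H G = h H G" if "H \<in> {F..G} - {F}" for H
  proof -
    from that obtain x where "x \<in> H" "x \<notin> F" "F \<subseteq> H" "H \<subseteq> G" by auto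
    then have "G - H \<subset> G - F" by blast
    then show ?thesis using less.hyps[of H] less.prems that fG
      by (simp add: psubset_card_mono)
  qed
  have split: "conv f u F G = f F F * u F G + (\<Sum>H\<in>{F..G} - {F}. f F H * u H G)" for u
    unfolding conv_def using less.prems fG by (intro sum.remove) (auto simp: finite_set_interval)
  have "(\<Sum>H\<in>{F..G} - {F}. f F H * g H G) = (\<Sum>H\<in>{F..G} - {F}. f F H * h H G)"
    using IH by (intro sum.cong) auto
  moreover have "f F F = 1" using assms(2) less.prems by auto
  ultimately show ?case using assms(3)[OF less.prems] unfolding split by simp
qed

text \<open>From f (g f) = (f g) f = f = f delta, cancel \<open>f\<close> on the left.\<close>

lemma conv_left_inverse:
  assumes "finite E" "\<And>F. F \<subseteq> E \<Longrightarrow> f F F = 1"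
    and "\<And>F G. F \<subseteq> G \<Longrightarrow> G \<subseteq> E \<Longrightarrow> conv f g F G = delta F G"
    and "F \<subseteq> G" "G \<subseteq> E"
  shows "conv g f F G = delta F G"
proof (rule conv_cancel_left[of E f "conv g f" delta])
  fix F G assume FG: "F \<subseteq> G" "G \<subseteq> E"
  then have fG: "finite G" using assms(1) finite_subset by blast
  have "conv f (conv g f) F G = conv (conv f g) f F G" by (simp add: conv_assoc fG)
  also have "\<dots> = conv delta f F G"
    by (rule conv_cong) (use assms(3) FG in auto)
  also have "\<dots> = conv f delta F G" using FG fG by (simp add: conv_delta_left conv_delta_right)
  finally show "conv f (conv g f) F G = conv f delta F G" .
qed (use assms in auto)

section \<open>Loops and minors\<close>

lemma loopless_iff_rank:
  assumes M: "is_matroid M"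
  shows "loopless M \<longleftrightarrow> (\<forall>e\<in>ground M. 0 < rank_of M {e})"
proof -
  have "(\<exists>B\<in>bases M. e \<in> B) \<longleftrightarrow> 0 < rank_of M {e}" if e: "e \<in> ground M" for e
  proof -
    have "(\<exists>B\<in>bases M. e \<in> B) \<longleftrightarrow> indep M {e}" by (simp add: indep_def)
    also have "\<dots> \<longleftrightarrow> rank_of M {e} = 1" using indep_iff_rank[OF M, of "{e}"] e by simp
    also have "\<dots> \<longleftrightarrow> 0 < rank_of M {e}" using rank_of_le_card[OF M, of "{e}"] by auto
    finally show ?thesis .
  qed
  then show ?thesis by (simp add: loopless_def)
qed

lemma rank_of_insert_loop:
  assumes M: "is_matroid M" and "rank_of M {e} = 0"
  shows "rank_of M (insert e X) = rank_of M X"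
proof -
  have "e \<notin> B" if "B \<in> bases M" for B
    using rank_of_bound[OF M that, of "{e}"] assms by (cases "e \<in> B") auto
  then have "(\<lambda>B. card (B \<inter> insert e X)) ` bases M = (\<lambda>B. card (B \<inter> X)) ` bases M"
    by (intro image_cong) auto
  then show ?thesis by (simp add: rank_of_def)
qed

text \<open>A loop of the contraction is an element that does not raise the rank of
  \<open>F\<close>.\<close>

lemma loopless_contract_iff:
  assumes M: "is_matroid M" and F: "F \<subseteq> ground M"
  shows "loopless (contract_by M F) \<longleftrightarrow> F \<in> flats M"
proof -
  have "0 < rank_of (contract_by M F) {e} \<longleftrightarrow> rank_of M F < rank_of M (insert e F)"
    if "e \<in> ground M - F" for e
    using that rank_of_contract[OF M F, of "{e}"] by simp
  then show ?thesis using F by (auto simp: loopless_iff_rank is_matroid_contract[OF M F] flats_def)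
qed

lemma loopless_restrict:
  assumes M: "is_matroid M" and F: "F \<subseteq> ground M" and "loopless M"
  shows "loopless (restrict_to M F)"
  using assms by (auto simp: loopless_iff_rank is_matroid_restrict rank_of_restrict)

text \<open>A loopless contraction forces \<open>F\<close> to be a flat, and every flat contains all
  loops of \<open>M\<close>.\<close>

lemma loop_of_restriction:
  assumes M: "is_matroid M" and F: "F \<subseteq> ground M" and "\<not> loopless M"
    and c: "loopless (contract_by M F)"
  shows "\<not> loopless (restrict_to M F)"
proof -
  obtain e where e: "e \<in> ground M" "rank_of M {e} = 0"
    using assms by (auto simp: loopless_iff_rank)
  have "F \<in> flats M" using c loopless_contract_iff[OF M F] by simp
  then have "e \<in> F" using rank_of_insert_loop[OF M e(2), of F] e(1)
    unfolding flats_def by (metis (mono_tags, lifting) Diff_iff less_irrefl mem_Collect_eq)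
  then show ?thesis using e F
    by (auto simp: loopless_iff_rank is_matroid_restrict[OF M F] rank_of_restrict[OF M F])
qed

text \<open>Together with the convention that the Kazhdan--Lusztig polynomials vanish on matroids with
  loops, this allows all sums over flats to be taken over all subsets of the ground set, so that no
  Moebius function of the lattice of flats is needed.\<close>

lemma char_poly_loop:
  assumes M: "is_matroid M" and "\<not> loopless M"
  shows "char_poly_matroid M = 0"
proof -
  obtain e where e: "e \<in> ground M" "rank_of M {e} = 0"
    using assms by (auto simp: loopless_iff_rank)
  have P: "Pow (ground M) = {{}..ground M}" by auto
  show ?thesis unfolding char_poly_matroid_def P
  proof (rule alternating_interval_sum[of _ e])
    fix A assume A: "A \<subseteq> ground M" "e \<notin> A"
    then have "finite A" using matroid_finite_ground[OF M] finite_subset by blast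
    then show "(- 1) ^ card (insert e A) * monom 1 (rk M - rank_of M (insert e A)) =
         - ((- 1) ^ card A * monom (1::int) (rk M - rank_of M A))"
      using A rank_of_insert_loop[OF M e(2)] by simp
  qed (use e matroid_finite_ground[OF M] in auto)
qed

lemma sum_flats_eq_sum_Pow:
  fixes P :: "'a matroid \<Rightarrow> 'b::comm_ring_1"
  assumes M: "is_matroid M" and 0: "\<And>N. \<not> (is_matroid N \<and> loopless N) \<Longrightarrow> P N = 0"
  shows "(\<Sum>F\<in>flats M. g F * P (contract_by M F)) = (\<Sum>F\<in>Pow (ground M). g F * P (contract_by M F))"
  by (rule sum.mono_neutral_left)
    (use loopless_contract_iff[OF M] 0 matroid_finite_ground[OF M] in \<open>auto simp: flats_def\<close>)

lemma rk_0_iff_ground: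
  assumes M: "is_matroid M" and "loopless M"
  shows "rk M = 0 \<longleftrightarrow> ground M = {}"
proof
  assume r: "rk M = 0"
  show "ground M = {}"
  proof (rule ccontr)
    assume "ground M \<noteq> {}"
    then obtain e where e: "e \<in> ground M" by blast
    then have "rank_of M {e} \<le> rk M" by (intro rank_of_mono[OF M]) auto
    then show False using assms e r by (auto simp: loopless_iff_rank)
  qed
qed (use M in simp)

lemma contract_restrict_commute:
  assumes M: "is_matroid M" and FG: "F \<subseteq> G" "G \<subseteq> ground M"
  shows "restrict_to (contract_by M F) (G - F) = contract_by (restrict_to M G) F"
proof (rule matroid_eqI)
  have F: "F \<subseteq> ground M" using FG by blast
  note mc = is_matroid_contract[OF M F] and mr = is_matroid_restrict[OF M FG(2)]
  have G: "G - F \<subseteq> ground (contract_by M F)" using FG by auto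
  have F': "F \<subseteq> ground (restrict_to M G)" using FG by simp
  show "is_matroid (restrict_to (contract_by M F) (G - F))" using is_matroid_restrict[OF mc G] .
  show "is_matroid (contract_by (restrict_to M G) F)" using is_matroid_contract[OF mr F'] .
  fix X assume "X \<subseteq> ground (restrict_to (contract_by M F) (G - F))"
  then have X: "X \<subseteq> G - F" by simp
  then have X': "X \<subseteq> ground M" "X \<subseteq> ground (restrict_to M G)" "X \<union> F \<subseteq> G" using FG by auto
  show "rank_of (restrict_to (contract_by M F) (G - F)) X = rank_of (contract_by (restrict_to M G) F) X"
    by (simp add: rank_of_restrict[OF mc G X] rank_of_contract[OF mr F' X'(2)]
        rank_of_contract[OF M F X'(1)] rank_of_restrict[OF M FG(2) X'(3)] rank_of_restrict[OF M FG(2) FG(1)])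
qed simp

lemma restrict_restrict:
  assumes M: "is_matroid M" and FG: "F \<subseteq> G" "G \<subseteq> ground M"
  shows "restrict_to (restrict_to M G) F = restrict_to M F"
proof (rule matroid_eqI)
  have F: "F \<subseteq> ground M" using FG by blast
  note mr = is_matroid_restrict[OF M FG(2)]
  have F': "F \<subseteq> ground (restrict_to M G)" using FG by simp
  show "is_matroid (restrict_to (restrict_to M G) F)" using is_matroid_restrict[OF mr F'] .
  show "is_matroid (restrict_to M F)" using is_matroid_restrict[OF M F] .
  fix X assume "X \<subseteq> ground (restrict_to (restrict_to M G) F)"
  then have X: "X \<subseteq> F" by simp
  then show "rank_of (restrict_to (restrict_to M G) F) X = rank_of (restrict_to M F) X"
    using FG by (simp add: rank_of_restrict[OF mr F' X] rank_of_restrict[OF M FG(2)] rank_of_restrict[OF M F X])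
qed simp

lemma contract_contract:
  assumes M: "is_matroid M" and FG: "F \<subseteq> G" "G \<subseteq> ground M"
  shows "contract_by (contract_by M F) (G - F) = contract_by M G"
proof (rule matroid_eqI)
  have F: "F \<subseteq> ground M" using FG by blast
  note mc = is_matroid_contract[OF M F]
  have G': "G - F \<subseteq> ground (contract_by M F)" using FG by auto
  show "is_matroid (contract_by (contract_by M F) (G - F))" using is_matroid_contract[OF mc G'] .
  show "is_matroid (contract_by M G)" using is_matroid_contract[OF M FG(2)] .
  show "ground (contract_by (contract_by M F) (G - F)) = ground (contract_by M G)" using FG by auto
  fix X assume "X \<subseteq> ground (contract_by (contract_by M F) (G - F))"
  then have X: "X \<subseteq> ground (contract_by M F)" "X \<subseteq> ground M"
    "X \<union> (G - F) \<subseteq> ground M" "G - F \<subseteq> ground M"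
    using FG by auto
  have e: "X \<union> (G - F) \<union> F = X \<union> G" "G - F \<union> F = G" using FG by auto
  have "rank_of M F \<le> rank_of M G" using rank_of_mono[OF M FG(1)] .
  then show "rank_of (contract_by (contract_by M F) (G - F)) X = rank_of (contract_by M G) X"
    by (simp add: rank_of_contract[OF mc G' X(1)] rank_of_contract[OF M F X(3)]
        rank_of_contract[OF M F X(4)] rank_of_contract[OF M FG(2) X(2)] e del: Un_Diff_cancel2)
qed

lemma restrict_ground [simp]:
  assumes M: "is_matroid M" shows "restrict_to M (ground M) = M"
  by (rule matroid_eqI) (auto simp: is_matroid_restrict rank_of_restrict M)

lemma contract_empty [simp]:
  assumes M: "is_matroid M" shows "contract_by M {} = M"
  by (rule matroid_eqI) (auto simp: is_matroid_contract rank_of_contract M)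

section \<open>Existence and uniqueness of Kazhdan--Lusztig polynomials\<close>

lemma rev_poly_1: "rev_poly r 1 = monom 1 r"
  using rev_poly_monom[of 0 r 1] by simp

text \<open>The matroid of the interval from \<open>F\<close> to \<open>G\<close>. Its restrictions
  and contractions at a member of the interval are the matroids of the two subintervals, so any
  matroid invariant becomes a function in the incidence algebra.\<close>

definition minor :: "'a matroid \<Rightarrow> 'a set \<Rightarrow> 'a set \<Rightarrow> 'a matroid" where
  "minor M F G = contract_by (restrict_to M G) F"

context
  fixes M :: "'a matroid" and F G :: "'a set"
  assumes M: "is_matroid M" and FG: "F \<subseteq> G" "G \<subseteq> ground M"
begin

lemma is_matroid_minor: "is_matroid (minor M F G)"
  unfolding minor_def using M FG by (intro is_matroid_contract is_matroid_restrict) auto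

lemma ground_minor: "ground (minor M F G) = G - F"
  by (simp add: minor_def)

lemma rank_of_minor:
  assumes "X \<subseteq> G"
  shows "rank_of (minor M F G) X = rank_of M (X \<union> F) - rank_of M F"
proof -
  have "X \<union> F \<subseteq> G" using assms FG by auto
  then show ?thesis unfolding minor_def using assms FG
    by (simp add: rank_of_contract[OF is_matroid_restrict[OF M FG(2)]] rank_of_restrict[OF M FG(2)])
qed

lemma rk_minor: "rk (minor M F G) = rank_of M G - rank_of M F"
  using rank_of_minor[of "G - F"] FG by (simp add: ground_minor Un_absorb2)

lemma restrict_minor:
  assumes "F \<subseteq> H" "H \<subseteq> G"
  shows "restrict_to (minor M F G) (H - F) = minor M F H"
  unfolding minor_def using assms FG M
  by (simp add: contract_restrict_commute is_matroid_restrict restrict_restrict)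

lemma contract_minor:
  assumes "F \<subseteq> H" "H \<subseteq> G"
  shows "contract_by (minor M F G) (H - F) = minor M H G"
  unfolding minor_def using assms FG M
  by (simp add: contract_contract is_matroid_restrict)

end

lemma minor_empty: "is_matroid M \<Longrightarrow> G \<subseteq> ground M \<Longrightarrow> minor M {} G = restrict_to M G"
  by (simp add: minor_def is_matroid_restrict)

lemma minor_ground: "is_matroid M \<Longrightarrow> minor M F (ground M) = contract_by M F"
  by (simp add: minor_def)

lemma minor_refl:
  assumes M: "is_matroid M" and F: "F \<subseteq> ground M"
  shows "is_matroid (minor M F F) \<and> loopless (minor M F F) \<and> ground (minor M F F) = {}"
  using assms by (simp add: is_matroid_minor ground_minor loopless_def)

lemma sum_Pow_Diff:
  assumes "F \<subseteq> G"
  shows "(\<Sum>X\<in>Pow (G - F). h X) = (\<Sum>H\<in>{F..G}. h (H - F))"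
  using assms by (intro sum.reindex_bij_witness[of _ "\<lambda>H. H - F" "\<lambda>X. X \<union> F"])
    (auto intro!: arg_cong[of _ _ h])

section \<open>The Kazhdan-Lusztig kernel and the reversal of interval functions\<close>

definition mu_set :: "'a set \<Rightarrow> 'a set \<Rightarrow> int poly" where
  "mu_set F G = (-1) ^ (card F + card G)"

definition rank_monom :: "'a matroid \<Rightarrow> 'a set \<Rightarrow> 'a set \<Rightarrow> int poly" where
  "rank_monom M F G = monom 1 (rank_of M G - rank_of M F)"

text \<open>Write zeta for the constant function 1. Then \<open>mu_set\<close> is the inverse of
  zeta and \<open>rank_monom M\<close> is the image of zeta under \<open>bar M\<close>, so the
  kernel is zeta^-1 bar(zeta). This form shows why \<open>bar\<close> inverts it; that its values
  are characteristic polynomials is \<open>char_poly_minor\<close>.\<close>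

definition kernel :: "'a matroid \<Rightarrow> 'a set \<Rightarrow> 'a set \<Rightarrow> int poly" where
  "kernel M = conv mu_set (rank_monom M)"

definition bar :: "'a matroid \<Rightarrow> ('a set \<Rightarrow> 'a set \<Rightarrow> int poly) \<Rightarrow> 'a set \<Rightarrow> 'a set \<Rightarrow> int poly" where
  "bar M f F G = rev_poly (rank_of M G - rank_of M F) (f F G)"

lemma conv_refl: "conv f g F F = f F F * g F F"
  by (simp add: conv_def)

lemma kernel_refl: "kernel M F F = 1"
  by (simp add: kernel_def conv_refl mu_set_def rank_monom_def flip: power_add)

lemma char_poly_minor:
  assumes M: "is_matroid M" and FG: "F \<subseteq> G" "G \<subseteq> ground M"
  shows "char_poly_matroid (minor M F G) = kernel M F G"
proof -
  have fin: "finite G" using FG(2) matroid_finite_ground[OF M] finite_subset by blast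
  have "(- 1) ^ card (H - F) * monom 1 (rk (minor M F G) - rank_of (minor M F G) (H - F)) =
      mu_set F H * rank_monom M H G" if H: "H \<in> {F..G}" for H
  proof -
    from H have H': "F \<subseteq> H" "H \<subseteq> G" by auto
    then have finH: "finite H" "finite F" using fin FG finite_subset by blast+
    have "card H = card F + card (H - F)"
      using H' finH by (metis card_Diff_subset card_mono le_add_diff_inverse)
    then have "(- 1 :: int poly) ^ card (H - F) = (- 1) ^ (card F + card H)"
      by (simp add: power_add flip: mult.assoc power_mult_distrib)
    moreover have "rank_of (minor M F G) (H - F) = rank_of M H - rank_of M F"
      using rank_of_minor[OF M FG, of "H - F"] H' by (auto simp: Un_absorb2)
    moreover have "rank_of M F \<le> rank_of M H" using rank_of_mono[OF M H'(1)] .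
    ultimately show ?thesis
      by (simp add: rk_minor[OF M FG] mu_set_def rank_monom_def)
  qed
  then show ?thesis
    unfolding char_poly_matroid_def ground_minor[OF M FG] sum_Pow_Diff[OF FG(1)]
      kernel_def conv_def rk_minor[OF M FG]
    by (intro sum.cong) (simp_all add: rk_minor[OF M FG] ground_minor[OF M FG])
qed

lemma conv_mu_zeta:
  assumes "finite G" "F \<subseteq> G"
  shows "conv (\<lambda>_ _. 1) mu_set F G = delta F G"
proof (cases "F = G")
  case False
  then obtain e where e: "e \<in> G" "e \<notin> F" using assms by blast
  have "(\<Sum>H\<in>{F..G}. mu_set H G) = 0"
    by (rule alternating_interval_sum[OF assms(1) e])
      (use assms in \<open>auto simp: mu_set_def finite_subset\<close>)
  then show ?thesis using False by (simp add: conv_def delta_def)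
qed (simp add: conv_refl delta_def mu_set_def flip: power_add)

lemma conv_mu_one:
  assumes "finite G" "F \<subseteq> G"
  shows "conv mu_set (\<lambda>_ _. 1) F G = delta F G"
proof (rule conv_left_inverse[OF assms(1)])
  show "conv (\<lambda>_ _. 1) mu_set F' G' = delta F' G'" if "F' \<subseteq> G'" "G' \<subseteq> G" for F' G'
    using that assms(1) by (intro conv_mu_zeta) (auto intro: finite_subset)
qed (use assms in auto)

lemma degree_conv_le:
  assumes M: "is_matroid M" and fin: "finite G"
    and "\<And>H. F \<subseteq> H \<Longrightarrow> H \<subseteq> G \<Longrightarrow> degree (f F H) \<le> rank_of M H - rank_of M F"
    and "\<And>H. F \<subseteq> H \<Longrightarrow> H \<subseteq> G \<Longrightarrow> degree (g H G) \<le> rank_of M G - rank_of M H"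
  shows "degree (conv f g F G) \<le> rank_of M G - rank_of M F"
  unfolding conv_def
proof (rule degree_sum_le)
  fix H assume "H \<in> {F..G}"
  then have H: "F \<subseteq> H" "H \<subseteq> G" by auto
  show "degree (f F H * g H G) \<le> rank_of M G - rank_of M F"
    using degree_mult_le[of "f F H" "g H G"] assms(3,4)[OF H]
      rank_of_mono[OF M H(1)] rank_of_mono[OF M H(2)] by linarith
qed (simp add: fin finite_set_interval)

text \<open>Rank differences add up along \<open>F \<subseteq> H \<subseteq> G\<close>, so each
  product splits by \<open>rev_poly_mult\<close>. The degree bounds are what makes
  \<open>rev_poly\<close> agree with t^r p(1/t).\<close>

lemma bar_conv:
  assumes M: "is_matroid M" and fin: "finite G"
    and "\<And>H. F \<subseteq> H \<Longrightarrow> H \<subseteq> G \<Longrightarrow> degree (f F H) \<le> rank_of M H - rank_of M F"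
    and "\<And>H. F \<subseteq> H \<Longrightarrow> H \<subseteq> G \<Longrightarrow> degree (g H G) \<le> rank_of M G - rank_of M H"
  shows "bar M (conv f g) F G = conv (bar M f) (bar M g) F G"
proof -
  have *: "rev_poly (rank_of M G - rank_of M F) (f F H * g H G) = bar M f F H * bar M g H G"
    and **: "degree (f F H * g H G) \<le> rank_of M G - rank_of M F"
    if "H \<in> {F..G}" for H
  proof -
    from that have H: "F \<subseteq> H" "H \<subseteq> G" by auto
    have eq: "rank_of M G - rank_of M F =
        (rank_of M H - rank_of M F) + (rank_of M G - rank_of M H)"
      using rank_of_mono[OF M H(1)] rank_of_mono[OF M H(2)] by simp
    show "rev_poly (rank_of M G - rank_of M F) (f F H * g H G) = bar M f F H * bar M g H G"
      unfolding eq bar_def using assms(3,4)[OF H] by (rule rev_poly_mult)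
    show "degree (f F H * g H G) \<le> rank_of M G - rank_of M F"
      unfolding eq using degree_mult_le[of "f F H" "g H G"] assms(3,4)[OF H] by linarith
  qed
  have "bar M (conv f g) F G = (\<Sum>H\<in>{F..G}. rev_poly (rank_of M G - rank_of M F) (f F H * g H G))"
    unfolding bar_def conv_def using ** by (rule rev_poly_sum)
  also have "\<dots> = conv (bar M f) (bar M g) F G"
    unfolding conv_def using * by (rule sum.cong[OF refl])
  finally show ?thesis .
qed

lemma degree_mu_set [simp]: "degree (mu_set F G) = 0"
  by (cases "even (card F + card G)") (simp_all add: mu_set_def)

lemma degree_rank_monom: "degree (rank_monom M F G) \<le> rank_of M G - rank_of M F"
  by (simp add: rank_monom_def degree_monom_le)

lemma degree_kernel:
  "is_matroid M \<Longrightarrow> finite G \<Longrightarrow> degree (kernel M F G) \<le> rank_of M G - rank_of M F"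
  unfolding kernel_def by (rule degree_conv_le) (simp_all add: degree_rank_monom)

text \<open>In bar(zeta^-1) zeta zeta^-1 bar(zeta) the inner pair cancels, and then the outer one.
  The local \<open>m\<close> is bar(zeta^-1): reversing a constant sign multiplies it by the full
  power of t.\<close>

lemma bar_kernel_conv_kernel:
  assumes M: "is_matroid M" and FG: "F \<subseteq> G" "G \<subseteq> ground M"
  shows "conv (bar M (kernel M)) (kernel M) F G = delta F G"
proof -
  define m where "m F G = mu_set F G * rank_monom M F G" for F G
  have fin: "finite H" if "H \<subseteq> ground M" for H
    using that matroid_finite_ground[OF M] finite_subset by blast
  have finG: "finite G" using fin FG by blast
  have "bar M (kernel M) F H = conv m (\<lambda>_ _. 1) F H" if H: "F \<subseteq> H" "H \<subseteq> G" for H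
  proof -
    have "bar M (kernel M) F H = conv (bar M mu_set) (bar M (rank_monom M)) F H"
      unfolding kernel_def by (rule bar_conv) (use M H FG fin in \<open>auto simp: degree_rank_monom\<close>)
    also have "\<dots> = conv m (\<lambda>_ _. 1) F H"
    proof (rule conv_cong)
      fix A
      show "bar M mu_set F A = m F A"
        using rev_poly_mult_const[of 1 "rank_of M A - rank_of M F" "card F + card A"]
        by (simp add: bar_def mu_set_def m_def rank_monom_def rev_poly_1)
      show "bar M (rank_monom M) A H = 1" by (simp add: bar_def rank_monom_def rev_poly_monom)
    qed
    finally show ?thesis .
  qed
  then have "conv (bar M (kernel M)) (kernel M) F G =
      conv (conv m (\<lambda>_ _. 1)) (conv mu_set (rank_monom M)) F G"
    by (intro conv_cong) (auto simp: kernel_def)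
  also have "\<dots> = conv m (conv (conv (\<lambda>_ _. 1) mu_set) (rank_monom M)) F G"
    unfolding conv_assoc[OF finG, of m] by (rule conv_cong) (simp_all add: conv_assoc finG)
  also have "\<dots> = conv m (rank_monom M) F G"
  proof (rule conv_cong)
    fix H assume H: "F \<subseteq> H" "H \<subseteq> G"
    have "conv (conv (\<lambda>_ _. 1) mu_set) (rank_monom M) H G = conv delta (rank_monom M) H G"
      by (rule conv_cong) (use H FG fin in \<open>auto intro!: conv_mu_zeta\<close>)
    then show "conv (conv (\<lambda>_ _. 1) mu_set) (rank_monom M) H G = rank_monom M H G"
      using H finG by (simp add: conv_delta_left)
  qed simp
  \<comment> \<open>The powers of t at \<open>F \<subseteq> H \<subseteq> G\<close> multiply to one
    that does not depend on \<open>H\<close>, so it can be pulled out and plain Moebius inversion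
    remains.\<close>
  also have "\<dots> = rank_monom M F G * conv mu_set (\<lambda>_ _. 1) F G"
    unfolding conv_def sum_distrib_left
  proof (rule sum.cong)
    fix H assume "H \<in> {F..G}"
    then have "rank_of M F \<le> rank_of M H" "rank_of M H \<le> rank_of M G"
      using rank_of_mono[OF M] by auto
    then have "rank_monom M F H * rank_monom M H G = rank_monom M F G"
      by (simp add: rank_monom_def mult_monom)
    then show "m F H * rank_monom M H G = rank_monom M F G * (mu_set F H * 1)"
      by (simp add: m_def mult_ac)
  qed simp
  also have "\<dots> = delta F G"
    using conv_mu_one[OF finG FG(1)] by (auto simp: delta_def rank_monom_def)
  finally show ?thesis .
qed

text \<open>If \<open>M\<close> has a loop, each summand has a zero factor: either the contraction
  has a loop, or the restriction does. The value \<open>u\<close> stands for the reversed polynomial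
  of \<open>M\<close>.\<close>

lemma sum_char_poly_flats:
  assumes M: "is_matroid M" and 0: "\<And>N. \<not> (is_matroid N \<and> loopless N) \<Longrightarrow> P N = 0"
    and rel: "loopless M \<Longrightarrow> u = (\<Sum>F\<in>flats M. char_poly_matroid (restrict_to M F) * P (contract_by M F))"
    and u: "\<not> loopless M \<Longrightarrow> u = 0"
  shows "u = (\<Sum>F\<in>Pow (ground M). char_poly_matroid (restrict_to M F) * P (contract_by M F))"
proof (cases "loopless M")
  case True
  show ?thesis unfolding rel[OF True] by (rule sum_flats_eq_sum_Pow[OF M 0])
next
  case False
  have "char_poly_matroid (restrict_to M F) * P (contract_by M F) = 0" if F: "F \<subseteq> ground M" for F
  proof (cases "loopless (contract_by M F)")
    case True
    then have "char_poly_matroid (restrict_to M F) = 0"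
      using loop_of_restriction[OF M F False] char_poly_loop[OF is_matroid_restrict[OF M F]] by blast
    then show ?thesis by simp
  next
    case False
    then show ?thesis using 0[of "contract_by M F"] by simp
  qed
  then have "(\<Sum>F\<in>Pow (ground M). char_poly_matroid (restrict_to M F) * P (contract_by M F)) = 0"
    by (intro sum.neutral) auto
  then show ?thesis using u[OF False] by simp
qed

lemma sum_Pow_minor:
  assumes M: "is_matroid M" and FG: "F \<subseteq> G" "G \<subseteq> ground M"
  shows "(\<Sum>X\<in>Pow (ground (minor M F G)).
      f (restrict_to (minor M F G) X) * g (contract_by (minor M F G) X)) =
    conv (\<lambda>F G. f (minor M F G)) (\<lambda>F G. g (minor M F G)) F G"
  unfolding ground_minor[OF M FG] sum_Pow_Diff[OF FG(1)] conv_def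
  by (intro sum.cong) (auto simp: restrict_minor[OF M FG] contract_minor[OF M FG])

text \<open>The Kazhdan-Lusztig relation as the equation bar(P) = kernel P. It is assumed for the
  minor in question only, because the existence proof applies this inside an induction, where the
  relation is known for smaller matroids alone.\<close>

lemma KL_relation_minor:
  assumes M: "is_matroid M" and FG: "F \<subseteq> G" "G \<subseteq> ground M"
    and 0: "\<And>N. \<not> (is_matroid N \<and> loopless N) \<Longrightarrow> P N = 0"
    and rel: "\<And>N. N = minor M F G \<Longrightarrow> loopless N \<Longrightarrow> rev_poly (rk N) (P N) =
      (\<Sum>F\<in>flats N. char_poly_matroid (restrict_to N F) * P (contract_by N F))"
  shows "bar M (\<lambda>F G. P (minor M F G)) F G = conv (kernel M) (\<lambda>F G. P (minor M F G)) F G"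
proof -
  define N where "N = minor M F G"
  have "rev_poly (rk N) (P N) =
      (\<Sum>F\<in>Pow (ground N). char_poly_matroid (restrict_to N F) * P (contract_by N F))"
    by (rule sum_char_poly_flats)
      (use 0 rel is_matroid_minor[OF M FG] in \<open>auto simp: N_def\<close>)
  also have "\<dots> = conv (\<lambda>F G. char_poly_matroid (minor M F G)) (\<lambda>F G. P (minor M F G)) F G"
    unfolding N_def by (rule sum_Pow_minor[OF M FG])
  also have "\<dots> = conv (kernel M) (\<lambda>F G. P (minor M F G)) F G"
    by (rule conv_cong) (use char_poly_minor[OF M] FG in auto)
  finally show ?thesis by (simp add: N_def bar_def rk_minor[OF M FG])
qed

text \<open>The bound \<open>(rk M + 1) div 2\<close> makes \<open>poly_cutoff\<close> keep exactly
  the exponents \<open>i\<close> with \<open>2 * i < rk M\<close>, for both parities. Summing over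
  all non-empty subsets agrees with summing over flats because contractions with loops get the value
  0; it also makes the size of the ground set a termination measure.\<close>

function KL_rec :: "'a matroid \<Rightarrow> int poly" where
  "KL_rec M = (if is_matroid M \<and> loopless M then
     if ground M = {} then 1
     else poly_cutoff ((rk M + 1) div 2)
       (- (\<Sum>F\<in>Pow (ground M) - {{}}. char_poly_matroid (restrict_to M F) * KL_rec (contract_by M F)))
     else 0)"
  by pat_completeness auto
termination
proof (relation "measure (\<lambda>M. card (ground M))")
  fix M :: "'a matroid" and F
  assume "is_matroid M \<and> loopless M" "F \<in> Pow (ground M) - {{}}"
  then show "(contract_by M F, M) \<in> measure (\<lambda>M. card (ground M))"
    by (auto simp: matroid_finite_ground intro!: psubset_card_mono)
qed simp

declare KL_rec.simps [simp del]

lemma KL_rec_0: "\<not> (is_matroid M \<and> loopless M) \<Longrightarrow> KL_rec M = 0"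
  by (subst KL_rec.simps) auto

lemma degree_KL_rec:
  assumes M: "is_matroid M"
  shows "0 < rk M \<Longrightarrow> 2 * degree (KL_rec M) < rk M" and "degree (KL_rec M) \<le> rk M"
proof -
  have "ground M \<noteq> {} \<or> rk M = 0" using M by auto
  then have *: "KL_rec M = 0 \<or> (rk M = 0 \<and> KL_rec M = 1) \<or> (\<exists>p. KL_rec M = poly_cutoff ((rk M + 1) div 2) p)"
    by (subst (1 2 3) KL_rec.simps) (use M in auto)
  have "degree (poly_cutoff n p) \<le> n - 1" for n and p :: "int poly"
    by (intro degree_le) (auto simp: coeff_poly_cutoff)
  note ** = this[of "(rk M + 1) div 2"]
  show "0 < rk M \<Longrightarrow> 2 * degree (KL_rec M) < rk M"
  proof -
    assume "0 < rk M"
    then consider "KL_rec M = 0" | p where "KL_rec M = poly_cutoff ((rk M + 1) div 2) p" using * by auto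
    then show ?thesis
    proof cases
      case 2
      then have "degree (KL_rec M) \<le> (rk M + 1) div 2 - 1" using ** by simp
      then show ?thesis using \<open>0 < rk M\<close> by linarith
    qed (use \<open>0 < rk M\<close> in simp)
  qed
  show "degree (KL_rec M) \<le> rk M" using * **
    by (cases "rk M") (force intro: order_trans)+
qed

text \<open>The Kazhdan--Lusztig relation reads \<open>rev p = p + S\<close>, where \<open>S\<close> collects the terms of the
  non-empty flats; it is solvable with \<open>p\<close> of low degree because \<open>S\<close> is antisymmetric.\<close>

lemma antisymmetric_cutoff:
  assumes "degree S \<le> r" and anti: "rev_poly r S = - S"
  defines "p \<equiv> poly_cutoff ((r + 1) div 2) (- S)"
  shows "rev_poly r p = p + S"
proof (rule poly_eqI)
  fix e
  have c: "coeff p i = (if 2 * i < r then - coeff S i else 0)" for i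
    by (auto simp: p_def coeff_poly_cutoff)
  have "degree p \<le> r" by (intro degree_le) (simp add: c)
  note rp = coeff_rev_poly[OF this]
  have S: "coeff S e = - (if e \<le> r then coeff S (r - e) else 0)" for e
    using arg_cong[OF anti, of "\<lambda>q. coeff q e"] coeff_rev_poly[OF assms(1), of e] by simp
  show "coeff (rev_poly r p) e = coeff (p + S) e"
  proof (cases "2 * e = r")
    case True
    \<comment> \<open>The middle coefficient belongs to neither half, but antisymmetry makes it its
      own negative, hence 0.\<close>
    then have "r - e = e" by simp
    then show ?thesis using S[of e] True by (simp add: rp c)
  next
    case False
    show ?thesis
    proof (cases "e \<le> r")
      case True
      then show ?thesis using False S[of e] by (auto simp: rp c)
    qed (use S[of e] in \<open>simp add: rp c\<close>)
  qed
qed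

text \<open>By induction, bar(p) = kernel p holds on every interval from a non-empty
  \<open>F\<close> to the ground set. This is enough to compute the reversal of \<open>S\<close>,
  which comes out as p - (p + S) = - S, the antisymmetry that \<open>antisymmetric_cutoff\<close>
  asks for.\<close>

lemma KL_rec_relation:
  assumes "is_matroid M" "loopless M"
  shows "rev_poly (rk M) (KL_rec M) =
    (\<Sum>F\<in>flats M. char_poly_matroid (restrict_to M F) * KL_rec (contract_by M F))"
  using assms
proof (induction "card (ground M)" arbitrary: M rule: less_induct)
  case less
  note M = less.prems(1)
  define E where "E = ground M"
  have finE: "finite E" using matroid_finite_ground[OF M] by (simp add: E_def)
  define p where "p F G = KL_rec (minor M F G)" for F G
  define S where "S = (\<Sum>F\<in>{{}..E} - {{}}. kernel M {} F * p F E)"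
  have Pow: "Pow E = {{}..E}" by auto
  have pE: "p F E = KL_rec (contract_by M F)" for F
    by (simp add: p_def E_def minor_ground[OF M])
  have kE: "char_poly_matroid (restrict_to M F) = kernel M {} F" if "F \<subseteq> E" for F
    using char_poly_minor[OF M, of "{}" F] that minor_empty[OF M, of F] by (simp add: E_def)
  have rE: "rank_of M E - rank_of M {} = rk M" using M by (simp add: E_def)
  have split: "conv f p {} E = f {} {} * p {} E + (\<Sum>F\<in>{{}..E} - {{}}. f {} F * p F E)" for f
    unfolding conv_def using finE by (intro sum.remove) (auto simp: finite_set_interval)
  have goal: "(\<Sum>F\<in>flats M. char_poly_matroid (restrict_to M F) * KL_rec (contract_by M F)) =
      p {} E + S"
  proof -
    have "(\<Sum>F\<in>flats M. char_poly_matroid (restrict_to M F) * KL_rec (contract_by M F)) =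
        (\<Sum>F\<in>Pow E. char_poly_matroid (restrict_to M F) * KL_rec (contract_by M F))"
      unfolding E_def by (rule sum_flats_eq_sum_Pow[OF M KL_rec_0])
    also have "\<dots> = conv (kernel M) p {} E"
      unfolding Pow conv_def by (intro sum.cong) (auto simp: kE pE)
    finally show ?thesis by (simp add: split kernel_refl S_def)
  qed
  have degp: "degree (p F E) \<le> rank_of M E - rank_of M F" if "F \<subseteq> E" for F
    using degree_KL_rec(2)[OF is_matroid_minor[OF M that]] rk_minor[OF M that]
    by (simp add: p_def E_def)
  have eqF: "rk M = (rank_of M F - rank_of M {}) + (rank_of M E - rank_of M F)" if "F \<subseteq> E" for F
    using that rank_of_mono[OF M that] M by (simp add: E_def)
  have degk: "degree (kernel M {} F) \<le> rank_of M F - rank_of M {}" if "F \<subseteq> E" for F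
    using degree_kernel[OF M, of F "{}"] that finE finite_subset by blast
  have degS: "degree (kernel M {} F * p F E) \<le> rk M" if "F \<subseteq> E" for F
    unfolding eqF[OF that] using degree_mult_le[of "kernel M {} F" "p F E"] degp[OF that] degk[OF that]
    by linarith
  have barp: "bar M p F E = conv (kernel M) p F E" if F: "F \<subseteq> E" "F \<noteq> {}" for F
    unfolding p_def
  proof (rule KL_relation_minor[OF M F(1)])
    fix N assume N: "N = minor M F E" "loopless N"
    have "ground N = E - F" using ground_minor[OF M F(1)] by (simp add: N E_def)
    then have "card (ground N) < card (ground M)"
      using F finE unfolding E_def by (intro psubset_card_mono) auto
    then show "rev_poly (rk N) (KL_rec N) =
        (\<Sum>F\<in>flats N. char_poly_matroid (restrict_to N F) * KL_rec (contract_by N F))"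
      using less.hyps[of N] N is_matroid_minor[OF M F(1)] by (simp add: E_def)
  qed (use KL_rec_0 in \<open>auto simp: E_def\<close>)
  have "rev_poly (rk M) S = (\<Sum>F\<in>{{}..E} - {{}}. rev_poly (rk M) (kernel M {} F * p F E))"
    unfolding S_def by (rule rev_poly_sum) (use degS in auto)
  also have "\<dots> = (\<Sum>F\<in>{{}..E} - {{}}. bar M (kernel M) {} F * conv (kernel M) p F E)"
  proof (rule sum.cong)
    fix F assume "F \<in> {{}..E} - {{}}"
    then have F: "F \<subseteq> E" "F \<noteq> {}" by auto
    have "rev_poly (rk M) (kernel M {} F * p F E) = bar M (kernel M) {} F * bar M p F E"
      unfolding eqF[OF F(1)] bar_def by (rule rev_poly_mult) (use degp degk F in auto)
    then show "rev_poly (rk M) (kernel M {} F * p F E) = bar M (kernel M) {} F * conv (kernel M) p F E"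
      using barp[OF F] by simp
  qed simp
  \<comment> \<open>Adding and subtracting the term for \<open>F = {}\<close> completes the sum to a
    convolution, which collapses to \<open>p\<close> since \<open>bar\<close> inverts the
    kernel.\<close>
  also have "\<dots> = conv (bar M (kernel M)) (conv (kernel M) p) {} E - conv (kernel M) p {} E"
  proof -
    have "conv (bar M (kernel M)) (conv (kernel M) p) {} E =
        bar M (kernel M) {} {} * conv (kernel M) p {} E +
        (\<Sum>F\<in>{{}..E} - {{}}. bar M (kernel M) {} F * conv (kernel M) p F E)"
      unfolding conv_def[of "bar M (kernel M)"]
      using finE by (intro sum.remove) (auto simp: finite_set_interval)
    moreover have "bar M (kernel M) {} {} = 1" using rev_poly_monom[of 0 0 1] by (simp add: bar_def kernel_refl)
    ultimately show ?thesis by simp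
  qed
  also have "conv (bar M (kernel M)) (conv (kernel M) p) {} E = conv (conv (bar M (kernel M)) (kernel M)) p {} E"
    by (simp add: conv_assoc finE)
  also have "\<dots> = conv delta p {} E"
    by (rule conv_cong) (use bar_kernel_conv_kernel[OF M] in \<open>auto simp: E_def\<close>)
  also have "\<dots> = p {} E" using finE by (simp add: conv_delta_left)
  also have "conv (kernel M) p {} E = p {} E + S" by (simp add: split kernel_refl S_def)
  finally have anti: "rev_poly (rk M) S = - S" by simp
  show ?case unfolding goal
  proof (cases "E = {}")
    case True
    then have "p {} E = 1" unfolding pE
      using less.prems by (simp add: E_def KL_rec.simps[of M])
    moreover have "S = 0" "rk M = 0" using True M by (simp_all add: S_def E_def)
    ultimately show "rev_poly (rk M) (KL_rec M) = p {} E + S"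
      using rev_poly_monom[of 0 0 1] M by (simp add: pE)
  next
    case False
    have "degree S \<le> rk M" unfolding S_def
      by (rule degree_sum_le) (use degS finE in \<open>auto simp: finite_set_interval\<close>)
    moreover have "KL_rec M = poly_cutoff ((rk M + 1) div 2) (- S)"
    proof -
      have "(\<Sum>F\<in>Pow E - {{}}. char_poly_matroid (restrict_to M F) * KL_rec (contract_by M F)) = S"
        unfolding S_def Pow by (intro sum.cong) (auto simp: kE pE)
      then show ?thesis using less.prems False by (subst KL_rec.simps) (simp add: E_def)
    qed
    ultimately show "rev_poly (rk M) (KL_rec M) = p {} E + S"
      using antisymmetric_cutoff[OF _ anti] M by (simp add: pE)
  qed
qed

lemma is_KL_assignment_KL_rec: "is_KL_assignment KL_rec"
proof -
  have "KL_rec M = 1" if "is_matroid M" "loopless M" "rk M = 0" for M :: "'a matroid"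
    using that rk_0_iff_ground[of M] by (subst KL_rec.simps) simp
  then show ?thesis
    unfolding is_KL_assignment_def using degree_KL_rec(1) KL_rec_relation KL_rec_0 by blast
qed

text \<open>One of \<open>e\<close> and \<open>r - e\<close> is at least r / 2 and thus beyond the
  degree, and the two coefficients are equal.\<close>

lemma palindromic_low_degree_eq_0:
  assumes "rev_poly r d = d" "2 * degree d < r"
  shows "d = 0"
proof (rule poly_eqI)
  fix e
  have "coeff d e = (if e \<le> r then coeff d (r - e) else 0)"
    using coeff_rev_poly[of d r e] assms by simp
  moreover have "coeff d e = 0 \<or> e \<le> degree d" "coeff d (r - e) = 0 \<or> r - e \<le> degree d"
    using le_degree by blast+
  ultimately show "coeff d e = coeff 0 e" using assms(2) by (auto split: if_splits)
qed

lemma KL_assignment_unique: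
  fixes P P' :: "'a matroid \<Rightarrow> int poly"
  assumes P: "is_KL_assignment P" and P': "is_KL_assignment P'"
  shows "P M = P' M"
proof (induction "card (ground M)" arbitrary: M rule: less_induct)
  case less
  show ?case
  proof (cases "is_matroid M \<and> loopless M \<and> 0 < rk M")
    case False
    then show ?thesis using P P' unfolding is_KL_assignment_def by (metis gr0I)
  next
    case True
    then have M: "is_matroid M" "loopless M" "0 < rk M" by auto
    have fin: "finite (ground M)" using matroid_finite_ground[OF M(1)] .
    define R where "R A = (\<Sum>F\<in>flats M - {{}}. char_poly_matroid (restrict_to M F) * A (contract_by M F))"
      for A :: "'a matroid \<Rightarrow> int poly"
    have rel: "rev_poly (rk M) (A M) = A M + R A" and deg: "2 * degree (A M) < rk M"
      if A: "is_KL_assignment A" for A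
    proof -
      have "{} \<in> flats M"
        using loopless_contract_iff[OF M(1), of "{}"] M by simp
      moreover have "finite (flats M)" using fin by (auto simp: flats_def)
      moreover have "char_poly_matroid (restrict_to M {}) = 1"
        using char_poly_minor[OF M(1), of "{}" "{}"] minor_empty[OF M(1), of "{}"]
        by (simp add: kernel_refl)
      ultimately have "(\<Sum>F\<in>flats M. char_poly_matroid (restrict_to M F) * A (contract_by M F)) = A M + R A"
        unfolding R_def by (subst sum.remove[of _ "{}"]) (simp_all add: M)
      then show "rev_poly (rk M) (A M) = A M + R A" "2 * degree (A M) < rk M"
        using A M unfolding is_KL_assignment_def by auto
    qed
    have "R P = R P'" unfolding R_def
    proof (intro sum.cong refl arg_cong2[of _ _ _ _ "(*)"])
      fix F assume "F \<in> flats M - {{}}"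
      then have "F \<subseteq> ground M" "F \<noteq> {}" by (auto simp: flats_def)
      then have "card (ground (contract_by M F)) < card (ground M)"
        using fin by (auto intro!: psubset_card_mono)
      then show "P (contract_by M F) = P' (contract_by M F)" by (rule less.hyps)
    qed
    define d where "d = P M - P' M"
    have degd: "2 * degree d < rk M"
      using degree_diff_le_max[of "P M" "P' M"] deg[OF P] deg[OF P'] by (simp add: d_def)
    \<comment> \<open>Additivity for two summands, read off from \<open>rev_poly_sum\<close> over a
      two-element index set.\<close>
    have "rev_poly (rk M) (\<Sum>i\<in>{True, False}. if i then P M else - P' M) =
        (\<Sum>i\<in>{True, False}. rev_poly (rk M) (if i then P M else - P' M))"
      by (rule rev_poly_sum) (use deg[OF P] deg[OF P'] in auto)
    then have "rev_poly (rk M) d = rev_poly (rk M) (P M) + rev_poly (rk M) (- P' M)"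
      by (simp add: d_def)
    also have "rev_poly (rk M) (- P' M) = - rev_poly (rk M) (P' M)"
      by (rule rev_poly_uminus) (use deg[OF P'] in simp)
    finally have "rev_poly (rk M) d = d"
      using rel[OF P] rel[OF P'] \<open>R P = R P'\<close> by (simp add: d_def)
    then have "d = 0" using palindromic_low_degree_eq_0 degd by blast
    then show ?thesis by (simp add: d_def)
  qed
qed

lemma is_KL_assignment_KL_poly: "is_KL_assignment KL_poly"
  unfolding KL_poly_def
proof (rule theI[of is_KL_assignment, OF is_KL_assignment_KL_rec])
  fix P :: "'a matroid \<Rightarrow> int poly" assume "is_KL_assignment P"
  then show "P = KL_rec" using KL_assignment_unique is_KL_assignment_KL_rec by blast
qed

section \<open>Inverse Kazhdan--Lusztig polynomials\<close>

lemma KL_poly_0: "\<not> (is_matroid M \<and> loopless M) \<Longrightarrow> KL_poly M = 0"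
  and KL_poly_rank_0: "is_matroid M \<Longrightarrow> loopless M \<Longrightarrow> rk M = 0 \<Longrightarrow> KL_poly M = 1"
  and KL_poly_relation: "is_matroid M \<Longrightarrow> loopless M \<Longrightarrow> rev_poly (rk M) (KL_poly M) =
    (\<Sum>F\<in>flats M. char_poly_matroid (restrict_to M F) * KL_poly (contract_by M F))"
  using is_KL_assignment_KL_poly unfolding is_KL_assignment_def by blast+

lemma degree_KL_poly: "is_matroid M \<Longrightarrow> 0 < rk M \<Longrightarrow> 2 * degree (KL_poly M) < rk M"
  using is_KL_assignment_KL_poly KL_poly_0[of M] unfolding is_KL_assignment_def
  by (cases "loopless M") auto

lemma degree_KL_poly_le: "is_matroid M \<Longrightarrow> degree (KL_poly M) \<le> rk M"
  using degree_KL_poly[of M] KL_poly_rank_0[of M] KL_poly_0[of M]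
  by (cases "loopless M"; cases "rk M = 0") auto

section \<open>Existence, uniqueness and degree of the inverse polynomials\<close>

function inverse_KL_rec :: "'a matroid \<Rightarrow> int poly" where
  "inverse_KL_rec M = (if is_matroid M \<and> loopless M then
     if ground M = {} then 1
     else - (\<Sum>F\<in>Pow (ground M) - {{}}.
       (-1) ^ rank_of M F * KL_poly (restrict_to M F) * inverse_KL_rec (contract_by M F))
     else 0)"
  by pat_completeness auto
termination
proof (relation "measure (\<lambda>M. card (ground M))")
  fix M :: "'a matroid" and F
  assume "is_matroid M \<and> loopless M" "F \<in> Pow (ground M) - {{}}"
  then show "(contract_by M F, M) \<in> measure (\<lambda>M. card (ground M))"
    by (auto simp: matroid_finite_ground intro!: psubset_card_mono)
qed simp

declare inverse_KL_rec.simps [simp del]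

lemma inverse_KL_rec_0: "\<not> (is_matroid M \<and> loopless M) \<Longrightarrow> inverse_KL_rec M = 0"
  by (subst inverse_KL_rec.simps) auto

lemma KL_poly_restrict_empty:
  assumes M: "is_matroid M" shows "KL_poly (restrict_to M {}) = 1"
proof -
  have "is_matroid (restrict_to M {})" using is_matroid_restrict[OF M] by simp
  moreover from this have "rk (restrict_to M {}) = 0" by simp
  ultimately show ?thesis by (intro KL_poly_rank_0) (auto simp: loopless_def)
qed

lemma inverse_KL_sum_split:
  assumes M: "is_matroid M"
    and 0: "\<And>N. \<not> (is_matroid N \<and> loopless N) \<Longrightarrow> A N = 0"
  shows "(\<Sum>F\<in>flats M. (-1) ^ rank_of M F * KL_poly (restrict_to M F) * A (contract_by M F)) =
    A M + (\<Sum>F\<in>Pow (ground M) - {{}}. (-1) ^ rank_of M F * KL_poly (restrict_to M F) * A (contract_by M F))"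
    (is "?L = _ + ?R")
proof -
  have "?L = (\<Sum>F\<in>Pow (ground M). (-1) ^ rank_of M F * KL_poly (restrict_to M F) * A (contract_by M F))"
    by (rule sum_flats_eq_sum_Pow[OF M 0])
  also have "\<dots> = (-1) ^ rank_of M {} * KL_poly (restrict_to M {}) * A (contract_by M {}) + ?R"
    using matroid_finite_ground[OF M] by (intro sum.remove) auto
  finally show ?thesis using M by (simp add: KL_poly_restrict_empty)
qed

lemma is_inverse_KL_assignment_rec: "is_inverse_KL_assignment inverse_KL_rec"
  unfolding is_inverse_KL_assignment_def
proof (intro conjI allI impI)
  fix M :: "'a matroid"
  assume "\<not> (is_matroid M \<and> loopless M)"
  then show "inverse_KL_rec M = 0" by (rule inverse_KL_rec_0)
next
  fix M :: "'a matroid"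
  assume "is_matroid M \<and> loopless M" "rk M = 0"
  then show "inverse_KL_rec M = 1"
    using rk_0_iff_ground[of M] by (subst inverse_KL_rec.simps) simp
next
  fix M :: "'a matroid"
  assume M: "is_matroid M \<and> loopless M" "0 < rk M"
  then have "ground M \<noteq> {}" using rk_0_iff_ground[of M] by auto
  then show "(\<Sum>F\<in>flats M. (- 1) ^ rank_of M F * KL_poly (restrict_to M F) * inverse_KL_rec (contract_by M F)) = 0"
    using M by (subst inverse_KL_sum_split[OF _ inverse_KL_rec_0])
      (auto simp: inverse_KL_rec.simps[of M])
qed

lemma inverse_KL_assignment_unique:
  fixes Q Q' :: "'a matroid \<Rightarrow> int poly"
  assumes Q: "is_inverse_KL_assignment Q" and Q': "is_inverse_KL_assignment Q'"
  shows "Q M = Q' M"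
proof (induction "card (ground M)" arbitrary: M rule: less_induct)
  case less
  show ?case
  proof (cases "is_matroid M \<and> loopless M \<and> 0 < rk M")
    case False
    then show ?thesis using Q Q' unfolding is_inverse_KL_assignment_def by (metis gr0I)
  next
    case True
    then have M: "is_matroid M" "loopless M" "0 < rk M" by auto
    define R where "R A = (\<Sum>F\<in>Pow (ground M) - {{}}.
      (-1) ^ rank_of M F * KL_poly (restrict_to M F) * A (contract_by M F))"
      for A :: "'a matroid \<Rightarrow> int poly"
    have rel: "A M + R A = 0" if A: "is_inverse_KL_assignment A" for A
      using A M inverse_KL_sum_split[OF M(1), of A]
      unfolding is_inverse_KL_assignment_def R_def by simp
    have "R Q = R Q'" unfolding R_def
    proof (intro sum.cong refl arg_cong2[of _ _ _ _ "(*)"])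
      fix F assume "F \<in> Pow (ground M) - {{}}"
      then have "card (ground (contract_by M F)) < card (ground M)"
        using matroid_finite_ground[OF M(1)] by (auto intro!: psubset_card_mono)
      then show "Q (contract_by M F) = Q' (contract_by M F)" by (rule less.hyps)
    qed
    then show ?thesis using rel[OF Q] rel[OF Q'] by (metis add_right_imp_eq)
  qed
qed

lemma inverse_KL_poly_eq_rec: "inverse_KL_poly = inverse_KL_rec"
  unfolding inverse_KL_poly_def
proof (rule the_equality[of is_inverse_KL_assignment, OF is_inverse_KL_assignment_rec])
  fix Q :: "'a matroid \<Rightarrow> int poly" assume "is_inverse_KL_assignment Q"
  then show "Q = inverse_KL_rec" using inverse_KL_assignment_unique is_inverse_KL_assignment_rec by blast
qed

lemma inverse_KL_poly_0: "\<not> (is_matroid M \<and> loopless M) \<Longrightarrow> inverse_KL_poly M = 0"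
  by (simp add: inverse_KL_poly_eq_rec inverse_KL_rec_0)

lemma inverse_KL_poly_empty:
  "is_matroid M \<Longrightarrow> ground M = {} \<Longrightarrow> inverse_KL_poly M = 1"
  unfolding inverse_KL_poly_eq_rec by (subst inverse_KL_rec.simps) (simp add: loopless_def)

lemma inverse_KL_poly_rec:
  assumes "is_matroid M" "loopless M" "ground M \<noteq> {}"
  shows "inverse_KL_poly M = - (\<Sum>F\<in>Pow (ground M) - {{}}.
       (-1) ^ rank_of M F * KL_poly (restrict_to M F) * inverse_KL_poly (contract_by M F))"
  unfolding inverse_KL_poly_eq_rec using assms by (subst inverse_KL_rec.simps) simp

text \<open>The recursion for Q contains no degree condition; the bound is inherited from P. A
  non-empty \<open>F\<close> has positive rank in a loopless matroid, so the factor P has degree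
  strictly below half the rank of \<open>F\<close>, and this one strict inequality carries the whole
  product.\<close>

lemma degree_inverse_KL_poly:
  assumes "is_matroid M" "0 < rk M"
  shows "2 * degree (inverse_KL_poly M) < rk M"
  using assms
proof (induction "card (ground M)" arbitrary: M rule: less_induct)
  case less
  note M = less.prems(1)
  show ?case
  proof (cases "loopless M")
    case False
    then show ?thesis using less.prems by (simp add: inverse_KL_poly_0)
  next
    case True
    have g: "ground M \<noteq> {}" using rk_0_iff_ground[OF M True] less.prems by simp
    have "degree (inverse_KL_poly M) < (rk M + 1) div 2"
      unfolding inverse_KL_poly_rec[OF M True g] degree_minus
    proof (rule degree_sum_less)
      fix F assume F: "F \<in> Pow (ground M) - {{}}"
      then have F': "F \<subseteq> ground M" "F \<noteq> {}" by auto
      note mr = is_matroid_restrict[OF M F'(1)] and mc = is_matroid_contract[OF M F'(1)]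
      have rF: "rk (restrict_to M F) = rank_of M F" using rank_of_restrict[OF M F'(1)] by simp
      have cF: "rk (contract_by M F) = rk M - rank_of M F"
        using rank_of_contract[OF M F'(1), of "ground M - F"] F' by (simp add: Un_absorb2)
      have "0 < rank_of M F"
        using rk_0_iff_ground[OF mr loopless_restrict[OF M F'(1) True]] F' rF by simp
      then have 1: "2 * degree (KL_poly (restrict_to M F)) < rank_of M F"
        using degree_KL_poly[OF mr] rF by simp
      \<comment> \<open>Not strict: for a contraction of rank 0 both sides are 0.\<close>
      have 2: "2 * degree (inverse_KL_poly (contract_by M F)) \<le> rk M - rank_of M F"
      proof (cases "rk (contract_by M F) = 0")
        case True
        then have "inverse_KL_poly (contract_by M F) = 1 \<or> inverse_KL_poly (contract_by M F) = 0"
          using rk_0_iff_ground[OF mc] inverse_KL_poly_empty[OF mc] inverse_KL_poly_0[of "contract_by M F"]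
          by blast
        then show ?thesis by auto
      next
        case False
        have "card (ground (contract_by M F)) < card (ground M)"
          using F matroid_finite_ground[OF M] by (auto intro!: psubset_card_mono)
        then show ?thesis using less.hyps[OF _ mc] False cF by simp
      qed
      have 3: "rank_of M F \<le> rk M" using rank_of_mono[OF M F'(1)] .
      have "degree ((- 1) ^ rank_of M F * KL_poly (restrict_to M F) * inverse_KL_poly (contract_by M F)) \<le>
          degree (KL_poly (restrict_to M F)) + degree (inverse_KL_poly (contract_by M F))"
        using degree_mult_le[of "KL_poly (restrict_to M F)" "inverse_KL_poly (contract_by M F)"]
        by (cases "even (rank_of M F)") simp_all
      then show "degree ((- 1) ^ rank_of M F * KL_poly (restrict_to M F) * inverse_KL_poly (contract_by M F)) <
          (rk M + 1) div 2"
        using 1 2 3 by linarith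
    qed (use less.prems in simp)
    then show ?thesis by linarith
  qed
qed

text \<open>The sign is moved from the restriction, where the defining relation of Q has it, to the
  contraction that carries Q. In this form it is the inverse of P in the incidence algebra.\<close>

definition signed_inverse :: "'a matroid \<Rightarrow> 'a set \<Rightarrow> 'a set \<Rightarrow> int poly" where
  "signed_inverse M F G = (-1) ^ (rank_of M G - rank_of M F) * inverse_KL_poly (minor M F G)"

lemma degree_signed_inverse:
  assumes M: "is_matroid M" and FG: "F \<subseteq> G" "G \<subseteq> ground M"
  shows "rank_of M F < rank_of M G \<Longrightarrow> 2 * degree (signed_inverse M F G) < rank_of M G - rank_of M F"
    and "degree (signed_inverse M F G) \<le> rank_of M G - rank_of M F"
proof -
  define N where "N = minor M F G"
  have N: "is_matroid N" "rk N = rank_of M G - rank_of M F"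
    using is_matroid_minor[OF M FG] rk_minor[OF M FG] by (simp_all add: N_def)
  have d: "degree (signed_inverse M F G) = degree (inverse_KL_poly N)"
    by (cases "even (rank_of M G - rank_of M F)") (simp_all add: signed_inverse_def N_def)
  show *: "rank_of M F < rank_of M G \<Longrightarrow> 2 * degree (signed_inverse M F G) < rank_of M G - rank_of M F"
    using degree_inverse_KL_poly[OF N(1)] N(2) d by simp
  show "degree (signed_inverse M F G) \<le> rank_of M G - rank_of M F"
  proof (cases "rk N = 0")
    case True
    then have "inverse_KL_poly N = 1 \<or> inverse_KL_poly N = 0"
      using rk_0_iff_ground[OF N(1)] inverse_KL_poly_empty[OF N(1)] inverse_KL_poly_0[of N] by blast
    then show ?thesis using d by auto
  qed (use * N in simp)
qed

text \<open>The two sign conventions differ by the global factor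
  \<open>(-1) ^ (rank_of M G - rank_of M F)\<close>, which is 1 for \<open>F = G\<close> and does
  not affect a vanishing sum. Intervals whose minor has a loop are covered too, since P or Q of a
  matroid with a loop occurs in each of their summands.\<close>

lemma conv_KL_signed_inverse:
  assumes M: "is_matroid M" and FG: "F \<subseteq> G" "G \<subseteq> ground M"
  shows "conv (\<lambda>F G. KL_poly (minor M F G)) (signed_inverse M) F G = delta F G"
proof -
  define N where "N = minor M F G"
  have N: "is_matroid N" "rk N = rank_of M G - rank_of M F" "ground N = G - F"
    using is_matroid_minor[OF M FG] rk_minor[OF M FG] ground_minor[OF M FG] by (simp_all add: N_def)
  have "(\<Sum>X\<in>Pow (ground N). (-1) ^ rank_of N X * KL_poly (restrict_to N X) * inverse_KL_poly (contract_by N X)) =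
      delta F G" (is "sum ?f _ = _")
  proof (cases "loopless N")
    case True
    have split: "sum ?f (Pow (ground N)) = inverse_KL_poly N + sum ?f (Pow (ground N) - {{}})"
      using matroid_finite_ground[OF N(1)] N
      by (subst sum.remove[of _ "{}"]) (auto simp: KL_poly_restrict_empty)
    show ?thesis
    proof (cases "ground N = {}")
      case True
      then show ?thesis using split N FG by (auto simp: inverse_KL_poly_empty delta_def)
    next
      case False
      then have "F \<noteq> G" using N by auto
      then show ?thesis unfolding split
        using inverse_KL_poly_rec[OF N(1) True False] by (simp add: delta_def)
    qed
  next
    case False
    have "?f X = 0" if X: "X \<subseteq> ground N" for X
      using loop_of_restriction[OF N(1) X False] KL_poly_0[of "restrict_to N X"]
        inverse_KL_poly_0[of "contract_by N X"] by auto
    then have "sum ?f (Pow (ground N)) = 0" by (intro sum.neutral) auto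
    moreover have "F \<noteq> G" using False N by (auto simp: loopless_def)
    ultimately show ?thesis by (simp add: delta_def)
  qed
  also have "sum ?f (Pow (ground N)) = (\<Sum>H\<in>{F..G}. ?f (H - F))"
    unfolding N(3) by (rule sum_Pow_Diff[OF FG(1)])
  also have "\<dots> = (-1) ^ (rank_of M G - rank_of M F) * conv (\<lambda>F G. KL_poly (minor M F G)) (signed_inverse M) F G"
    unfolding conv_def sum_distrib_left
  proof (rule sum.cong)
    fix H assume "H \<in> {F..G}"
    then have H: "F \<subseteq> H" "H \<subseteq> G" by auto
    have r: "rank_of N (H - F) = rank_of M H - rank_of M F"
      using rank_of_minor[OF M FG, of "H - F"] H by (auto simp: N_def Un_absorb2)
    have "(rank_of M G - rank_of M F) + (rank_of M G - rank_of M H) =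
        (rank_of M H - rank_of M F) + 2 * (rank_of M G - rank_of M H)"
      using rank_of_mono[OF M H(1)] rank_of_mono[OF M H(2)] by simp
    then have sgn: "(- 1 :: int poly) ^ (rank_of M G - rank_of M F) * (- 1) ^ (rank_of M G - rank_of M H) =
        (- 1) ^ (rank_of M H - rank_of M F)"
      by (metis (no_types) power_add power_mult power2_minus power_one mult.right_neutral)
    have "(- 1) ^ (rank_of M H - rank_of M F) * KL_poly (minor M F H) * inverse_KL_poly (minor M H G) =
       (- 1) ^ (rank_of M G - rank_of M F) * (KL_poly (minor M F H) * signed_inverse M H G)"
      unfolding signed_inverse_def sgn[symmetric] by (simp only: mult_ac)
    then show "?f (H - F) = (- 1) ^ (rank_of M G - rank_of M F) * (KL_poly (minor M F H) * signed_inverse M H G)"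
      using H by (simp add: r, simp add: N_def restrict_minor[OF M FG] contract_minor[OF M FG])
  qed simp
  finally have eq: "(-1) ^ (rank_of M G - rank_of M F) *
      conv (\<lambda>F G. KL_poly (minor M F G)) (signed_inverse M) F G = delta F G" .
  show ?thesis
  proof (cases "F = G")
    case True
    then show ?thesis using eq by simp
  next
    case False
    then show ?thesis using eq by (simp add: delta_def)
  qed
qed

text \<open>Since Q inverts P, the relation bar(P) = kernel P becomes kernel = bar(P) Q; multiplying
  on the left by bar(Q), the inverse of bar(P), gives the claim. With the kernel on the right, the
  lower end of the interval can stay fixed at the empty set, so that only restrictions of
  \<open>M\<close> occur.\<close>

lemma signed_inverse_left_relation:
  assumes M: "is_matroid M" and FG: "F \<subseteq> G" "G \<subseteq> ground M"
  shows "conv (bar M (signed_inverse M)) (kernel M) F G = signed_inverse M F G"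
proof -
  define P where "P F G = KL_poly (minor M F G)" for F G
  define Q where "Q = signed_inverse M"
  have finE: "finite (ground M)" using matroid_finite_ground[OF M] .
  have fin: "finite H" if "H \<subseteq> ground M" for H using that finE finite_subset by blast
  have PQ: "conv P Q F G = delta F G" if "F \<subseteq> G" "G \<subseteq> ground M" for F G
    unfolding P_def[abs_def] Q_def using conv_KL_signed_inverse[OF M that] .
  have P1: "P F F = 1" if "F \<subseteq> ground M" for F
  proof -
    have "rk (minor M F F) = 0" using rk_minor[OF M order_refl that] by simp
    then show ?thesis using minor_refl[OF M that] by (simp add: P_def KL_poly_rank_0)
  qed
  have QP: "conv Q P F G = delta F G" if "F \<subseteq> G" "G \<subseteq> ground M" for F G
    using conv_left_inverse[OF finE P1 PQ that] .
  have barP: "bar M P F G = conv (kernel M) P F G" if "F \<subseteq> G" "G \<subseteq> ground M" for F G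
    unfolding P_def[abs_def]
    by (rule KL_relation_minor[OF M that])
      (use KL_poly_0 KL_poly_relation is_matroid_minor[OF M that] in blast)+
  have ker: "kernel M F G = conv (bar M P) Q F G" if FG: "F \<subseteq> G" "G \<subseteq> ground M" for F G
  proof -
    have "conv (bar M P) Q F G = conv (conv (kernel M) P) Q F G"
      by (rule conv_cong) (use FG barP in auto)
    also have "\<dots> = conv (kernel M) (conv P Q) F G" by (simp add: conv_assoc fin FG)
    also have "\<dots> = conv (kernel M) delta F G"
      by (rule conv_cong) (use FG PQ in auto)
    also have "\<dots> = kernel M F G" using FG fin by (simp add: conv_delta_right)
    finally show ?thesis by simp
  qed
  have degP: "degree (P F G) \<le> rank_of M G - rank_of M F" if "F \<subseteq> G" "G \<subseteq> ground M" for F G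
    using degree_KL_poly_le[OF is_matroid_minor[OF M that]] rk_minor[OF M that] by (simp add: P_def)
  have barQP: "conv (bar M Q) (bar M P) F G = delta F G" if FG: "F \<subseteq> G" "G \<subseteq> ground M" for F G
  proof -
    have "conv (bar M Q) (bar M P) F G = bar M (conv Q P) F G"
      by (rule bar_conv[symmetric])
        (use M FG fin degP degree_signed_inverse(2)[OF M] in \<open>auto simp: Q_def\<close>)
    also have "\<dots> = delta F G"
      using QP[OF FG] by (simp add: bar_def delta_def rev_poly_1)
    finally show ?thesis .
  qed
  have "conv (bar M Q) (kernel M) F G = conv (bar M Q) (conv (bar M P) Q) F G"
    by (rule conv_cong) (use FG ker in auto)
  also have "\<dots> = conv (conv (bar M Q) (bar M P)) Q F G" by (simp add: conv_assoc fin FG)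
  also have "\<dots> = conv delta Q F G"
    by (rule conv_cong) (use FG barQP in auto)
  also have "\<dots> = Q F G" using FG fin by (simp add: conv_delta_left)
  finally show ?thesis by (simp add: Q_def)
qed

text \<open>The family of all \<open>(-1)^r Q\<close> of the restrictions of a matroid solves a recursion that involves
  nothing but the rank function.\<close>

definition left_KL :: "('a set \<Rightarrow> nat) \<Rightarrow> 'a set \<Rightarrow> ('a set \<Rightarrow> int poly) \<Rightarrow> bool" where
  "left_KL \<rho> E q \<longleftrightarrow> (\<forall>X\<subseteq>E.
     (\<rho> X = 0 \<longrightarrow> q X = 1) \<and> (0 < \<rho> X \<longrightarrow> 2 * degree (q X) < \<rho> X) \<and>
     q X = (\<Sum>Z\<in>Pow X. rev_poly (\<rho> Z) (q Z) *
       (\<Sum>A\<in>{Z..X}. (-1) ^ (card Z + card A) * monom 1 (\<rho> X - \<rho> A))))"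

lemma left_KL_inverse_KL_poly:
  assumes M: "is_matroid M" and "loopless M"
  shows "left_KL (rank_of M) (ground M)
    (\<lambda>X. (-1) ^ rank_of M X * inverse_KL_poly (restrict_to M X))"
  unfolding left_KL_def
proof (intro allI impI conjI)
  fix X assume X: "X \<subseteq> ground M"
  have q: "(-1) ^ rank_of M Z * inverse_KL_poly (restrict_to M Z) = signed_inverse M {} Z"
    if "Z \<subseteq> ground M" for Z
    using that M by (simp add: signed_inverse_def minor_empty)
  show "(-1) ^ rank_of M X * inverse_KL_poly (restrict_to M X) = 1" if "rank_of M X = 0"
    using that rk_0_iff_ground[OF is_matroid_restrict[OF M X] loopless_restrict[OF M X assms(2)]]
      rank_of_restrict[OF M X order_refl]
    by (simp add: inverse_KL_poly_empty is_matroid_restrict M)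
  show "2 * degree ((-1) ^ rank_of M X * inverse_KL_poly (restrict_to M X)) < rank_of M X"
    if "0 < rank_of M X"
    using degree_signed_inverse(1)[OF M empty_subsetI X] that M q[OF X] by simp
  have Pow: "Pow X = {{}..X}" by auto
  have "signed_inverse M {} X = conv (bar M (signed_inverse M)) (kernel M) {} X"
    using signed_inverse_left_relation[OF M empty_subsetI X] by simp
  also have "\<dots> = (\<Sum>Z\<in>Pow X. rev_poly (rank_of M Z) (signed_inverse M {} Z) *
       (\<Sum>A\<in>{Z..X}. (-1) ^ (card Z + card A) * monom 1 (rank_of M X - rank_of M A)))"
    using M by (simp add: conv_def Pow bar_def kernel_def mu_set_def rank_monom_def)
  finally show "(-1) ^ rank_of M X * inverse_KL_poly (restrict_to M X) =
      (\<Sum>Z\<in>Pow X. rev_poly (rank_of M Z) ((-1) ^ rank_of M Z * inverse_KL_poly (restrict_to M Z)) *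
       (\<Sum>A\<in>{Z..X}. (-1) ^ (card Z + card A) * monom 1 (rank_of M X - rank_of M A)))"
    using q X by (simp add: q[OF X] subset_trans cong: sum.cong)
      (intro sum.cong refl, use q X in auto)
qed

section \<open>Chain expansion of the coefficients\<close>

text \<open>The first argument is fuel; any value \<open>\<ge> \<rho> X\<close> gives the coefficient of \<open>t^j\<close>. The inequalities inside
  \<open>of_bool\<close> make the truncated subtraction exact.\<close>

primrec left_KL_coeff :: "nat \<Rightarrow> ('a set \<Rightarrow> nat) \<Rightarrow> 'a set \<Rightarrow> nat \<Rightarrow> int" where
  "left_KL_coeff 0 \<rho> X j = of_bool (\<rho> X = 0 \<and> j = 0)"
| "left_KL_coeff (Suc f) \<rho> X j =
     of_bool (\<rho> X = 0 \<and> j = 0) +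
     of_bool (2 * j < \<rho> X) * (\<Sum>A\<in>Pow X. \<Sum>Z\<in>Pow A.
       (-1) ^ (card Z + card A) *
       of_bool (\<rho> Z < \<rho> X \<and> \<rho> X \<le> \<rho> A + j \<and> \<rho> A + j \<le> \<rho> X + \<rho> Z) *
       left_KL_coeff f \<rho> Z (\<rho> Z + \<rho> X - \<rho> A - j))"

lemma left_KL_rank_0: "left_KL \<rho> E q \<Longrightarrow> X \<subseteq> E \<Longrightarrow> \<rho> X = 0 \<Longrightarrow> q X = 1"
  and left_KL_degree: "left_KL \<rho> E q \<Longrightarrow> X \<subseteq> E \<Longrightarrow> 0 < \<rho> X \<Longrightarrow> 2 * degree (q X) < \<rho> X"
  and left_KL_relation: "left_KL \<rho> E q \<Longrightarrow> X \<subseteq> E \<Longrightarrow> q X = (\<Sum>Z\<in>Pow X. rev_poly (\<rho> Z) (q Z) *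
       (\<Sum>A\<in>{Z..X}. (-1) ^ (card Z + card A) * monom 1 (\<rho> X - \<rho> A)))"
  unfolding left_KL_def by blast+

lemma left_KL_degree_le: "left_KL \<rho> E q \<Longrightarrow> X \<subseteq> E \<Longrightarrow> degree (q X) \<le> \<rho> X"
  using left_KL_rank_0[of \<rho> E q X] left_KL_degree[of \<rho> E q X] by (cases "\<rho> X = 0") auto

lemma sum_Pow_interval_swap:
  assumes "finite X"
  shows "(\<Sum>Z\<in>Pow X. \<Sum>A\<in>{Z..X}. g Z A) = (\<Sum>A\<in>Pow X. \<Sum>Z\<in>Pow A. g Z A)"
proof -
  have 1: "{Z..X} = {A\<in>Pow X. Z \<subseteq> A}" and 2: "Z \<in> Pow X \<Longrightarrow> Pow Z = {A\<in>Pow X. A \<subseteq> Z}" for Z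
    by auto
  have "(\<Sum>Z\<in>Pow X. \<Sum>A\<in>{Z..X}. g Z A) = (\<Sum>A\<in>Pow X. \<Sum>Z\<in>{Z\<in>Pow X. Z \<subseteq> A}. g Z A)"
    unfolding 1 by (rule sum.swap_restrict) (simp_all add: assms)
  also have "\<dots> = (\<Sum>A\<in>Pow X. \<Sum>Z\<in>Pow A. g Z A)"
    by (intro sum.cong refl 2[symmetric])
  finally show ?thesis .
qed

text \<open>Induction on the fuel needs every surviving \<open>Z\<close> to have smaller rank than
  \<open>X\<close>. The terms with \<open>\<rho> Z = \<rho> X\<close> cancel or vanish, and this
  justifies the factor \<open>of_bool (\<rho> Z < \<rho> X)\<close> in the unfolding.\<close>

lemma left_KL_coeff_eq:
  assumes q: "left_KL \<rho> E q" and fin: "finite E"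
    and mono: "\<And>X Y. X \<subseteq> Y \<Longrightarrow> Y \<subseteq> E \<Longrightarrow> \<rho> X \<le> \<rho> Y"
  shows "X \<subseteq> E \<Longrightarrow> \<rho> X \<le> f \<Longrightarrow> coeff (q X) j = left_KL_coeff f \<rho> X j"
proof (induction f arbitrary: X j)
  case 0
  then show ?case using left_KL_rank_0[OF q] by simp
next
  case (Suc f)
  note X = Suc.prems(1)
  have finX: "finite X" using X fin finite_subset by blast
  show ?case
  proof (cases "\<rho> X = 0")
    case True
    then show ?thesis using left_KL_rank_0[OF q X] by simp
  next
    case False
    then have deg: "2 * degree (q X) < \<rho> X" using left_KL_degree[OF q X] by simp
    show ?thesis
    proof (cases "2 * j < \<rho> X")
      case j: False
      then have "coeff (q X) j = 0" using deg by (intro coeff_eq_0) simp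
      then show ?thesis using j False by simp
    next
      case j: True
      define T where "T Z A = (-1) ^ (card Z + card A) * (if \<rho> X \<le> \<rho> A + j \<and> \<rho> A + j \<le> \<rho> X + \<rho> Z
        then coeff (q Z) (\<rho> Z + \<rho> X - \<rho> A - j) else 0)" for Z A
      have T: "coeff (rev_poly (\<rho> Z) (q Z) * ((-1) ^ (card Z + card A) * monom 1 (\<rho> X - \<rho> A))) j = T Z A"
        if ZA: "Z \<subseteq> A" "A \<subseteq> X" for Z A
      proof -
        have le: "\<rho> A \<le> \<rho> X" using mono ZA X by blast
        have d: "degree (q Z) \<le> \<rho> Z" using left_KL_degree_le[OF q, of Z] ZA X by blast
        have "coeff (monom 1 (\<rho> X - \<rho> A) * rev_poly (\<rho> Z) (q Z)) j =
          (if \<rho> X \<le> \<rho> A + j \<and> \<rho> A + j \<le> \<rho> X + \<rho> Z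
             then coeff (q Z) (\<rho> Z + \<rho> X - \<rho> A - j) else 0)"
          using le by (auto simp: coeff_monom_mult coeff_rev_poly[OF d] intro!: arg_cong[of _ _ "coeff (q Z)"])
        then show ?thesis
          by (cases "even (card Z + card A)") (simp_all add: T_def mult_ac)
      qed
      have "coeff (q X) j = coeff (\<Sum>Z\<in>Pow X. rev_poly (\<rho> Z) (q Z) *
          (\<Sum>A\<in>{Z..X}. (-1) ^ (card Z + card A) * monom 1 (\<rho> X - \<rho> A))) j"
        by (rule arg_cong[OF left_KL_relation[OF q X]])
      also have "\<dots> = (\<Sum>Z\<in>Pow X. \<Sum>A\<in>{Z..X}. T Z A)"
        unfolding coeff_sum sum_distrib_left by (intro sum.cong refl T) auto
      also have "\<dots> = (\<Sum>Z\<in>Pow X. \<Sum>A\<in>{Z..X}. of_bool (\<rho> Z < \<rho> X) * T Z A)"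
      proof (rule sum.cong)
        fix Z assume "Z \<in> Pow X"
        then have Z: "Z \<subseteq> X" by simp
        show "(\<Sum>A\<in>{Z..X}. T Z A) = (\<Sum>A\<in>{Z..X}. of_bool (\<rho> Z < \<rho> X) * T Z A)"
        proof (cases "\<rho> Z < \<rho> X")
          case False
          then have rZ: "\<rho> Z = \<rho> X" using mono[OF Z X] by simp
          have rA: "\<rho> A = \<rho> X" if "Z \<subseteq> A" "A \<subseteq> X" for A
            using mono[OF that(1)] mono[OF that(2) X] that X rZ by fastforce
          have "(\<Sum>A\<in>{Z..X}. T Z A) = 0"
          proof (cases "Z = X")
            case True
            \<comment> \<open>The self-referential term \<open>Z = A = X\<close> asks for the
              coefficient opposite to \<open>j\<close>, which lies above half the rank.\<close>
            have "coeff (q X) (\<rho> X - j) = 0" using deg j by (intro coeff_eq_0) simp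
            then show ?thesis using True j by (simp add: T_def)
          next
            case False
            \<comment> \<open>The rank is constant between \<open>Z\<close> and \<open>X\<close>, so
              adding \<open>e\<close> to \<open>A\<close> changes nothing but the sign.\<close>
            then obtain e where e: "e \<in> X" "e \<notin> Z" using Z by blast
            show ?thesis
            proof (rule alternating_interval_sum[OF finX e])
              fix A assume A: "Z \<subseteq> A" "A \<subseteq> X" "e \<notin> A"
              then have "finite A" "\<rho> (insert e A) = \<rho> X" "\<rho> A = \<rho> X"
                using finX finite_subset rA[of "insert e A"] rA[of A] e by auto
              then show "T Z (insert e A) = - T Z A" using A by (simp add: T_def)
            qed
          qed
          then show ?thesis using False by simp
        qed simp
      qed simp
      also have "\<dots> = (\<Sum>A\<in>Pow X. \<Sum>Z\<in>Pow A. of_bool (\<rho> Z < \<rho> X) * T Z A)"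
        by (rule sum_Pow_interval_swap[OF finX])
      also have "\<dots> = (\<Sum>A\<in>Pow X. \<Sum>Z\<in>Pow A. (-1) ^ (card Z + card A) *
          of_bool (\<rho> Z < \<rho> X \<and> \<rho> X \<le> \<rho> A + j \<and> \<rho> A + j \<le> \<rho> X + \<rho> Z) *
          left_KL_coeff f \<rho> Z (\<rho> Z + \<rho> X - \<rho> A - j))"
      proof (intro sum.cong refl)
        fix A Z assume "A \<in> Pow X" "Z \<in> Pow A"
        then have "Z \<subseteq> E" using X by auto
        then have "\<rho> Z < \<rho> X \<Longrightarrow> coeff (q Z) j' = left_KL_coeff f \<rho> Z j'" for j'
          using Suc.IH[of Z j'] Suc.prems(2) by simp
        then show "of_bool (\<rho> Z < \<rho> X) * T Z A = (-1) ^ (card Z + card A) *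
          of_bool (\<rho> Z < \<rho> X \<and> \<rho> X \<le> \<rho> A + j \<and> \<rho> A + j \<le> \<rho> X + \<rho> Z) *
          left_KL_coeff f \<rho> Z (\<rho> Z + \<rho> X - \<rho> A - j)"
          by (auto simp: T_def)
      qed
      finally show ?thesis using False j by simp
    qed
  qed
qed

text \<open>Chains are listed from the smallest set upwards, so \<open>hd (xs @ [E])\<close> is the smallest member of
  a chain, or \<open>E\<close> if the chain is empty.\<close>

definition set_chains :: "nat \<Rightarrow> 'a set \<Rightarrow> 'a set list set" where
  "set_chains k E = {xs. length xs = k \<and> sorted_wrt (\<subseteq>) xs \<and> set xs \<subseteq> Pow E}"

definition chain_sign :: "'a set list \<Rightarrow> int" where
  "chain_sign xs = (-1) ^ sum_list (map card xs)"

lemma finite_chains: "finite E \<Longrightarrow> finite (set_chains k E)"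
  by (rule finite_subset[OF _ finite_lists_length_eq[of "Pow E" k]]) (auto simp: set_chains_def)

lemma chains_0: "set_chains 0 E = {[]}"
  by (auto simp: set_chains_def)

lemma sum_chains_Suc:
  assumes fin: "finite E"
  shows "(\<Sum>xs\<in>set_chains (Suc k) E. g xs) = (\<Sum>xs\<in>set_chains k E. \<Sum>Z\<in>Pow (hd (xs @ [E])). g (Z # xs))"
proof -
  have sub: "Z \<subseteq> hd (xs @ [E]) \<longleftrightarrow> (\<forall>x\<in>set xs. Z \<subseteq> x) \<and> Z \<subseteq> E" if "xs \<in> set_chains k E" for Z xs
    using that by (cases xs) (simp_all add: set_chains_def, blast)
  have mem: "Z # xs \<in> set_chains (Suc k) E \<longleftrightarrow> xs \<in> set_chains k E \<and> Z \<subseteq> hd (xs @ [E])" for Z xs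
    using sub[of xs Z] by (auto simp: set_chains_def)
  have ne: "\<exists>Z xs. ys = Z # xs" if "ys \<in> set_chains (Suc k) E" for ys
    using that by (simp add: set_chains_def length_Suc_conv) blast
  have "(\<Sum>xs\<in>set_chains k E. \<Sum>Z\<in>Pow (hd (xs @ [E])). g (Z # xs)) =
      (\<Sum>(xs, Z)\<in>(SIGMA xs:set_chains k E. Pow (hd (xs @ [E]))). g (Z # xs))"
  proof (rule sum.Sigma)
    show "\<forall>xs\<in>set_chains k E. finite (Pow (hd (xs @ [E])))"
    proof
      fix xs assume "xs \<in> set_chains k E"
      then have "hd (xs @ [E]) \<subseteq> E" using sub by blast
      then show "finite (Pow (hd (xs @ [E])))" using fin finite_subset by blast
    qed
  qed (rule finite_chains[OF fin])
  also have "\<dots> = (\<Sum>xs\<in>set_chains (Suc k) E. g xs)"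
  proof (rule sum.reindex_bij_witness[of _ "\<lambda>ys. (tl ys, hd ys)" "\<lambda>(xs, Z). Z # xs"])
    fix ys assume ys: "ys \<in> set_chains (Suc k) E"
    then obtain Z xs where e: "ys = Z # xs" using ne by blast
    show "(tl ys, hd ys) \<in> (SIGMA xs:set_chains k E. Pow (hd (xs @ [E])))"
      using ys mem unfolding e by simp
    show "(case (tl ys, hd ys) of (xs, Z) \<Rightarrow> Z # xs) = ys" unfolding e by simp
  qed (auto simp: mem)
  finally show ?thesis by simp
qed

text \<open>The coefficients are sums over chains of weights that depend only on the ranks along the chain,
  so any linear relation between the chain counts of several rank functions is inherited by them.\<close>

lemma left_KL_coeff_chains:
  fixes \<rho> :: "'i \<Rightarrow> 'a set \<Rightarrow> nat"
  assumes fin: "finite E" and R: "\<And>i. i \<in> I \<Longrightarrow> \<rho> i E = R"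
    and null: "\<And>k w. (\<Sum>i\<in>I. c i * (\<Sum>xs\<in>set_chains k E. chain_sign xs * w (map (\<rho> i) xs))) = (0::int)"
  shows "(\<Sum>i\<in>I. c i * (\<Sum>xs\<in>set_chains k E. chain_sign xs * w (map (\<rho> i) xs) *
    left_KL_coeff f (\<rho> i) (hd (xs @ [E])) (J (map (\<rho> i) xs)))) = 0"
proof (induction f arbitrary: k w J)
  \<comment> \<open>For the empty chain the set in question is \<open>E\<close>, whose rank is not
    on the list; a common value \<open>R\<close> for all \<open>i\<close> makes it a function of the
    list nevertheless.\<close>
  have hd: "\<rho> i (hd (xs @ [E])) = hd (map (\<rho> i) xs @ [R])" if "i \<in> I" for i xs
    using R[OF that] by (cases xs) auto
  {
    case 0
    have "(\<Sum>i\<in>I. c i * (\<Sum>xs\<in>set_chains k E. chain_sign xs * w (map (\<rho> i) xs) *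
        left_KL_coeff 0 (\<rho> i) (hd (xs @ [E])) (J (map (\<rho> i) xs)))) =
      (\<Sum>i\<in>I. c i * (\<Sum>xs\<in>set_chains k E. chain_sign xs *
        (\<lambda>rs. w rs * of_bool (hd (rs @ [R]) = 0 \<and> J rs = 0)) (map (\<rho> i) xs)))"
      unfolding left_KL_coeff.simps mult.assoc of_bool_conj
      by (rule sum.cong[OF refl]) (simp add: hd)
    also have "\<dots> = 0" by (rule null)
    finally show ?case .
  next
    case (Suc f)
    \<comment> \<open>One unfolding of the coefficient prepends two members \<open>Z\<close> and
      \<open>A\<close> to the chain. \<open>w1\<close> is the weight of the term that stops here;
      \<open>w2\<close> and \<open>J2\<close> are the weight and the exponent for the longer chain,
      with \<open>tl (tl rs)\<close> giving back the old ranks. The induction is therefore over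
      arbitrary \<open>k\<close>, \<open>w\<close> and \<open>J\<close>.\<close>
    define w1 where "w1 rs = w rs * of_bool (hd (rs @ [R]) = 0 \<and> J rs = 0)" for rs
    define w2 where "w2 rs = (let rz = rs ! 0; ra = rs ! 1; us = tl (tl rs); rx = hd (us @ [R]); j = J us in
      w us * of_bool (2 * j < rx) * of_bool (rz < rx \<and> rx \<le> ra + j \<and> ra + j \<le> rx + rz))" for rs
    define J2 where "J2 rs = (let us = tl (tl rs) in rs ! 0 + hd (us @ [R]) - rs ! 1 - J us)" for rs
    have "chain_sign xs * w (map (\<rho> i) xs) * left_KL_coeff (Suc f) (\<rho> i) (hd (xs @ [E])) (J (map (\<rho> i) xs)) =
        chain_sign xs * w1 (map (\<rho> i) xs) +
        (\<Sum>A\<in>Pow (hd (xs @ [E])). \<Sum>Z\<in>Pow (hd ((A # xs) @ [E])).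
          chain_sign (Z # A # xs) * w2 (map (\<rho> i) (Z # A # xs)) *
          left_KL_coeff f (\<rho> i) (hd ((Z # A # xs) @ [E])) (J2 (map (\<rho> i) (Z # A # xs))))"
      if i: "i \<in> I" for i xs
      unfolding left_KL_coeff.simps hd[OF i] distrib_left sum_distrib_left
      by (intro arg_cong2[of _ _ _ _ "(+)"] sum.cong)
        (simp_all add: w1_def chain_sign_def w2_def J2_def Let_def power_add mult_ac)
    then have "(\<Sum>i\<in>I. c i * (\<Sum>xs\<in>set_chains k E. chain_sign xs * w (map (\<rho> i) xs) *
        left_KL_coeff (Suc f) (\<rho> i) (hd (xs @ [E])) (J (map (\<rho> i) xs)))) =
      (\<Sum>i\<in>I. c i * (\<Sum>xs\<in>set_chains k E. chain_sign xs * w1 (map (\<rho> i) xs))) +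
      (\<Sum>i\<in>I. c i * (\<Sum>xs\<in>set_chains (Suc (Suc k)) E. chain_sign xs * w2 (map (\<rho> i) xs) *
        left_KL_coeff f (\<rho> i) (hd (xs @ [E])) (J2 (map (\<rho> i) xs))))"
      by (simp add: sum_chains_Suc[OF fin] sum.distrib distrib_left)
    also have "\<dots> = 0" by (simp add: null Suc.IH)
    finally show ?case .
  }
qed

section \<open>Direct sums and relabelling\<close>

lemma sum_interval_disjoint:
  assumes "finite X" "Z \<subseteq> X" "X \<subseteq> E1 \<union> E2" "E1 \<inter> E2 = {}"
  shows "(\<Sum>A\<in>{Z..X}. g (A \<inter> E1) (A \<inter> E2)) =
    (\<Sum>A1\<in>{Z \<inter> E1..X \<inter> E1}. \<Sum>A2\<in>{Z \<inter> E2..X \<inter> E2}. g A1 A2)"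
proof -
  have "(\<Sum>A\<in>{Z..X}. g (A \<inter> E1) (A \<inter> E2)) =
      (\<Sum>(A1, A2)\<in>{Z \<inter> E1..X \<inter> E1} \<times> {Z \<inter> E2..X \<inter> E2}. g A1 A2)"
  proof (rule sum.reindex_bij_witness[of _ "\<lambda>(A1, A2). A1 \<union> A2" "\<lambda>A. (A \<inter> E1, A \<inter> E2)"])
    fix A assume A: "A \<in> {Z..X}"
    show "(case (A \<inter> E1, A \<inter> E2) of (A1, A2) \<Rightarrow> A1 \<union> A2) = A" using A assms by auto
    show "(A \<inter> E1, A \<inter> E2) \<in> {Z \<inter> E1..X \<inter> E1} \<times> {Z \<inter> E2..X \<inter> E2}" using A by auto
  next
    fix b assume b: "b \<in> {Z \<inter> E1..X \<inter> E1} \<times> {Z \<inter> E2..X \<inter> E2}"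
    obtain A1 A2 where e: "b = (A1, A2)" by fastforce
    with b have A: "Z \<inter> E1 \<subseteq> A1" "A1 \<subseteq> X \<inter> E1" "Z \<inter> E2 \<subseteq> A2" "A2 \<subseteq> X \<inter> E2" by auto
    have "(A1 \<union> A2) \<inter> E1 = A1" "(A1 \<union> A2) \<inter> E2 = A2" using A assms(4) by blast+
    then show "((case b of (A1, A2) \<Rightarrow> A1 \<union> A2) \<inter> E1, (case b of (A1, A2) \<Rightarrow> A1 \<union> A2) \<inter> E2) = b"
      by (simp add: e)
    have "Z \<subseteq> A1 \<union> A2" "A1 \<union> A2 \<subseteq> X" using A assms(2,3) by blast+
    then show "(case b of (A1, A2) \<Rightarrow> A1 \<union> A2) \<in> {Z..X}" by (simp add: e)
  qed simp
  then show ?thesis by (simp add: sum.cartesian_product)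
qed

text \<open>Multiplicativity of Q over direct sums, at the level of rank functions: intervals in a
  disjoint union are products of intervals, ranks and sizes add, and \<open>rev_poly\<close> is
  multiplicative. The strict degree bound survives because a factor of rank 0 equals 1.\<close>

lemma left_KL_sum:
  assumes q1: "left_KL \<rho>1 E1 q1" and q2: "left_KL \<rho>2 E2 q2"
    and fin: "finite E1" "finite E2" and disj: "E1 \<inter> E2 = {}"
    and mono1: "\<And>X Y. X \<subseteq> Y \<Longrightarrow> Y \<subseteq> E1 \<Longrightarrow> \<rho>1 X \<le> \<rho>1 Y"
    and mono2: "\<And>X Y. X \<subseteq> Y \<Longrightarrow> Y \<subseteq> E2 \<Longrightarrow> \<rho>2 X \<le> \<rho>2 Y"
  shows "left_KL (\<lambda>X. \<rho>1 (X \<inter> E1) + \<rho>2 (X \<inter> E2)) (E1 \<union> E2) (\<lambda>X. q1 (X \<inter> E1) * q2 (X \<inter> E2))"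
  unfolding left_KL_def
proof (intro allI impI conjI)
  fix X assume X: "X \<subseteq> E1 \<union> E2"
  define X1 X2 where "X1 = X \<inter> E1" and "X2 = X \<inter> E2"
  have X12: "X1 \<subseteq> E1" "X2 \<subseteq> E2" by (auto simp: X1_def X2_def)
  have finX: "finite X" using X fin finite_subset by blast
  show "q1 (X \<inter> E1) * q2 (X \<inter> E2) = 1" if "\<rho>1 (X \<inter> E1) + \<rho>2 (X \<inter> E2) = 0"
    using that left_KL_rank_0[OF q1 X12(1)] left_KL_rank_0[OF q2 X12(2)] by (simp add: X1_def X2_def)
  show "2 * degree (q1 (X \<inter> E1) * q2 (X \<inter> E2)) < \<rho>1 (X \<inter> E1) + \<rho>2 (X \<inter> E2)"
    if pos: "0 < \<rho>1 (X \<inter> E1) + \<rho>2 (X \<inter> E2)"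
  proof -
    have a: "\<rho>1 X1 = 0 \<and> degree (q1 X1) = 0 \<or> 2 * degree (q1 X1) < \<rho>1 X1"
      using left_KL_rank_0[OF q1 X12(1)] left_KL_degree[OF q1 X12(1)] by (cases "\<rho>1 X1 = 0") auto
    have b: "\<rho>2 X2 = 0 \<and> degree (q2 X2) = 0 \<or> 2 * degree (q2 X2) < \<rho>2 X2"
      using left_KL_rank_0[OF q2 X12(2)] left_KL_degree[OF q2 X12(2)] by (cases "\<rho>2 X2 = 0") auto
    show ?thesis using a b pos degree_mult_le[of "q1 X1" "q2 X2"] unfolding X1_def X2_def by linarith
  qed
  define D where "D \<rho> q X Z A = rev_poly (\<rho> Z) (q Z) * ((-1) ^ (card Z + card A) * monom (1::int) (\<rho> X - \<rho> A))"
    for \<rho> :: "'a set \<Rightarrow> nat" and q :: "'a set \<Rightarrow> int poly" and X Z A :: "'a set"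
  have rel: "q X = (\<Sum>Z\<in>{{}..X}. \<Sum>A\<in>{Z..X}. D \<rho> q X Z A)" if "left_KL \<rho> E q" "X \<subseteq> E" for \<rho> E q and X :: "'a set"
  proof -
    have Pow: "Pow X = {{}..X}" by auto
    show ?thesis
      using left_KL_relation[OF that] unfolding D_def sum_distrib_left Pow .
  qed
  define \<rho> where "\<rho> X = \<rho>1 (X \<inter> E1) + \<rho>2 (X \<inter> E2)" for X
  define q where "q X = q1 (X \<inter> E1) * q2 (X \<inter> E2)" for X
  have D: "D \<rho> q X Z A = D \<rho>1 q1 X1 (Z \<inter> E1) (A \<inter> E1) * D \<rho>2 q2 X2 (Z \<inter> E2) (A \<inter> E2)"
    if ZA: "Z \<subseteq> A" "A \<subseteq> X" for Z A
  proof -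
    have card: "card B = card (B \<inter> E1) + card (B \<inter> E2)" if "B \<subseteq> X" for B
    proof -
      have "B = (B \<inter> E1) \<union> (B \<inter> E2)" using that X by blast
      moreover have "(B \<inter> E1) \<inter> (B \<inter> E2) = {}" using disj by blast
      moreover have "finite B" using that finX finite_subset by blast
      ultimately show ?thesis by (metis card_Un_disjoint finite_Int)
    qed
    have "\<rho>1 (A \<inter> E1) \<le> \<rho>1 X1" "\<rho>2 (A \<inter> E2) \<le> \<rho>2 X2"
      using ZA by (auto simp: X1_def X2_def intro!: mono1 mono2)
    then have "monom (1::int) (\<rho> X - \<rho> A) = monom 1 (\<rho>1 X1 - \<rho>1 (A \<inter> E1)) * monom 1 (\<rho>2 X2 - \<rho>2 (A \<inter> E2))"
      by (simp add: \<rho>_def X1_def X2_def mult_monom)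
    moreover have "rev_poly (\<rho> Z) (q Z) = rev_poly (\<rho>1 (Z \<inter> E1)) (q1 (Z \<inter> E1)) * rev_poly (\<rho>2 (Z \<inter> E2)) (q2 (Z \<inter> E2))"
      unfolding \<rho>_def q_def
      by (rule rev_poly_mult) (use left_KL_degree_le[OF q1] left_KL_degree_le[OF q2] in auto)
    moreover have "card Z + card A = (card (Z \<inter> E1) + card (A \<inter> E1)) + (card (Z \<inter> E2) + card (A \<inter> E2))"
      using card[of Z] card[of A] ZA by auto
    ultimately show ?thesis by (simp only: D_def power_add mult_ac)
  qed
  have "q X = (\<Sum>Z1\<in>{{}..X1}. \<Sum>A1\<in>{Z1..X1}. D \<rho>1 q1 X1 Z1 A1) * (\<Sum>Z2\<in>{{}..X2}. \<Sum>A2\<in>{Z2..X2}. D \<rho>2 q2 X2 Z2 A2)"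
    using rel[OF q1 X12(1)] rel[OF q2 X12(2)] by (simp add: q_def X1_def X2_def)
  also have "\<dots> = (\<Sum>Z1\<in>{{} \<inter> E1..X \<inter> E1}. \<Sum>Z2\<in>{{} \<inter> E2..X \<inter> E2}.
      (\<Sum>A1\<in>{Z1..X1}. D \<rho>1 q1 X1 Z1 A1) * (\<Sum>A2\<in>{Z2..X2}. D \<rho>2 q2 X2 Z2 A2))"
    by (simp add: sum_product X1_def X2_def)
  also have "\<dots> = (\<Sum>Z\<in>{{}..X}.
      (\<Sum>A1\<in>{Z \<inter> E1..X1}. D \<rho>1 q1 X1 (Z \<inter> E1) A1) * (\<Sum>A2\<in>{Z \<inter> E2..X2}. D \<rho>2 q2 X2 (Z \<inter> E2) A2))"
    by (rule sum_interval_disjoint[symmetric, OF finX empty_subsetI X disj])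
  also have "\<dots> = (\<Sum>Z\<in>{{}..X}. \<Sum>A\<in>{Z..X}. D \<rho> q X Z A)"
  proof (rule sum.cong)
    fix Z assume "Z \<in> {{}..X}"
    then have Z: "Z \<subseteq> X" by simp
    have "(\<Sum>A\<in>{Z..X}. D \<rho> q X Z A) =
        (\<Sum>A\<in>{Z..X}. D \<rho>1 q1 X1 (Z \<inter> E1) (A \<inter> E1) * D \<rho>2 q2 X2 (Z \<inter> E2) (A \<inter> E2))"
      by (rule sum.cong) (auto simp: D)
    also have "\<dots> = (\<Sum>A1\<in>{Z \<inter> E1..X \<inter> E1}. \<Sum>A2\<in>{Z \<inter> E2..X \<inter> E2}.
        D \<rho>1 q1 X1 (Z \<inter> E1) A1 * D \<rho>2 q2 X2 (Z \<inter> E2) A2)"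
      by (rule sum_interval_disjoint[OF finX Z X disj])
    finally show "(\<Sum>A1\<in>{Z \<inter> E1..X1}. D \<rho>1 q1 X1 (Z \<inter> E1) A1) * (\<Sum>A2\<in>{Z \<inter> E2..X2}. D \<rho>2 q2 X2 (Z \<inter> E2) A2) =
        (\<Sum>A\<in>{Z..X}. D \<rho> q X Z A)"
      by (simp add: sum_product X1_def X2_def)
  qed simp
  also have "\<dots> = (\<Sum>Z\<in>Pow X. rev_poly (\<rho> Z) (q Z) * (\<Sum>A\<in>{Z..X}. (-1) ^ (card Z + card A) * monom 1 (\<rho> X - \<rho> A)))"
    unfolding D_def sum_distrib_left by (rule sum.cong) auto
  finally show "q1 (X \<inter> E1) * q2 (X \<inter> E2) =
      (\<Sum>Z\<in>Pow X. rev_poly (\<rho>1 (Z \<inter> E1) + \<rho>2 (Z \<inter> E2)) (q1 (Z \<inter> E1) * q2 (Z \<inter> E2)) *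
       (\<Sum>A\<in>{Z..X}. (-1) ^ (card Z + card A) *
         monom 1 (\<rho>1 (X \<inter> E1) + \<rho>2 (X \<inter> E2) - (\<rho>1 (A \<inter> E1) + \<rho>2 (A \<inter> E2)))))"
    by (simp only: \<rho>_def q_def)
qed

lemma left_KL_image:
  assumes q: "left_KL \<rho> (h ` E) q" and inj: "inj_on h E"
  shows "left_KL (\<lambda>X. \<rho> (h ` X)) E (\<lambda>X. q (h ` X))"
  unfolding left_KL_def
proof (intro allI impI conjI)
  fix X assume X: "X \<subseteq> E"
  then have hX: "h ` X \<subseteq> h ` E" by blast
  show "q (h ` X) = 1" if "\<rho> (h ` X) = 0" using left_KL_rank_0[OF q hX that] .
  show "2 * degree (q (h ` X)) < \<rho> (h ` X)" if "0 < \<rho> (h ` X)" using left_KL_degree[OF q hX that] .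
  have injX: "inj_on h X" using inj X inj_on_subset by blast
  have bij: "bij_betw (image h) {Z..X} {h ` Z..h ` X}" if "Z \<subseteq> X" for Z
  proof (rule bij_betw_byWitness[where f' = "\<lambda>Y. X \<inter> h -` Y"])
    show "\<forall>A\<in>{Z..X}. X \<inter> h -` (h ` A) = A"
    proof (intro ballI set_eqI)
      fix A x assume "A \<in> {Z..X}"
      then show "x \<in> X \<inter> h -` (h ` A) \<longleftrightarrow> x \<in> A"
        using inj_on_image_mem_iff[OF injX, of x A] by auto
    qed
    show "\<forall>Y\<in>{h ` Z..h ` X}. h ` (X \<inter> h -` Y) = Y" by auto blast
    show "image h ` {Z..X} \<subseteq> {h ` Z..h ` X}"
      by (intro image_subsetI) (simp add: image_mono)
    show "(\<lambda>Y. X \<inter> h -` Y) ` {h ` Z..h ` X} \<subseteq> {Z..X}"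
      using that by (auto simp: image_subset_iff)
  qed
  have card: "card (h ` A) = card A" if "A \<subseteq> X" for A
    using injX that by (meson card_image inj_on_subset)
  have "q (h ` X) = (\<Sum>Z\<in>{h ` {}..h ` X}. rev_poly (\<rho> Z) (q Z) *
       (\<Sum>A\<in>{Z..h ` X}. (-1) ^ (card Z + card A) * monom 1 (\<rho> (h ` X) - \<rho> A)))"
  proof -
    have Pow: "Pow (h ` X) = {h ` {}..h ` X}" by auto
    show ?thesis using left_KL_relation[OF q hX] unfolding Pow .
  qed
  also have "\<dots> = (\<Sum>Z\<in>{{}..X}. rev_poly (\<rho> (h ` Z)) (q (h ` Z)) *
       (\<Sum>A\<in>{h ` Z..h ` X}. (-1) ^ (card (h ` Z) + card A) * monom 1 (\<rho> (h ` X) - \<rho> A)))"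
    by (rule sum.reindex_bij_betw[symmetric, OF bij]) simp
  also have "\<dots> = (\<Sum>Z\<in>Pow X. rev_poly (\<rho> (h ` Z)) (q (h ` Z)) *
       (\<Sum>A\<in>{Z..X}. (-1) ^ (card Z + card A) * monom 1 (\<rho> (h ` X) - \<rho> (h ` A))))"
  proof (intro sum.cong arg_cong2[of _ _ _ _ "(*)"] refl)
    fix Z assume "Z \<in> Pow X"
    then have Z: "Z \<subseteq> X" by simp
    show "(\<Sum>A\<in>{h ` Z..h ` X}. (-1) ^ (card (h ` Z) + card A) * monom (1::int) (\<rho> (h ` X) - \<rho> A)) =
        (\<Sum>A\<in>{Z..X}. (-1) ^ (card Z + card A) * monom 1 (\<rho> (h ` X) - \<rho> (h ` A)))"
      unfolding sum.reindex_bij_betw[symmetric, OF bij[OF Z]]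
      by (rule sum.cong) (auto simp: card Z)
  qed auto
  finally show "q (h ` X) = (\<Sum>Z\<in>Pow X. rev_poly (\<rho> (h ` Z)) (q (h ` Z)) *
       (\<Sum>A\<in>{Z..X}. (-1) ^ (card Z + card A) * monom 1 (\<rho> (h ` X) - \<rho> (h ` A))))" .
qed

section \<open>A Spitzer identity for decreasing vectors\<close>

definition pos_part_fun :: "(nat \<Rightarrow> int) \<Rightarrow> nat \<Rightarrow> int" where
  "pos_part_fun s = (\<lambda>l. max 0 (s l))"

text \<open>The ambient ring is the group algebra of integer vectors: signed laws with finite
  support, multiplied by convolution. \<open>baxter\<close> is the push-forward of laws along the
  coordinatewise positive part.\<close>

definition baxter :: "((nat \<Rightarrow> int) \<Rightarrow>\<^sub>0 int) \<Rightarrow> (nat \<Rightarrow> int) \<Rightarrow>\<^sub>0 int" where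
  "baxter = frag_extend (\<lambda>s. frag_of (pos_part_fun s))"

text \<open>Vectors of length \<open>k\<close>, padded by zeros so that all lengths share one type.
  Monotonicity stops at \<open>k\<close> because entries may be negative. The shape comes from
  chains: a defect decreases as the set grows.\<close>

definition antitone_upto :: "nat \<Rightarrow> (nat \<Rightarrow> int) set" where
  "antitone_upto k = {s. (\<forall>i j. i \<le> j \<and> j < k \<longrightarrow> s j \<le> s i) \<and> (\<forall>l\<ge>k. s l = 0)}"

lemma baxter_add: "baxter (x + y) = baxter x + baxter y"
  and baxter_diff: "baxter (x - y) = baxter x - baxter y"
  and baxter_0 [simp]: "baxter 0 = 0"
  by (simp_all add: baxter_def frag_extend_add frag_extend_diff)

lemma baxter_sum: "finite I \<Longrightarrow> baxter (\<Sum>i\<in>I. f i) = (\<Sum>i\<in>I. baxter (f i))"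
  by (simp add: baxter_def frag_extend_sum)

lemma baxter_single: "baxter (Poly_Mapping.single s c) = Poly_Mapping.single (pos_part_fun s) c"
proof -
  have *: "Poly_Mapping.single s c = frag_cmul c (frag_of s)" for s :: "nat \<Rightarrow> int"
    by (intro poly_mapping_eqI) (simp add: lookup_single when_def)
  show ?thesis unfolding * by (simp add: baxter_def frag_extend_cmul)
qed

lemma baxter_of_nat_mult: "baxter (of_nat n * x) = of_nat n * baxter x"
  by (induction n) (simp_all add: distrib_right baxter_add)

lemma antitone_upto_add: "s \<in> antitone_upto k \<Longrightarrow> t \<in> antitone_upto k \<Longrightarrow> s + t \<in> antitone_upto k"
  by (auto simp: antitone_upto_def intro: add_mono)

lemma keys_mult_antitone:
  assumes "Poly_Mapping.keys x \<subseteq> antitone_upto k" "Poly_Mapping.keys y \<subseteq> antitone_upto k"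
  shows "Poly_Mapping.keys (x * y) \<subseteq> antitone_upto k"
  using keys_mult[of x y] assms antitone_upto_add by blast

lemma pos_part_antitone: "s \<in> antitone_upto k \<Longrightarrow> pos_part_fun s \<in> antitone_upto k"
  by (force simp: antitone_upto_def pos_part_fun_def max_def)

lemma keys_baxter_antitone:
  assumes "Poly_Mapping.keys x \<subseteq> antitone_upto k" shows "Poly_Mapping.keys (baxter x) \<subseteq> antitone_upto k"
  using keys_frag_extend[of "\<lambda>s. frag_of (pos_part_fun s)" x] assms pos_part_antitone
  unfolding baxter_def by fastforce

text \<open>The Rota--Baxter identity fails for arbitrary vectors. For decreasing ones, \<open>s\<close> and \<open>t\<close> cannot have opposite
  signs in both ways, so the two terms on each side can be matched in the same way in all
  coordinates.\<close>

lemma pos_part_matching: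
  assumes s: "s \<in> antitone_upto k" and t: "t \<in> antitone_upto k"
  shows "pos_part_fun s + pos_part_fun t = pos_part_fun (s + pos_part_fun t) \<and>
      pos_part_fun (s + t) = pos_part_fun (pos_part_fun s + t) \<or>
    pos_part_fun s + pos_part_fun t = pos_part_fun (pos_part_fun s + t) \<and>
      pos_part_fun (s + t) = pos_part_fun (s + pos_part_fun t)"
proof -
  have *: "(\<forall>l. s l \<ge> 0 \<or> t l \<le> 0) \<or> (\<forall>l. t l \<ge> 0 \<or> s l \<le> 0)"
  proof (rule ccontr)
    assume "\<not> ?thesis"
    then obtain l l' where l: "s l < 0" "t l > 0" "t l' < 0" "s l' > 0"
      by (auto simp: not_le)
    have "m < k" if "s m \<noteq> 0" for m
      using s that unfolding antitone_upto_def by (metis (mono_tags, lifting) mem_Collect_eq not_less)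
    then have k: "l < k" "l' < k" using l by (metis less_irrefl)+
    show False
    proof (cases "l \<le> l'")
      case True
      then have "s l' \<le> s l" using s k by (simp add: antitone_upto_def)
      then show ?thesis using l by simp
    next
      case False
      then have "t l \<le> t l'" using t k by (simp add: antitone_upto_def)
      then show ?thesis using l by simp
    qed
  qed
  then show ?thesis
  proof
    assume a: "\<forall>l. s l \<ge> 0 \<or> t l \<le> 0"
    have "pos_part_fun s l + pos_part_fun t l = pos_part_fun (s + pos_part_fun t) l"
      "pos_part_fun (s + t) l = pos_part_fun (pos_part_fun s + t) l" for l
      using spec[OF a, of l] by (auto simp: pos_part_fun_def max_def)
    then show ?thesis by (intro disjI1) (simp add: fun_eq_iff)
  next
    assume a: "\<forall>l. t l \<ge> 0 \<or> s l \<le> 0"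
    have "pos_part_fun s l + pos_part_fun t l = pos_part_fun (pos_part_fun s + t) l"
      "pos_part_fun (s + t) l = pos_part_fun (s + pos_part_fun t) l" for l
      using spec[OF a, of l] by (auto simp: pos_part_fun_def max_def)
    then show ?thesis by (intro disjI2) (simp add: fun_eq_iff)
  qed
qed

text \<open>The Rota-Baxter identity of weight -1. Both sides are bilinear, which leaves pairs of
  basis vectors; there each side is a sum of two basis elements, and
  \<open>pos_part_matching\<close> pairs them in one of the two orders.\<close>

lemma rota_baxter:
  assumes x: "Poly_Mapping.keys x \<subseteq> antitone_upto k" and y: "Poly_Mapping.keys y \<subseteq> antitone_upto k"
  shows "baxter x * baxter y + baxter (x * y) = baxter (x * baxter y) + baxter (baxter x * y)"
  using x
proof (induction x rule: frag_induction)
  case (one s)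
  show ?case using y
  proof (induction y rule: frag_induction)
    case (one t)
    show ?case using pos_part_matching[OF \<open>s \<in> _\<close> \<open>t \<in> _\<close>]
      by (auto simp: baxter_single mult_single)
  next
    case (diff x y)
    then show ?case by (simp add: baxter_diff right_diff_distrib algebra_simps)
  qed simp
next
  case (diff a b)
  then show ?case by (simp add: baxter_diff algebra_simps)
qed simp

text \<open>For the law \<open>f\<close> of a step this is the law of the maximal partial sum of
  \<open>n\<close> independent steps, the empty sum included: M_n = max 0 (step + M_(n-1)), in each
  coordinate.\<close>

primrec baxter_iter :: "((nat \<Rightarrow> int) \<Rightarrow>\<^sub>0 int) \<Rightarrow> nat \<Rightarrow> (nat \<Rightarrow> int) \<Rightarrow>\<^sub>0 int" where
  "baxter_iter f 0 = 1"
| "baxter_iter f (Suc n) = baxter (f * baxter_iter f n)"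

lemma keys_one_antitone: "Poly_Mapping.keys (1 :: (nat \<Rightarrow> int) \<Rightarrow>\<^sub>0 int) \<subseteq> antitone_upto k"
  by (simp add: antitone_upto_def)

lemma keys_power_antitone:
  "Poly_Mapping.keys f \<subseteq> antitone_upto k \<Longrightarrow> Poly_Mapping.keys (f ^ n) \<subseteq> antitone_upto k"
proof (induction n)
  case 0
  then show ?case using keys_one_antitone by simp
qed (simp add: keys_mult_antitone)

lemma keys_baxter_iter_antitone:
  "Poly_Mapping.keys f \<subseteq> antitone_upto k \<Longrightarrow> Poly_Mapping.keys (baxter_iter f n) \<subseteq> antitone_upto k"
proof (induction n)
  case 0
  then show ?case using keys_one_antitone by simp
qed (simp add: keys_mult_antitone keys_baxter_antitone)

text \<open>The Rota-Baxter identity for \<open>f ^ Suc i\<close> and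
  \<open>f * ?c (n - Suc i)\<close> rewrites the \<open>i\<close>-th product as
  \<open>u i - u (Suc i)\<close> plus a term under \<open>baxter\<close>. The differences telescope,
  and the remaining terms add up to \<open>of_nat n * ?c (Suc n)\<close> by the induction
  hypothesis.\<close>

lemma spitzer_recursion:
  assumes f: "Poly_Mapping.keys f \<subseteq> antitone_upto k"
  shows "of_nat n * baxter_iter f n = (\<Sum>i<n. baxter (f ^ Suc i) * baxter_iter f (n - Suc i))"
proof (induction n)
  case (Suc n)
  let ?c = "baxter_iter f"
  define u where "u i = baxter (f ^ Suc i * ?c (n - i))" for i
  have "baxter (f ^ Suc i) * ?c (Suc n - Suc i) =
      u i - u (Suc i) + baxter (baxter (f ^ Suc i) * (f * ?c (n - Suc i)))" if "i < n" for i
  proof -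
    define y where "y = f * ?c (n - Suc i)"
    have "Poly_Mapping.keys y \<subseteq> antitone_upto k"
      unfolding y_def by (intro keys_mult_antitone f keys_baxter_iter_antitone)
    then have "baxter (f ^ Suc i) * baxter y + baxter (f ^ Suc i * y) =
        baxter (f ^ Suc i * baxter y) + baxter (baxter (f ^ Suc i) * y)"
      by (intro rota_baxter[of _ k] keys_power_antitone f)
    moreover have "baxter y = ?c (n - i)" using that by (simp add: y_def Suc_diff_Suc flip: baxter_iter.simps)
    moreover have "f ^ Suc i * y = f ^ Suc (Suc i) * ?c (n - Suc i)" by (simp add: y_def mult_ac)
    ultimately show ?thesis by (simp add: u_def y_def algebra_simps)
  qed
  then have "(\<Sum>i<n. baxter (f ^ Suc i) * ?c (Suc n - Suc i)) =
      (\<Sum>i<n. u i - u (Suc i)) + (\<Sum>i<n. baxter (baxter (f ^ Suc i) * (f * ?c (n - Suc i))))"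
    by (simp add: sum.distrib)
  also have "(\<Sum>i<n. u i - u (Suc i)) = u 0 - u n" by (rule sum_lessThan_telescope')
  also have "(\<Sum>i<n. baxter (baxter (f ^ Suc i) * (f * ?c (n - Suc i)))) =
      baxter (f * (\<Sum>i<n. baxter (f ^ Suc i) * ?c (n - Suc i)))"
    by (simp add: baxter_sum sum_distrib_left mult_ac)
  also have "\<dots> = of_nat n * ?c (Suc n)"
    unfolding Suc.IH[symmetric] by (simp add: baxter_of_nat_mult mult.left_commute[of f])
  also have "u 0 = ?c (Suc n)" by (simp add: u_def)
  \<comment> \<open>This is the summand \<open>i = n\<close> of the recursion for
    \<open>Suc n\<close>, which the sum over \<open>i < n\<close> has left out.\<close>
  also have "u n = baxter (f ^ Suc n)" by (simp add: u_def)
  finally show ?case by (simp add: algebra_simps)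
qed simp

section \<open>Generating functions of chains\<close>

lemma sum_chains_disjoint:
  assumes fin: "finite E1" "finite E2" and disj: "E1 \<inter> E2 = {}"
  shows "(\<Sum>xs\<in>set_chains k (E1 \<union> E2). h (map (\<lambda>X. X \<inter> E1) xs) (map (\<lambda>X. X \<inter> E2) xs)) =
    (\<Sum>xs\<in>set_chains k E1. \<Sum>ys\<in>set_chains k E2. h xs ys)"
proof (induction k arbitrary: h)
  case 0
  then show ?case by (simp add: chains_0)
next
  case (Suc k)
  let ?E = "E1 \<union> E2" and ?p1 = "map (\<lambda>X. X \<inter> E1)" and ?p2 = "map (\<lambda>X. X \<inter> E2)"
  define h' where "h' xs ys = (\<Sum>Z1\<in>Pow (hd (xs @ [E1])). \<Sum>Z2\<in>Pow (hd (ys @ [E2])). h (Z1 # xs) (Z2 # ys))" for xs ys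
  have finE: "finite ?E" using fin by simp
  have "(\<Sum>xs\<in>set_chains (Suc k) ?E. h (?p1 xs) (?p2 xs)) =
      (\<Sum>xs\<in>set_chains k ?E. \<Sum>Z\<in>Pow (hd (xs @ [?E])). h ((Z \<inter> E1) # ?p1 xs) ((Z \<inter> E2) # ?p2 xs))"
    by (simp add: sum_chains_Suc[OF finE])
  also have "\<dots> = (\<Sum>xs\<in>set_chains k ?E. h' (?p1 xs) (?p2 xs))"
  proof (rule sum.cong)
    fix xs assume xs: "xs \<in> set_chains k ?E"
    define X where "X = hd (xs @ [?E])"
    have X: "X \<subseteq> ?E" using xs by (cases xs) (auto simp: X_def set_chains_def)
    have h: "hd (?p1 xs @ [E1]) = X \<inter> E1" "hd (?p2 xs @ [E2]) = X \<inter> E2"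
      by (cases xs; auto simp: X_def)+
    have Pow: "Pow Y = {{}..Y}" for Y :: "'a set" by auto
    show "(\<Sum>Z\<in>Pow (hd (xs @ [?E])). h ((Z \<inter> E1) # ?p1 xs) ((Z \<inter> E2) # ?p2 xs)) = h' (?p1 xs) (?p2 xs)"
      unfolding h'_def h X_def[symmetric] Pow
      using sum_interval_disjoint[of X "{}" E1 E2 "\<lambda>Z1 Z2. h (Z1 # ?p1 xs) (Z2 # ?p2 xs)"]
        X disj finite_subset[OF X finE] by simp
  qed simp
  also have "\<dots> = (\<Sum>xs\<in>set_chains k E1. \<Sum>ys\<in>set_chains k E2. h' xs ys)" by (rule Suc.IH)
  also have "\<dots> = (\<Sum>xs\<in>set_chains (Suc k) E1. \<Sum>ys\<in>set_chains (Suc k) E2. h xs ys)"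
    unfolding sum_chains_Suc[OF fin(1)] sum_chains_Suc[OF fin(2)] h'_def
    by (intro sum.cong refl) (rule sum.swap)
  finally show ?case .
qed

lemma sum_chains_image:
  assumes fin: "finite E" and inj: "inj_on h E"
  shows "(\<Sum>xs\<in>set_chains k (h ` E). g xs) = (\<Sum>xs\<in>set_chains k E. g (map (image h) xs))"
proof (induction k arbitrary: g)
  case 0
  then show ?case by (simp add: chains_0)
next
  case (Suc k)
  have "(\<Sum>xs\<in>set_chains (Suc k) (h ` E). g xs) =
      (\<Sum>xs\<in>set_chains k E. \<Sum>Z\<in>Pow (hd (map (image h) xs @ [h ` E])). g (Z # map (image h) xs))"
    using fin by (simp add: sum_chains_Suc Suc.IH)
  also have "\<dots> = (\<Sum>xs\<in>set_chains k E. \<Sum>Z\<in>Pow (hd (xs @ [E])). g (image h Z # map (image h) xs))"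
  proof (rule sum.cong)
    fix xs assume xs: "xs \<in> set_chains k E"
    define X where "X = hd (xs @ [E])"
    have X: "X \<subseteq> E" using xs by (cases xs) (auto simp: X_def set_chains_def)
    have hX: "hd (map (image h) xs @ [h ` E]) = h ` X" by (cases xs) (auto simp: X_def)
    have "inj_on (image h) (Pow X)" using inj X by (meson inj_on_image_Pow inj_on_subset)
    then show "(\<Sum>Z\<in>Pow (hd (map (image h) xs @ [h ` E])). g (Z # map (image h) xs)) =
        (\<Sum>Z\<in>Pow (hd (xs @ [E])). g (image h Z # map (image h) xs))"
      unfolding hX X_def[symmetric] image_Pow_surj[OF refl, symmetric] by (simp add: sum.reindex)
  qed simp
  also have "\<dots> = (\<Sum>xs\<in>set_chains (Suc k) E. g (map (image h) xs))"
    by (simp add: sum_chains_Suc[OF fin])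
  finally show ?case .
qed

definition chain_vec :: "('a set \<Rightarrow> int) \<Rightarrow> 'a set list \<Rightarrow> nat \<Rightarrow> int" where
  "chain_vec \<delta> xs = (\<lambda>l. if l < length xs then \<delta> (xs ! l) else 0)"

text \<open>The signed law of the values of \<open>\<delta>\<close> along a chain. Equations between
  such elements are equations between signed numbers of chains with prescribed values.\<close>

definition chain_gf :: "nat \<Rightarrow> 'a set \<Rightarrow> ('a set \<Rightarrow> int) \<Rightarrow> (nat \<Rightarrow> int) \<Rightarrow>\<^sub>0 int" where
  "chain_gf k E \<delta> = (\<Sum>xs\<in>set_chains k E. Poly_Mapping.single (chain_vec \<delta> xs) (chain_sign xs))"

lemma chain_gf_cong:
  assumes "\<And>X. X \<subseteq> E \<Longrightarrow> \<delta> X = \<delta>' X"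
  shows "chain_gf k E \<delta> = chain_gf k E \<delta>'"
proof -
  have "chain_vec \<delta> xs = chain_vec \<delta>' xs" if "xs \<in> set_chains k E" for xs
  proof -
    have "\<delta> (xs ! l) = \<delta>' (xs ! l)" if "l < length xs" for l
    proof (rule assms)
      show "xs ! l \<subseteq> E" using nth_mem[OF that] \<open>xs \<in> set_chains k E\<close> by (auto simp: set_chains_def)
    qed
    then show ?thesis by (auto simp: chain_vec_def)
  qed
  then show ?thesis by (simp add: chain_gf_def cong: sum.cong)
qed

text \<open>This is independence: the law of a sum of quantities on disjoint sets is the convolution
  of their laws.\<close>

lemma chain_gf_add:
  assumes fin: "finite E1" "finite E2" and disj: "E1 \<inter> E2 = {}"
  shows "chain_gf k (E1 \<union> E2) (\<lambda>X. \<delta>1 (X \<inter> E1) + \<delta>2 (X \<inter> E2)) = chain_gf k E1 \<delta>1 * chain_gf k E2 \<delta>2"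
proof -
  let ?p1 = "map (\<lambda>X. X \<inter> E1)" and ?p2 = "map (\<lambda>X. X \<inter> E2)"
  define h where "h xs ys = Poly_Mapping.single (chain_vec \<delta>1 xs) (chain_sign xs) *
    Poly_Mapping.single (chain_vec \<delta>2 ys) (chain_sign ys)" for xs ys
  have sgn: "chain_sign xs = chain_sign (?p1 xs) * chain_sign (?p2 xs)" if "set xs \<subseteq> Pow (E1 \<union> E2)" for xs
    using that
  proof (induction xs)
    case (Cons X xs)
    have "X = (X \<inter> E1) \<union> (X \<inter> E2)" "(X \<inter> E1) \<inter> (X \<inter> E2) = {}" using Cons.prems disj by auto
    then have "card X = card (X \<inter> E1) + card (X \<inter> E2)" using fin by (metis card_Un_disjoint finite_Int)
    then show ?case using Cons by (simp add: chain_sign_def power_add)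
  qed (simp add: chain_sign_def)
  have "chain_gf k (E1 \<union> E2) (\<lambda>X. \<delta>1 (X \<inter> E1) + \<delta>2 (X \<inter> E2)) =
      (\<Sum>xs\<in>set_chains k (E1 \<union> E2). h (?p1 xs) (?p2 xs))"
    unfolding chain_gf_def
  proof (rule sum.cong)
    fix xs assume "xs \<in> set_chains k (E1 \<union> E2)"
    then have xs: "set xs \<subseteq> Pow (E1 \<union> E2)" by (simp add: set_chains_def)
    have "chain_vec (\<lambda>X. \<delta>1 (X \<inter> E1) + \<delta>2 (X \<inter> E2)) xs = chain_vec \<delta>1 (?p1 xs) + chain_vec \<delta>2 (?p2 xs)"
      by (auto simp: chain_vec_def)
    then show "Poly_Mapping.single (chain_vec (\<lambda>X. \<delta>1 (X \<inter> E1) + \<delta>2 (X \<inter> E2)) xs) (chain_sign xs) =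
        h (?p1 xs) (?p2 xs)"
      by (simp add: h_def mult_single sgn[OF xs])
  qed simp
  also have "\<dots> = chain_gf k E1 \<delta>1 * chain_gf k E2 \<delta>2"
    unfolding sum_chains_disjoint[OF fin disj] by (simp add: h_def chain_gf_def sum_product)
  finally show ?thesis .
qed

lemma chain_gf_pos_part:
  assumes "finite E"
  shows "chain_gf k E (\<lambda>X. max 0 (\<delta> X)) = baxter (chain_gf k E \<delta>)"
proof -
  have "chain_vec (\<lambda>X. max 0 (\<delta> X)) xs = pos_part_fun (chain_vec \<delta> xs)" for xs
    by (auto simp: chain_vec_def pos_part_fun_def)
  then show ?thesis using finite_chains[OF assms] by (simp add: chain_gf_def baxter_sum baxter_single)
qed

lemma chain_gf_image:
  assumes fin: "finite E" and inj: "inj_on h E"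
  shows "chain_gf k (h ` E) \<delta> = chain_gf k E (\<lambda>X. \<delta> (h ` X))"
proof -
  have "chain_sign (map (image h) xs) = chain_sign xs" if "xs \<in> set_chains k E" for xs
  proof -
    have "card (h ` X) = card X" if "X \<in> set xs" for X
    proof (rule card_image, rule inj_on_subset[OF inj])
      show "X \<subseteq> E" using that \<open>xs \<in> set_chains k E\<close> by (auto simp: set_chains_def)
    qed
    then have "map (card \<circ> image h) xs = map card xs" by simp
    then show ?thesis by (simp only: chain_sign_def map_map)
  qed
  moreover have "chain_vec \<delta> (map (image h) xs) = chain_vec (\<lambda>X. \<delta> (h ` X)) xs" for xs
    by (auto simp: chain_vec_def)
  ultimately show ?thesis by (simp add: chain_gf_def sum_chains_image[OF fin inj] cong: sum.cong)
qed

lemma chain_gf_empty: "chain_gf k {} (\<lambda>_. 0) = 1"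
proof -
  have "xs \<in> set_chains k {} \<longleftrightarrow> xs = replicate k {}" for xs :: "'a set list"
    unfolding replicate_eqI[of xs k "{}"]
    by (auto simp: set_chains_def sorted_wrt_iff_nth_less intro!: replicate_eqI)
  then have "set_chains k {} = {replicate k ({} :: 'a set)}" by blast
  moreover have "chain_vec (\<lambda>_. 0) xs = 0" for xs :: "'a set list"
    by (simp add: chain_vec_def fun_eq_iff)
  ultimately show ?thesis
    by (simp add: chain_gf_def chain_sign_def sum_list_replicate)
qed

lemma keys_chain_gf:
  assumes anti: "\<And>X Y. X \<subseteq> Y \<Longrightarrow> Y \<subseteq> E \<Longrightarrow> \<delta> Y \<le> \<delta> X"
  shows "Poly_Mapping.keys (chain_gf k E \<delta>) \<subseteq> antitone_upto k"
proof -
  have "chain_vec \<delta> xs \<in> antitone_upto k" if xs: "xs \<in> set_chains k E" for xs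
  proof -
    have "\<delta> (xs ! j) \<le> \<delta> (xs ! i)" if ij: "i \<le> j" "j < k" for i j
    proof (cases "i = j")
      case False
      then have "xs ! i \<subseteq> xs ! j" using xs ij by (auto simp: set_chains_def sorted_wrt_iff_nth_less)
      moreover have "xs ! j \<in> set xs" using xs ij by (simp add: set_chains_def)
      then have "xs ! j \<subseteq> E" using xs by (auto simp: set_chains_def)
      ultimately show ?thesis by (rule anti)
    qed simp
    then show ?thesis using xs by (auto simp: antitone_upto_def chain_vec_def set_chains_def)
  qed
  then show ?thesis unfolding chain_gf_def
    by (intro order_trans[OF keys_sum]) (auto simp: keys_single split: if_splits)
qed

text \<open>Expectation of \<open>w\<close> under a signed law. It turns equations between laws into
  the weighted chain sums that \<open>left_KL_coeff_chains\<close> takes as input.\<close>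

definition linear_eval :: "('b \<Rightarrow> int) \<Rightarrow> ('b \<Rightarrow>\<^sub>0 int) \<Rightarrow> int" where
  "linear_eval w x = (\<Sum>v\<in>Poly_Mapping.keys x. Poly_Mapping.lookup x v * w v)"

text \<open>As a \<open>frag_extend\<close> into the free abelian group on one generator, the
  expectation inherits additivity.\<close>

lemma linear_eval_frag: "linear_eval w x = Poly_Mapping.lookup (frag_extend (\<lambda>v. frag_cmul (w v) (frag_of ())) x) ()"
  by (simp add: linear_eval_def frag_extend_def lookup_sum)

lemma linear_eval_sum: "finite I \<Longrightarrow> linear_eval w (\<Sum>i\<in>I. x i) = (\<Sum>i\<in>I. linear_eval w (x i))"
  by (simp add: linear_eval_frag frag_extend_sum lookup_sum)

lemma linear_eval_single: "linear_eval w (Poly_Mapping.single v c) = c * w v"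
  by (simp add: linear_eval_def)

lemma linear_eval_chain_gf:
  "finite E \<Longrightarrow> linear_eval w (chain_gf k E \<delta>) = (\<Sum>xs\<in>set_chains k E. chain_sign xs * w (chain_vec \<delta> xs))"
  by (simp add: chain_gf_def linear_eval_sum finite_chains linear_eval_single)

section \<open>Block decomposition of the rank functions\<close>

definition blocks :: "nat \<Rightarrow> nat \<Rightarrow> nat \<Rightarrow> nat set" where
  "blocks c i n = {i * c + 1..(i + n) * c}"

lemma finite_blocks [simp]: "finite (blocks c i n)"
  by (simp add: blocks_def)

lemma blocks_0 [simp]: "blocks c i 0 = {}"
  by (simp add: blocks_def)

lemma card_blocks [simp]: "card (blocks c i n) = n * c"
  by (simp add: blocks_def algebra_simps)

lemma blocks_add: "blocks c i (m + n) = blocks c i m \<union> blocks c (i + m) n"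
  unfolding blocks_def by (auto simp: algebra_simps)

lemma blocks_disjoint: "i + m \<le> j \<Longrightarrow> blocks c i m \<inter> blocks c j n = {}"
proof -
  assume "i + m \<le> j"
  then have "(i + m) * c \<le> j * c" by (rule mult_le_mono1)
  then have "\<not> x \<le> (i + m) * c" if "j * c + 1 \<le> x" for x using that by linarith
  then show ?thesis unfolding blocks_def disjoint_iff atLeastAtMost_iff by blast
qed

lemma blocks_Suc: "blocks c i (Suc n) = blocks c i 1 \<union> blocks c (Suc i) n"
  using blocks_add[of c i 1 n] by simp

lemma blocks_image: "blocks c (i + j) n = (\<lambda>x. x + j * c) ` blocks c i n"
  unfolding blocks_def image_add_atLeastAtMost' by (simp add: algebra_simps)

text \<open>\<open>block_defect b c n i X\<close> is the maximum over \<open>j \<le> n\<close> of the partial sums of \<open>b - card (X \<inter> B)\<close> over the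
  first \<open>j\<close> blocks \<open>B\<close>; it is the amount by which \<open>X\<close> fails to have full rank in the Catalan matroid.\<close>

primrec block_defect :: "nat \<Rightarrow> nat \<Rightarrow> nat \<Rightarrow> nat \<Rightarrow> nat set \<Rightarrow> int" where
  "block_defect b c 0 i X = 0"
| "block_defect b c (Suc n) i X =
    max 0 ((int b - int (card (X \<inter> blocks c i 1))) + block_defect b c n (Suc i) X)"

lemma block_defect_restrict: "block_defect b c n i (X \<inter> blocks c i n) = block_defect b c n i X"
proof (induction n arbitrary: i X)
  case (Suc n)
  have e: "X \<inter> blocks c i (Suc n) \<inter> blocks c i 1 = X \<inter> blocks c i 1"
    "X \<inter> blocks c i (Suc n) \<inter> blocks c (Suc i) n = X \<inter> blocks c (Suc i) n"
    unfolding blocks_Suc by auto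
  have "block_defect b c n (Suc i) (X \<inter> blocks c i (Suc n)) = block_defect b c n (Suc i) X"
    using Suc.IH[of "Suc i" "X \<inter> blocks c i (Suc n)"] Suc.IH[of "Suc i" X] unfolding e by simp
  then show ?case by (simp only: block_defect.simps e)
qed simp

lemma block_defect_nonneg: "0 \<le> block_defect b c n i X"
  by (cases n) auto

lemma block_defect_le: "block_defect b c n i X \<le> int (n * b)"
proof (induction n arbitrary: i)
  case (Suc n)
  have "block_defect b c n (Suc i) X \<le> int (n * b)" by (rule Suc.IH)
  then show ?case by (simp add: algebra_simps)
qed simp

lemma block_defect_antimono:
  "X \<subseteq> Y \<Longrightarrow> block_defect b c n i Y \<le> block_defect b c n i X"
proof (induction n arbitrary: i)
  case (Suc n)
  have "card (X \<inter> blocks c i 1) \<le> card (Y \<inter> blocks c i 1)"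
    using Suc.prems by (intro card_mono) auto
  then show ?case using Suc.IH[OF Suc.prems, of "Suc i"] by simp
qed simp

lemma block_defect_full:
  assumes "b \<le> c" shows "block_defect b c n i (blocks c i n) = 0"
proof (induction n arbitrary: i)
  case (Suc n)
  have "block_defect b c n (Suc i) (blocks c i (Suc n)) = block_defect b c n (Suc i) (blocks c (Suc i) n)"
    using block_defect_restrict[of b c n "Suc i" "blocks c i (Suc n)"]
    unfolding blocks_Suc[of c i n] by (simp add: Int_absorb1)
  then have "block_defect b c n (Suc i) (blocks c i (Suc n)) = 0" using Suc.IH by simp
  moreover have "blocks c i (Suc n) \<inter> blocks c i 1 = blocks c i 1" unfolding blocks_Suc[of c i n] by auto
  ultimately show ?case using assms by simp
qed simp

text \<open>The law of a single step, computed on the first block; by \<open>chain_gf_block\<close>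
  every other block gives the same.\<close>

definition block_gf :: "nat \<Rightarrow> nat \<Rightarrow> nat \<Rightarrow> (nat \<Rightarrow> int) \<Rightarrow>\<^sub>0 int" where
  "block_gf b c k = chain_gf k (blocks c 0 1) (\<lambda>X. int b - int (card X))"

lemma chain_gf_block: "chain_gf k (blocks c i 1) (\<lambda>X. int b - int (card X)) = block_gf b c k"
proof -
  have "chain_gf k (blocks c i 1) (\<lambda>X. int b - int (card X)) =
      chain_gf k (blocks c 0 1) (\<lambda>X. int b - int (card ((\<lambda>x. x + i * c) ` X)))"
    using blocks_image[of c 0 i 1] by (simp add: chain_gf_image)
  also have "\<dots> = block_gf b c k"
    by (simp add: block_gf_def card_image)
  finally show ?thesis .
qed

lemma chain_gf_blocks_power:
  "chain_gf k (blocks c i m) (\<lambda>X. int (m * b) - int (card X)) = block_gf b c k ^ m"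
proof (induction m arbitrary: i)
  case 0
  have "chain_gf k {} (\<lambda>X. int (0 * b) - int (card (X :: nat set))) = chain_gf k ({} :: nat set) (\<lambda>_. 0)"
    by (rule chain_gf_cong) (simp add: subset_empty)
  then show ?case by (simp add: chain_gf_empty)
next
  case (Suc m)
  have disj: "blocks c i 1 \<inter> blocks c (Suc i) m = {}" by (rule blocks_disjoint) simp
  have "chain_gf k (blocks c i (Suc m)) (\<lambda>X. int (Suc m * b) - int (card X)) =
      chain_gf k (blocks c i 1 \<union> blocks c (Suc i) m)
        (\<lambda>X. (int b - int (card (X \<inter> blocks c i 1))) + (int (m * b) - int (card (X \<inter> blocks c (Suc i) m))))"
    unfolding blocks_Suc[of c i m]
  proof (rule chain_gf_cong)
    fix X assume X: "X \<subseteq> blocks c i 1 \<union> blocks c (Suc i) m"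
    have "X = (X \<inter> blocks c i 1) \<union> (X \<inter> blocks c (Suc i) m)" using X by blast
    then have "card X = card (X \<inter> blocks c i 1) + card (X \<inter> blocks c (Suc i) m)"
      using disj by (metis card_Un_disjoint finite_Int finite_blocks inf_left_commute inf_assoc inf_bot_right)
    then show "int (Suc m * b) - int (card X) =
        int b - int (card (X \<inter> blocks c i 1)) + (int (m * b) - int (card (X \<inter> blocks c (Suc i) m)))" by simp
  qed
  also have "\<dots> = block_gf b c k * block_gf b c k ^ m"
    by (subst chain_gf_add[OF _ _ disj]) (simp_all only: chain_gf_block Suc.IH finite_blocks)
  finally show ?case by simp
qed

text \<open>Splitting off the first block adds an independent step and then takes the positive part,
  which is the recursion of \<open>baxter_iter\<close>.\<close>

lemma chain_gf_block_defect:
  "chain_gf k (blocks c i n) (block_defect b c n i) = baxter_iter (block_gf b c k) n"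
proof (induction n arbitrary: i)
  case 0
  then show ?case by (simp add: chain_gf_empty block_defect.simps(1)[abs_def])
next
  case (Suc n)
  have disj: "blocks c i 1 \<inter> blocks c (Suc i) n = {}" by (rule blocks_disjoint) simp
  have "chain_gf k (blocks c i (Suc n)) (block_defect b c (Suc n) i) =
      chain_gf k (blocks c i 1 \<union> blocks c (Suc i) n)
        (\<lambda>X. max 0 ((int b - int (card (X \<inter> blocks c i 1))) +
           block_defect b c n (Suc i) (X \<inter> blocks c (Suc i) n)))"
    unfolding blocks_Suc[of c i n] block_defect_restrict by (rule chain_gf_cong) simp
  also have "\<dots> = baxter (block_gf b c k * baxter_iter (block_gf b c k) n)"
    by (subst chain_gf_pos_part, simp, subst chain_gf_add[OF _ _ disj])
      (simp_all only: chain_gf_block Suc.IH finite_blocks)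
  finally show ?case by (simp only: baxter_iter.simps)
qed

lemma keys_block_gf: "Poly_Mapping.keys (block_gf b c k) \<subseteq> antitone_upto k"
  unfolding block_gf_def
proof (rule keys_chain_gf)
  fix X Y assume "X \<subseteq> Y" "Y \<subseteq> blocks c 0 1"
  then have "card X \<le> card Y" by (meson card_mono finite_blocks finite_subset)
  then show "int b - int (card Y) \<le> int b - int (card X)" by simp
qed

definition catalan_rank :: "nat \<Rightarrow> nat \<Rightarrow> nat \<Rightarrow> nat set \<Rightarrow> nat" where
  "catalan_rank b c n X = nat (int (n * b) - block_defect b c n 0 X)"

definition uniform_rank :: "nat \<Rightarrow> nat \<Rightarrow> 'a set \<Rightarrow> nat" where
  "uniform_rank b m X = min (m * b) (card X)"

text \<open>The rank function of the direct sum of the Catalan matroid on the first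
  \<open>n - m\<close> blocks and the uniform matroid on the last \<open>m\<close>. All these sums
  live on the same ground set, so that their chain counts can be compared; \<open>m = 0\<close> is
  the Catalan matroid itself.\<close>

definition mixed_rank :: "nat \<Rightarrow> nat \<Rightarrow> nat \<Rightarrow> nat \<Rightarrow> nat set \<Rightarrow> nat" where
  "mixed_rank b c n m X = catalan_rank b c (n - m) (X \<inter> blocks c 0 (n - m)) +
     uniform_rank b m (X \<inter> blocks c (n - m) m)"

definition mixed_defect :: "nat \<Rightarrow> nat \<Rightarrow> nat \<Rightarrow> nat \<Rightarrow> nat set \<Rightarrow> int" where
  "mixed_defect b c n m X = block_defect b c (n - m) 0 (X \<inter> blocks c 0 (n - m)) +
     max 0 (int (m * b) - int (card (X \<inter> blocks c (n - m) m)))"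

lemma catalan_rank_eq: "int (catalan_rank b c n X) = int (n * b) - block_defect b c n 0 X"
  using block_defect_le[of b c n 0 X] by (simp add: catalan_rank_def)

lemma mixed_rank_eq:
  assumes "m \<le> n"
  shows "mixed_rank b c n m X = nat (int (n * b) - mixed_defect b c n m X)"
proof -
  have "int (n * b) = int ((n - m) * b) + int (m * b)"
    using assms by (simp flip: of_nat_add distrib_right)
  then have "int (mixed_rank b c n m X) = int (n * b) - mixed_defect b c n m X"
    unfolding mixed_rank_def mixed_defect_def of_nat_add catalan_rank_eq uniform_rank_def
    by (simp add: max_def min_def flip: of_nat_mult)
  then show ?thesis by simp
qed

lemma mixed_rank_0: "mixed_rank b c n 0 X = catalan_rank b c n X"
  by (simp add: mixed_rank_def uniform_rank_def catalan_rank_def block_defect_restrict)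

lemma mixed_rank_full:
  assumes "b \<le> c" "m \<le> n"
  shows "mixed_rank b c n m (blocks c 0 n) = n * b"
proof -
  have "blocks c 0 n = blocks c 0 (n - m) \<union> blocks c (n - m) m"
    using blocks_add[of c 0 "n - m" m] assms by simp
  then have "blocks c 0 n \<inter> blocks c 0 (n - m) = blocks c 0 (n - m)"
    "blocks c 0 n \<inter> blocks c (n - m) m = blocks c (n - m) m" by auto
  moreover have "nat (int ((n - m) * b)) + m * b = n * b"
    unfolding nat_int using assms by (simp flip: distrib_right)
  ultimately show ?thesis using assms
    by (simp add: mixed_rank_def uniform_rank_def catalan_rank_def block_defect_full del: of_nat_mult)
qed

lemma chain_gf_mixed_defect:
  assumes "m \<le> n"
  shows "chain_gf k (blocks c 0 n) (mixed_defect b c n m) =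
    baxter (block_gf b c k ^ m) * baxter_iter (block_gf b c k) (n - m)"
proof -
  have E: "blocks c 0 n = blocks c 0 (n - m) \<union> blocks c (n - m) m"
    using blocks_add[of c 0 "n - m" m] assms by simp
  have disj: "blocks c 0 (n - m) \<inter> blocks c (n - m) m = {}" by (rule blocks_disjoint) simp
  have "chain_gf k (blocks c 0 n) (mixed_defect b c n m) =
      chain_gf k (blocks c 0 (n - m)) (block_defect b c (n - m) 0) *
      chain_gf k (blocks c (n - m) m) (\<lambda>X. max 0 (int (m * b) - int (card X)))"
    unfolding E mixed_defect_def[abs_def] by (rule chain_gf_add) (simp_all add: disj)
  also have "\<dots> = baxter_iter (block_gf b c k) (n - m) * baxter (block_gf b c k ^ m)"
    by (simp only: chain_gf_block_defect chain_gf_pos_part finite_blocks chain_gf_blocks_power)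
  finally show ?thesis by (simp add: mult.commute)
qed

text \<open>Spitzer's recursion with everything on one side, hence the coefficients \<open>n\<close>
  at \<open>m = 0\<close> and \<open>-1\<close> elsewhere, evaluated on a weight of rank
  sequences.\<close>

lemma mixed_chain_sum:
  "(\<Sum>m\<le>n. (if m = 0 then int n else -1) *
     (\<Sum>xs\<in>set_chains k (blocks c 0 n). chain_sign xs * w (map (mixed_rank b c n m) xs))) = 0"
proof -
  \<comment> \<open>A rank is \<open>n * b\<close> minus a defect, so a weight of ranks can be read
    as a weight \<open>W\<close> of defect vectors.\<close>
  define W where "W v = w (map (\<lambda>l. nat (int (n * b) - v l)) [0..<k])" for v :: "nat \<Rightarrow> int"
  have ev: "(\<Sum>xs\<in>set_chains k (blocks c 0 n). chain_sign xs * w (map (mixed_rank b c n m) xs)) =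
      linear_eval W (chain_gf k (blocks c 0 n) (mixed_defect b c n m))" if "m \<le> n" for m
  proof -
    have "map (mixed_rank b c n m) xs = map (\<lambda>l. nat (int (n * b) - chain_vec (mixed_defect b c n m) xs l)) [0..<k]"
      if "xs \<in> set_chains k (blocks c 0 n)" for xs
      using that mixed_rank_eq[OF \<open>m \<le> n\<close>]
      by (intro nth_equalityI) (auto simp: set_chains_def chain_vec_def)
    then show ?thesis by (simp add: linear_eval_chain_gf W_def cong: sum.cong)
  qed
  let ?G = "\<lambda>m. chain_gf k (blocks c 0 n) (mixed_defect b c n m)"
  \<comment> \<open>A sum of \<open>n\<close> equal terms stands for the factor \<open>n\<close>, so
    that additivity of \<open>linear_eval\<close> suffices below. At \<open>m = 0\<close> the first
    factor of \<open>chain_gf_mixed_defect\<close> is \<open>baxter 1 = 1\<close>.\<close>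
  have "(\<Sum>i<n. ?G 0) = of_nat n * baxter_iter (block_gf b c k) n"
    using baxter_single[of 0 1] by (simp add: chain_gf_mixed_defect pos_part_fun_def flip: zero_fun_def)
  also have "\<dots> = (\<Sum>i<n. ?G (Suc i))"
    unfolding spitzer_recursion[OF keys_block_gf]
    by (intro sum.cong) (simp_all add: chain_gf_mixed_defect del: power_Suc)
  finally have "linear_eval W (\<Sum>i<n. ?G 0) = linear_eval W (\<Sum>i<n. ?G (Suc i))" by simp
  then have "int n * linear_eval W (?G 0) = (\<Sum>i<n. linear_eval W (?G (Suc i)))"
    by (simp only: linear_eval_sum finite_lessThan) simp
  moreover have "(\<Sum>m\<le>n. (if m = 0 then int n else -1) *
      (\<Sum>xs\<in>set_chains k (blocks c 0 n). chain_sign xs * w (map (mixed_rank b c n m) xs))) =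
    (\<Sum>m\<le>n. (if m = 0 then int n else -1) * linear_eval W (?G m))"
    by (intro sum.cong refl arg_cong2[of _ _ _ _ "(*)"] ev) simp
  moreover have "\<dots> = int n * linear_eval W (?G 0) - (\<Sum>i<n. linear_eval W (?G (Suc i)))"
    unfolding sum.atMost_shift by (simp add: sum_negf)
  ultimately show ?thesis by simp
qed

lemma left_KL_coeff_mixed:
  assumes "b \<le> c"
  shows "int n * left_KL_coeff f (catalan_rank b c n) (blocks c 0 n) j =
    (\<Sum>i<n. left_KL_coeff f (mixed_rank b c n (Suc i)) (blocks c 0 n) j)"
proof -
  \<comment> \<open>At length 0 the empty chain is the only one, and the set it refers to is the
    full ground set.\<close>
  have "(\<Sum>m\<le>n. (if m = 0 then int n else -1) *
    (\<Sum>xs\<in>set_chains 0 (blocks c 0 n). chain_sign xs * 1 *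
      left_KL_coeff f (mixed_rank b c n m) (hd (xs @ [blocks c 0 n])) j)) = 0"
    by (rule left_KL_coeff_chains[where w = "\<lambda>_. 1" and J = "\<lambda>_. j"])
      (use mixed_rank_full[OF assms] mixed_chain_sum in auto)
  then have "(\<Sum>m\<le>n. (if m = 0 then int n else -1) *
      left_KL_coeff f (mixed_rank b c n m) (blocks c 0 n) j) = 0"
    by (simp add: chains_0 chain_sign_def)
  then show ?thesis unfolding sum.atMost_shift by (simp add: sum_negf mixed_rank_0[abs_def])
qed

section \<open>Uniform and Catalan matroids\<close>

text \<open>The Schubert conditions of the Catalan matroid are implied by those at the ends of the blocks;
  the uniform matroid has no conditions except the trivial ones at both ends.\<close>

definition prefix_matroid :: "nat \<Rightarrow> nat \<Rightarrow> nat \<Rightarrow> nat set \<Rightarrow> nat matroid" where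
  "prefix_matroid b c n J =
     Matroid {1..n * c} {T. T \<subseteq> {1..n * c} \<and> card T = n * b \<and> (\<forall>j\<in>J. j * b \<le> card (T \<inter> {..j * c}))}"

lemma bases_prefix_matroid:
  "T \<in> bases (prefix_matroid b c n J) \<longleftrightarrow>
     T \<subseteq> {1..n * c} \<and> card T = n * b \<and> (\<forall>j\<in>J. j * b \<le> card (T \<inter> {..j * c}))"
  by (simp add: prefix_matroid_def)

lemma ground_prefix_matroid [simp]: "ground (prefix_matroid b c n J) = {1..n * c}"
  by (simp add: prefix_matroid_def)

lemma is_matroid_prefix_matroid:
  assumes "b \<le> c" "J \<subseteq> {..n}"
  shows "is_matroid (prefix_matroid b c n J)"
  unfolding is_matroid_def
proof (intro conjI ballI)
  have "{1..n * b} \<in> bases (prefix_matroid b c n J)"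
    unfolding bases_prefix_matroid
  proof (intro conjI ballI)
    show "{1..n * b} \<subseteq> {1..n * c}" using assms by (auto intro: order_trans)
    fix j assume "j \<in> J"
    then have "j * b \<le> n * b" "j * b \<le> j * c" using assms by auto
    then have "{1..j * b} \<subseteq> {1..n * b} \<inter> {..j * c}" by auto
    then have "card {1..j * b} \<le> card ({1..n * b} \<inter> {..j * c})" by (intro card_mono) auto
    then show "j * b \<le> card ({1..n * b} \<inter> {..j * c})" by simp
  qed simp
  then show "bases (prefix_matroid b c n J) \<noteq> {}" by blast
next
  fix T T' x
  assume T: "T \<in> bases (prefix_matroid b c n J)" and T': "T' \<in> bases (prefix_matroid b c n J)"
    and x: "x \<in> T - T'"
  have fin: "finite T" "finite T'" using T T' finite_subset by (auto simp: bases_prefix_matroid)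
  have card: "card T = n * b" "card T' = n * b" using T T' by (auto simp: bases_prefix_matroid)
  have "T' - T \<noteq> {}"
  proof
    assume "T' - T = {}"
    then have "T' = T" using fin card by (intro card_subset_eq) auto
    then show False using x by simp
  qed
  \<comment> \<open>With the smallest possible \<open>y\<close> every prefix condition holds: a
    prefix that contains \<open>y\<close> is at least as full as before, and in a shorter one
    \<open>T'\<close> is contained in the new set, so the condition carries over from
    \<open>T'\<close>.\<close>
  define y where "y = Min (T' - T)"
  have y: "y \<in> T' - T" unfolding y_def using fin \<open>T' - T \<noteq> {}\<close> by (intro Min_in) auto
  have min: "y \<le> z" if "z \<in> T' - T" for z unfolding y_def using fin that by (intro Min_le) auto
  define T2 where "T2 = insert y (T - {x})"
  have fin2: "finite T2" using fin by (simp add: T2_def)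
  have ins: "card (insert y (A - {x})) \<ge> card A" if "A \<subseteq> T" for A
  proof -
    have "finite A" using that fin finite_subset by blast
    moreover have "y \<notin> A - {x}" using y that by blast
    ultimately show ?thesis by (cases "x \<in> A") (simp_all add: card_Suc_Diff1 del: card_Diff_insert)
  qed
  have "T2 \<in> bases (prefix_matroid b c n J)"
    unfolding bases_prefix_matroid
  proof (intro conjI ballI)
    show "T2 \<subseteq> {1..n * c}" using T T' y by (auto simp: T2_def bases_prefix_matroid)
    have "card T2 = Suc (card (T - {x}))" using y fin by (simp add: T2_def)
    then show "card T2 = n * b" using x fin card by (simp add: card_Suc_Diff1 del: card_Diff_insert)
    fix j assume j: "j \<in> J"
    show "j * b \<le> card (T2 \<inter> {..j * c})"
    proof (cases "y \<le> j * c")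
      case True
      have "j * b \<le> card (T \<inter> {..j * c})" using T j by (simp add: bases_prefix_matroid)
      also have "\<dots> \<le> card (insert y (T \<inter> {..j * c} - {x}))" by (rule ins) auto
      also have "insert y (T \<inter> {..j * c} - {x}) = T2 \<inter> {..j * c}" using True by (auto simp: T2_def)
      finally show ?thesis .
    next
      case False
      have "z \<in> T2" if z: "z \<in> T'" "z \<le> j * c" for z
      proof -
        have "z \<in> T" using min[of z] z False by (cases "z \<in> T") auto
        moreover have "z \<noteq> x" using z x by blast
        ultimately show ?thesis by (simp add: T2_def)
      qed
      then have "card (T' \<inter> {..j * c}) \<le> card (T2 \<inter> {..j * c})"
        using fin2 by (intro card_mono) auto
      moreover have "j * b \<le> card (T' \<inter> {..j * c})" using T' j by (simp add: bases_prefix_matroid)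
      ultimately show ?thesis by simp
    qed
  qed
  then show "\<exists>y\<in>T' - T. insert y (T - {x}) \<in> bases (prefix_matroid b c n J)"
    using y by (auto simp: T2_def)
qed (auto simp: bases_prefix_matroid)

lemma rank_prefix_matroid_le:
  assumes M: "is_matroid (prefix_matroid b c n J)" and j: "j \<in> J" "j \<le> n"
  shows "rank_of (prefix_matroid b c n J) X \<le> card (X \<inter> {..j * c}) + (n - j) * b"
proof -
  obtain T where T: "T \<in> bases (prefix_matroid b c n J)"
    and r: "card (T \<inter> X) = rank_of (prefix_matroid b c n J) X" using rank_of_attained[OF M] .
  have fin: "finite T" using T finite_subset by (auto simp: bases_prefix_matroid)
  have "T = (T \<inter> {..j * c}) \<union> (T - {..j * c})" by blast
  then have "card T = card (T \<inter> {..j * c}) + card (T - {..j * c})"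
    using fin by (metis card_Int_Diff)
  moreover have "j * b \<le> card (T \<inter> {..j * c})" "card T = n * b" using T j by (auto simp: bases_prefix_matroid)
  ultimately have "card (T - {..j * c}) \<le> (n - j) * b" by (simp add: diff_mult_distrib)
  moreover have "card (T \<inter> X) \<le> card ((T \<inter> X \<inter> {..j * c}) \<union> (T - {..j * c}))"
    using fin by (intro card_mono) auto
  moreover have "\<dots> \<le> card (T \<inter> X \<inter> {..j * c}) + card (T - {..j * c})" by (rule card_Un_le)
  moreover have "card (T \<inter> X \<inter> {..j * c}) \<le> card (X \<inter> {..j * c})" by (intro card_mono) auto
  ultimately show ?thesis using r by linarith
qed

text \<open>Let \<open>T\<close> be a basis that meets \<open>X\<close> in as many elements as
  possible, not comparable with \<open>X\<close>. Replacing the largest \<open>y\<close> in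
  \<open>T - X\<close> by the smallest \<open>x\<close> in \<open>X - T\<close> would be an
  improvement, so it violates some condition \<open>j\<close>; that condition is tight for
  \<open>T\<close>, and \<open>y \<le> j * c < x\<close>. Hence all of \<open>X\<close> up to
  \<open>j * c\<close> lies in \<open>T\<close>, and all of \<open>T\<close> beyond it lies in
  \<open>X\<close>. The comparable cases take \<open>j = n\<close> and \<open>j = 0\<close>.\<close>

lemma rank_prefix_matroid_attained:
  assumes M: "is_matroid (prefix_matroid b c n J)" and J: "0 \<in> J" "n \<in> J" "J \<subseteq> {..n}"
    and X: "X \<subseteq> {1..n * c}"
  shows "\<exists>j\<in>J. rank_of (prefix_matroid b c n J) X = card (X \<inter> {..j * c}) + (n - j) * b"
proof -
  obtain T where T: "T \<in> bases (prefix_matroid b c n J)"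
    and r: "card (T \<inter> X) = rank_of (prefix_matroid b c n J) X" using rank_of_attained[OF M] .
  have T': "T \<subseteq> {1..n * c}" "card T = n * b" "\<And>j. j \<in> J \<Longrightarrow> j * b \<le> card (T \<inter> {..j * c})"
    using T by (auto simp: bases_prefix_matroid)
  have fin: "finite T" "finite X" using T'(1) X by (meson finite_atLeastAtMost finite_subset)+
  consider "X \<subseteq> T" | "T \<subseteq> X" | "X - T \<noteq> {}" "T - X \<noteq> {}" by blast
  then show ?thesis
  proof cases
    case 1
    then have "T \<inter> X = X" "X \<inter> {..n * c} = X" using X by auto
    then show ?thesis using r J by (intro bexI[of _ n]) auto
  next
    case 2
    then have "T \<inter> X = T" "X \<inter> {..0 * c} = {}" using X by auto
    then show ?thesis using r J T' by (intro bexI[of _ 0]) auto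
  next
    case 3
    define y where "y = Max (T - X)"
    define x where "x = Min (X - T)"
    have y: "y \<in> T - X" and ymax: "\<And>z. z \<in> T - X \<Longrightarrow> z \<le> y"
      using 3 fin Max_in[of "T - X"] unfolding y_def by auto
    have x: "x \<in> X - T" and xmin: "\<And>z. z \<in> X - T \<Longrightarrow> x \<le> z"
      using 3 fin Min_in[of "X - T"] unfolding x_def by auto
    define T2 where "T2 = insert x (T - {y})"
    have "card T2 = Suc (card (T - {y}))" using x fin by (simp add: T2_def)
    then have c2: "card T2 = n * b" using y fin T' by (simp add: card_Suc_Diff1 del: card_Diff_insert)
    have "T2 \<inter> X = insert x (T \<inter> X)" using x y by (auto simp: T2_def)
    then have "card (T2 \<inter> X) = Suc (card (T \<inter> X))" using x fin by simp
    then have "T2 \<notin> bases (prefix_matroid b c n J)"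
      using rank_of_bound[OF M, of T2 X] r by auto
    moreover have "T2 \<subseteq> {1..n * c}" using T' x X by (auto simp: T2_def)
    ultimately obtain j where j: "j \<in> J" "card (T2 \<inter> {..j * c}) < j * b"
      using c2 by (auto simp: bases_prefix_matroid not_le)
    have lt: "card (T2 \<inter> {..j * c}) < card (T \<inter> {..j * c})" using j T'(3)[OF j(1)] by simp
    have yj: "y \<le> j * c"
    proof (rule ccontr)
      assume "\<not> y \<le> j * c"
      then have "T \<inter> {..j * c} \<subseteq> T2 \<inter> {..j * c}" by (auto simp: T2_def)
      then have "card (T \<inter> {..j * c}) \<le> card (T2 \<inter> {..j * c})" by (intro card_mono) auto
      then show False using lt by simp
    qed
    have D: "card (T \<inter> {..j * c} - {y}) = card (T \<inter> {..j * c}) - 1" using y yj by simp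
    have xj: "j * c < x"
    proof (rule ccontr)
      assume "\<not> j * c < x"
      then have "T2 \<inter> {..j * c} = insert x (T \<inter> {..j * c} - {y})" by (auto simp: T2_def)
      then have "card (T2 \<inter> {..j * c}) = Suc (card (T \<inter> {..j * c}) - 1)"
        using x D by simp
      then show False using lt by linarith
    qed
    have "T2 \<inter> {..j * c} = T \<inter> {..j * c} - {y}" using xj by (auto simp: T2_def)
    then have tight: "card (T \<inter> {..j * c}) = j * b"
      using j(2) T'(3)[OF j(1)] D by simp
    have "X \<inter> {..j * c} = T \<inter> X \<inter> {..j * c}" using xmin xj by fastforce
    moreover have "T - {..j * c} = T \<inter> X - {..j * c}" using ymax yj by fastforce
    moreover have "card (T \<inter> X) = card (T \<inter> X \<inter> {..j * c}) + card (T \<inter> X - {..j * c})"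
      using fin by (metis card_Int_Diff finite_Int)
    moreover have "card T = card (T \<inter> {..j * c}) + card (T - {..j * c})"
      using fin by (metis card_Int_Diff)
    ultimately have "card (T \<inter> X) = card (X \<inter> {..j * c}) + (n - j) * b"
      using tight T'(2) by (simp add: diff_mult_distrib)
    then show ?thesis using r j(1) by auto
  qed
qed

lemma loopless_prefix_matroid:
  assumes "0 < b" "b \<le> c" "0 \<in> J" "n \<in> J" "J \<subseteq> {..n}"
  shows "loopless (prefix_matroid b c n J)"
proof -
  have M: "is_matroid (prefix_matroid b c n J)" using assms by (intro is_matroid_prefix_matroid)
  have "0 < rank_of (prefix_matroid b c n J) {e}" if e: "e \<in> {1..n * c}" for e
  proof -
    obtain j where j: "j \<in> J"
      "rank_of (prefix_matroid b c n J) {e} = card ({e} \<inter> {..j * c}) + (n - j) * b"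
      using rank_prefix_matroid_attained[OF M assms(3-5), of "{e}"] e by auto
    show ?thesis
    proof (cases "j = n")
      case True
      then have "{e} \<inter> {..j * c} = {e}" using e by auto
      then show ?thesis using j by simp
    next
      case False
      then have "j < n" using assms(5) j(1) by fastforce
      then show ?thesis using j assms by simp
    qed
  qed
  then show ?thesis by (simp add: loopless_iff_rank[OF M])
qed

section \<open>Schubert conditions as conditions on prefix counts\<close>

lemma nth_sorted_list_of_set_le_iff:
  fixes T :: "nat set"
  assumes fin: "finite T" and i: "i < card T"
  shows "sorted_list_of_set T ! i \<le> p \<longleftrightarrow> i < card (T \<inter> {..p})"
proof -
  let ?l = "sorted_list_of_set T"
  have len: "length ?l = card T" by simp
  have mono: "?l ! j \<le> ?l ! k" if "j \<le> k" "k < card T" for j k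
    using that len by (intro sorted_nth_mono) auto
  have "bij_betw ((!) ?l) {..<card T} T"
    using bij_betw_nth[of ?l "{..<card T}" T] fin by simp
  then have inj: "inj_on ((!) ?l) {..<card T}" and im: "(!) ?l ` {..<card T} = T"
    by (auto simp: bij_betw_def)
  define A where "A = {j. j < card T \<and> ?l ! j \<le> p}"
  have "(!) ?l ` A = T \<inter> {..p}" using im by (auto simp: A_def)
  moreover have "inj_on ((!) ?l) A" using inj by (rule inj_on_subset) (auto simp: A_def)
  ultimately have card: "card (T \<inter> {..p}) = card A" by (metis card_image)
  have finA: "finite A" by (simp add: A_def)
  show ?thesis
  proof
    assume "?l ! i \<le> p"
    then have "?l ! j \<le> p" if "j \<le> i" for j using mono[OF that i] by simp
    then have "{..i} \<subseteq> A" using i by (auto simp: A_def)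
    then have "card {..i} \<le> card A" using finA by (intro card_mono)
    then show "i < card (T \<inter> {..p})" using card by simp
  next
    assume lt: "i < card (T \<inter> {..p})"
    show "?l ! i \<le> p"
    proof (rule ccontr)
      assume "\<not> ?l ! i \<le> p"
      then have "A \<subseteq> {..<i}" using mono[of i] by (force simp: A_def not_le)
      then have "card A \<le> card {..<i}" by (intro card_mono) auto
      then show False using lt card by simp
    qed
  qed
qed

lemma sorted_list_le_iff_prefix_counts:
  fixes S T :: "nat set"
  assumes "finite S" "finite T" "card T = card S"
  shows "(\<forall>i<card S. sorted_list_of_set T ! i \<le> sorted_list_of_set S ! i) \<longleftrightarrow>
    (\<forall>p. card (S \<inter> {..p}) \<le> card (T \<inter> {..p}))"
proof (intro iffI allI impI)
  fix p assume *: "\<forall>i<card S. sorted_list_of_set T ! i \<le> sorted_list_of_set S ! i"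
  show "card (S \<inter> {..p}) \<le> card (T \<inter> {..p})"
  proof (cases "card (S \<inter> {..p})")
    case (Suc i)
    have "card (S \<inter> {..p}) \<le> card S" using assms by (intro card_mono) auto
    then have i: "i < card S" using Suc by simp
    then have "sorted_list_of_set S ! i \<le> p"
      using Suc nth_sorted_list_of_set_le_iff[OF assms(1) i] by simp
    then have "sorted_list_of_set T ! i \<le> p" using * i by (meson order_trans)
    then show ?thesis using nth_sorted_list_of_set_le_iff[OF assms(2), of i p] i assms(3) Suc by simp
  qed simp
next
  fix i assume *: "\<forall>p. card (S \<inter> {..p}) \<le> card (T \<inter> {..p})" and i: "i < card S"
  have "i < card (S \<inter> {..sorted_list_of_set S ! i})"
    using nth_sorted_list_of_set_le_iff[OF assms(1) i, of "sorted_list_of_set S ! i"] by simp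
  also have "\<dots> \<le> card (T \<inter> {..sorted_list_of_set S ! i})" using * by blast
  finally show "sorted_list_of_set T ! i \<le> sorted_list_of_set S ! i"
    using nth_sorted_list_of_set_le_iff[OF assms(2)] i assms(3) by simp
qed

lemma nth_catalan_indicator:
  assumes "0 < b"
  shows "p < n * (a + b) \<Longrightarrow> catalan_indicator a b n ! p = (if p mod (a + b) < a then 0 else 1)"
proof (induction n arbitrary: p)
  case (Suc n)
  let ?xs = "replicate a 0 @ replicate b (1 :: nat)"
  have c: "catalan_indicator a b (Suc n) = ?xs @ catalan_indicator a b n"
    by (simp add: catalan_indicator_def)
  show ?case
  proof (cases "p < a + b")
    case True
    then show ?thesis unfolding c by (auto simp: nth_append)
  next
    case False
    then have "catalan_indicator a b (Suc n) ! p = catalan_indicator a b n ! (p - (a + b))"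
      unfolding c using False by (subst nth_append_right) auto
    also have "\<dots> = (if (p - (a + b)) mod (a + b) < a then 0 else 1)"
      using False Suc.prems by (intro Suc.IH) auto
    also have "(p - (a + b)) mod (a + b) = p mod (a + b)" using False by (simp add: le_mod_geq)
    finally show ?thesis .
  qed
qed simp

text \<open>These residues are the positions of the ones. Each full block contributes
  \<open>b\<close>; the truncated subtraction counts the ones of the unfinished block and is 0 among
  its zeros.\<close>

lemma card_residues_prefix:
  assumes "0 < b"
  shows "card {i \<in> {1..p}. a \<le> (i - 1) mod (a + b)} =
    (p div (a + b)) * b + (p mod (a + b) - a)"
proof (induction p)
  case (Suc p)
  let ?c = "a + b"
  have split: "{i \<in> {1..Suc p}. a \<le> (i - 1) mod ?c} =
      (if a \<le> p mod ?c then insert (Suc p) {i \<in> {1..p}. a \<le> (i - 1) mod ?c}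
       else {i \<in> {1..p}. a \<le> (i - 1) mod ?c})"
    by (auto simp: le_Suc_eq)
  have card: "card {i \<in> {1..Suc p}. a \<le> (i - 1) mod ?c} =
      (p div ?c) * b + (p mod ?c - a) + (if a \<le> p mod ?c then 1 else 0)"
    unfolding split using Suc.IH by simp
  show ?case
  proof (cases "Suc (p mod ?c) = ?c")
    case True
    then have "Suc p mod ?c = 0" "Suc p div ?c = Suc (p div ?c)"
      by (simp_all add: mod_Suc div_Suc)
    moreover have "p mod ?c = a + b - 1" using True by simp
    ultimately show ?thesis unfolding card using assms by simp
  next
    case False
    then have "Suc p mod ?c = Suc (p mod ?c)" "Suc p div ?c = p div ?c"
      by (simp_all add: mod_Suc div_Suc)
    then show ?thesis unfolding card by auto
  qed
qed simp

text \<open>While \<open>S\<close> has zeros its count is constant, so the condition at the start of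
  the block suffices. While it has ones, the count of \<open>T\<close> grows no faster than that of
  \<open>S\<close>, so the condition at the end of the block carries over backwards.\<close>

lemma catalan_matroid_eq_prefix:
  assumes "0 < b"
  shows "catalan_matroid a b n = prefix_matroid b (a + b) n {..n}"
proof -
  let ?c = "a + b" and ?N = "n * (a + b)"
  define S where "S = {i\<in>{1..?N}. catalan_indicator a b n ! (i - 1) = 1}"
  have S: "S = {i\<in>{1..?N}. a \<le> (i - 1) mod ?c}"
  proof -
    have "catalan_indicator a b n ! (i - 1) = 1 \<longleftrightarrow> a \<le> (i - 1) mod ?c" if "i \<in> {1..?N}" for i
    proof -
      have "i - 1 < ?N" using that by auto
      from nth_catalan_indicator[OF assms this] show ?thesis by simp
    qed
    then show ?thesis unfolding S_def by blast
  qed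
  define cnt where "cnt p = (p div ?c) * b + (p mod ?c - a)" for p
  have cS: "card (S \<inter> {..p}) = cnt (min p ?N)" for p
  proof -
    have "S \<inter> {..p} = {i \<in> {1..min p ?N}. a \<le> (i - 1) mod ?c}" unfolding S by auto
    then show ?thesis unfolding cnt_def by (simp only: card_residues_prefix[OF assms])
  qed
  have finS: "finite S" by (simp add: S)
  have "S \<inter> {..?N} = S" by (auto simp: S)
  then have cardS: "card S = n * b" using cS[of ?N] assms by (simp add: cnt_def)
  have "(\<forall>i<card S. sorted_list_of_set T ! i \<le> sorted_list_of_set S ! i) \<longleftrightarrow>
      (\<forall>j\<in>{..n}. j * b \<le> card (T \<inter> {..j * ?c}))"
    if T: "T \<subseteq> {1..?N}" "card T = card S" for T
  proof -
    have finT: "finite T" using T finite_subset by blast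
    have "(\<forall>p. card (S \<inter> {..p}) \<le> card (T \<inter> {..p})) \<longleftrightarrow> (\<forall>j\<in>{..n}. j * b \<le> card (T \<inter> {..j * ?c}))"
    proof (intro iffI allI ballI)
      fix j assume *: "\<forall>p. card (S \<inter> {..p}) \<le> card (T \<inter> {..p})" and j: "j \<in> {..n}"
      have "min (j * ?c) ?N = j * ?c" using j by (intro min_absorb1 mult_le_mono1) simp
      then have "cnt (j * ?c) \<le> card (T \<inter> {..j * ?c})" using * cS[of "j * ?c"] by metis
      then show "j * b \<le> card (T \<inter> {..j * ?c})" using assms by (simp add: cnt_def)
    next
      fix p assume *: "\<forall>j\<in>{..n}. j * b \<le> card (T \<inter> {..j * ?c})"
      define q j r where "q = min p ?N" and "j = q div ?c" and "r = q mod ?c"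
      have q: "q = j * ?c + r" "r < ?c" "q \<le> ?N"
        using assms div_mult_mod_eq[of q ?c] by (simp_all add: j_def r_def) (simp add: q_def)
      have Tq: "T \<inter> {..p} = T \<inter> {..q}" using T by (auto simp: q_def)
      have "j * ?c \<le> n * ?c" using q by linarith
      then have jn: "j \<le> n" using assms by (metis add_gr_0 mult_le_cancel2)
      have "cnt q \<le> card (T \<inter> {..q})"
      proof (cases "r \<le> a")
        case True
        have "card (T \<inter> {..j * ?c}) \<le> card (T \<inter> {..q})" using q by (intro card_mono) auto
        moreover have "j * b \<le> card (T \<inter> {..j * ?c})" using * jn by blast
        moreover have "cnt q = j * b" using True by (simp add: cnt_def j_def r_def)
        ultimately show ?thesis by linarith
      next
        case False
        \<comment> \<open>For \<open>j = n\<close> the bound \<open>q \<le> ?N\<close> would force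
          \<open>r = 0\<close>, against \<open>r > a\<close>; so the current block has an end at
          which the condition is available.\<close>
        then have "j \<noteq> n" using q by auto
        then have "Suc j \<in> {..n}" using jn by simp
        then have "Suc j * b \<le> card (T \<inter> {..Suc j * ?c})" using * by blast
        also have "\<dots> \<le> card ((T \<inter> {..q}) \<union> {q<..Suc j * ?c})" by (intro card_mono) auto
        also have "\<dots> \<le> card (T \<inter> {..q}) + card {q<..Suc j * ?c}" by (rule card_Un_le)
        also have "card {q<..Suc j * ?c} = ?c - r" using q by simp
        finally have "Suc j * b \<le> card (T \<inter> {..q}) + (?c - r)" .
        moreover have "cnt q = j * b + (r - a)" by (simp add: cnt_def j_def r_def)
        ultimately show ?thesis using False q(2) by simp
      qed
      then show "card (S \<inter> {..p}) \<le> card (T \<inter> {..p})" using Tq cS by (simp add: q_def)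
    qed
    then show ?thesis using sorted_list_le_iff_prefix_counts[OF finS finT T(2)] by simp
  qed
  then show ?thesis
    unfolding catalan_matroid_def schubert_matroid_def prefix_matroid_def S_def[symmetric]
    using cardS by (auto intro!: Collect_cong)
qed

lemma U_matroid_eq_prefix: "U_matroid a b n = prefix_matroid b (a + b) n {0, n}"
proof -
  have "T \<inter> {..n * (a + b)} = T" if "T \<subseteq> {1..n * (a + b)}" for T using that by auto
  then show ?thesis
    by (auto simp: U_matroid_def uniform_matroid_def prefix_matroid_def intro!: Collect_cong)
qed

section \<open>Rank functions of the Catalan and the uniform matroid\<close>

lemma block_defect_ge: "j \<le> n \<Longrightarrow> int (j * b) - int (card (X \<inter> blocks c i j)) \<le> block_defect b c n i X"
  and block_defect_attained: "\<exists>j\<le>n. block_defect b c n i X = int (j * b) - int (card (X \<inter> blocks c i j))"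
proof -
  have card: "card (X \<inter> blocks c i (Suc j)) = card (X \<inter> blocks c i 1) + card (X \<inter> blocks c (Suc i) j)" for i j
  proof -
    have "blocks c i 1 \<inter> blocks c (Suc i) j = {}" by (rule blocks_disjoint) simp
    then have "(X \<inter> blocks c i 1) \<inter> (X \<inter> blocks c (Suc i) j) = {}" by blast
    then show ?thesis unfolding blocks_Suc[of c i j] Int_Un_distrib
      by (intro card_Un_disjoint) auto
  qed
  show "j \<le> n \<Longrightarrow> int (j * b) - int (card (X \<inter> blocks c i j)) \<le> block_defect b c n i X"
  proof (induction n arbitrary: i j)
    case (Suc n)
    show ?case
    proof (cases j)
      case (Suc j')
      then have "int (j' * b) - int (card (X \<inter> blocks c (Suc i) j')) \<le> block_defect b c n (Suc i) X"
        using Suc.IH Suc.prems by simp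
      then show ?thesis unfolding Suc card[of i j'] by (simp add: algebra_simps)
    qed (simp add: block_defect_nonneg)
  qed simp
  show "\<exists>j\<le>n. block_defect b c n i X = int (j * b) - int (card (X \<inter> blocks c i j))"
  proof (induction n arbitrary: i)
    case (Suc n)
    obtain j where j: "j \<le> n" "block_defect b c n (Suc i) X = int (j * b) - int (card (X \<inter> blocks c (Suc i) j))"
      using Suc.IH by blast
    show ?case
    proof (cases "(int b - int (card (X \<inter> blocks c i 1))) + block_defect b c n (Suc i) X \<le> 0")
      case True
      then show ?thesis by (intro exI[of _ 0]) simp
    next
      case False
      then show ?thesis using j by (intro exI[of _ "Suc j"]) (simp add: card[of i j] del: One_nat_def)
    qed
  qed simp
qed

lemma blocks_from_0: "blocks c 0 n = {1..n * c}"
  by (simp add: blocks_def)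

text \<open>The rank is the minimum over \<open>j\<close> of
  \<open>card (X \<inter> {..j * c}) + (n - j) * b\<close>, that is, \<open>n * b\<close> minus the
  largest partial sum \<open>j * b - card (X \<inter> {..j * c})\<close>.\<close>

lemma rank_catalan_prefix:
  assumes "b \<le> c" and X: "X \<subseteq> {1..n * c}"
  shows "rank_of (prefix_matroid b c n {..n}) X = catalan_rank b c n X"
proof -
  have M: "is_matroid (prefix_matroid b c n {..n})" using assms by (intro is_matroid_prefix_matroid) auto
  have e: "X \<inter> {..j * c} = X \<inter> blocks c 0 j" for j using X by (auto simp: blocks_from_0)
  obtain j where j: "j \<le> n" "block_defect b c n 0 X = int (j * b) - int (card (X \<inter> blocks c 0 j))"
    using block_defect_attained by blast
  have nj: "int (n * b) = int (j * b) + int ((n - j) * b)" if "j \<le> n" for j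
    using that by (simp flip: of_nat_add distrib_right)
  have "rank_of (prefix_matroid b c n {..n}) X \<le> card (X \<inter> blocks c 0 j) + (n - j) * b"
    using rank_prefix_matroid_le[OF M, of j X] j(1) e[of j] by simp
  then have "int (rank_of (prefix_matroid b c n {..n}) X) \<le> int (card (X \<inter> blocks c 0 j)) + int ((n - j) * b)"
    by (simp flip: of_nat_add del: of_nat_mult)
  then have "int (rank_of (prefix_matroid b c n {..n}) X) \<le> int (n * b) - block_defect b c n 0 X"
    using j(2) nj[OF j(1)] by linarith
  moreover obtain j' where j': "j' \<le> n"
    "rank_of (prefix_matroid b c n {..n}) X = card (X \<inter> {..j' * c}) + (n - j') * b"
    using rank_prefix_matroid_attained[OF M _ _ _ X] by auto
  then have "int (rank_of (prefix_matroid b c n {..n}) X) \<ge> int (n * b) - block_defect b c n 0 X"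
    using block_defect_ge[OF j'(1), of b X c 0] nj[OF j'(1)] e[of j'] by simp
  ultimately show ?thesis by (simp add: catalan_rank_def)
qed

lemma rank_uniform_prefix:
  assumes "b \<le> c" and X: "X \<subseteq> {1..n * c}"
  shows "rank_of (prefix_matroid b c n {0, n}) X = uniform_rank b n X"
proof -
  have M: "is_matroid (prefix_matroid b c n {0, n})" using assms by (intro is_matroid_prefix_matroid) auto
  have e: "X \<inter> {..n * c} = X" "X \<inter> {..0 * c} = {}" using X by auto
  have "rank_of (prefix_matroid b c n {0, n}) X \<le> n * b"
    "rank_of (prefix_matroid b c n {0, n}) X \<le> card X"
    using rank_prefix_matroid_le[OF M, of 0 X] rank_prefix_matroid_le[OF M, of n X] e by auto
  moreover have "rank_of (prefix_matroid b c n {0, n}) X = n * b \<or> rank_of (prefix_matroid b c n {0, n}) X = card X"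
    using rank_prefix_matroid_attained[OF M _ _ _ X] e by auto
  ultimately show ?thesis by (auto simp: uniform_rank_def)
qed

section \<open>The recursion for Catalan matroids\<close>

lemma left_KL_cong:
  assumes q: "left_KL \<rho> E q"
    and eq: "\<And>X. X \<subseteq> E \<Longrightarrow> \<rho> X = \<rho>' X" "\<And>X. X \<subseteq> E \<Longrightarrow> q X = q' X"
  shows "left_KL \<rho>' E q'"
  unfolding left_KL_def
proof (intro allI impI conjI)
  fix X assume X: "X \<subseteq> E"
  show "q' X = 1" if "\<rho>' X = 0" using left_KL_rank_0[OF q X] that eq[OF X] by simp
  show "2 * degree (q' X) < \<rho>' X" if "0 < \<rho>' X" using left_KL_degree[OF q X] that eq[OF X] by simp
  have "q X = (\<Sum>Z\<in>Pow X. rev_poly (\<rho> Z) (q Z) *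
      (\<Sum>A\<in>{Z..X}. (-1) ^ (card Z + card A) * monom 1 (\<rho> X - \<rho> A)))"
    by (rule left_KL_relation[OF q X])
  also have "\<dots> = (\<Sum>Z\<in>Pow X. rev_poly (\<rho>' Z) (q' Z) *
      (\<Sum>A\<in>{Z..X}. (-1) ^ (card Z + card A) * monom 1 (\<rho>' X - \<rho>' A)))"
  proof (intro sum.cong refl arg_cong2[of _ _ _ _ "(*)"])
    fix Z A
    assume "Z \<in> Pow X"
    then show "rev_poly (\<rho> Z) (q Z) = rev_poly (\<rho>' Z) (q' Z)" using eq[of Z] X by auto
    assume "A \<in> {Z..X}"
    then have "A \<subseteq> E" using X by auto
    then show "monom 1 (\<rho> X - \<rho> A) = monom (1::int) (\<rho>' X - \<rho>' A)" using eq X by simp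
  qed
  finally show "q' X = (\<Sum>Z\<in>Pow X. rev_poly (\<rho>' Z) (q' Z) *
      (\<Sum>A\<in>{Z..X}. (-1) ^ (card Z + card A) * monom 1 (\<rho>' X - \<rho>' A)))"
    using eq(2)[OF X] by simp
qed

definition catalan_Q :: "nat \<Rightarrow> nat \<Rightarrow> nat \<Rightarrow> nat set \<Rightarrow> int poly" where
  "catalan_Q a b n X = (-1) ^ catalan_rank b (a + b) n X * inverse_KL_poly (restrict_to (catalan_matroid a b n) X)"

definition uniform_Q :: "nat \<Rightarrow> nat \<Rightarrow> nat \<Rightarrow> nat set \<Rightarrow> int poly" where
  "uniform_Q a b n X = (-1) ^ uniform_rank b n X * inverse_KL_poly (restrict_to (U_matroid a b n) X)"

lemma left_KL_inverse_KL_poly_rank: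
  assumes M: "is_matroid M" "loopless M" and r: "\<And>X. X \<subseteq> ground M \<Longrightarrow> rank_of M X = \<rho> X"
  shows "left_KL \<rho> (ground M) (\<lambda>X. (-1) ^ \<rho> X * inverse_KL_poly (restrict_to M X))"
  by (rule left_KL_cong[OF left_KL_inverse_KL_poly[OF M]]) (simp_all add: r)

context
  fixes a b :: nat
  assumes b: "0 < b"
begin

lemma is_matroid_catalan: "is_matroid (catalan_matroid a b n)"
  and is_matroid_U: "is_matroid (U_matroid a b n)"
  unfolding catalan_matroid_eq_prefix[OF b] U_matroid_eq_prefix
  by (rule is_matroid_prefix_matroid; simp)+

lemma ground_catalan: "ground (catalan_matroid a b n) = {1..n * (a + b)}"
  and ground_U: "ground (U_matroid a b n) = {1..n * (a + b)}"
  by (simp_all add: catalan_matroid_eq_prefix[OF b] U_matroid_eq_prefix)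

lemma left_KL_catalan: "left_KL (catalan_rank b (a + b) n) {1..n * (a + b)} (catalan_Q a b n)"
  unfolding catalan_Q_def[abs_def] ground_catalan[symmetric]
  by (rule left_KL_inverse_KL_poly_rank[OF is_matroid_catalan])
    (use b in \<open>auto simp: catalan_matroid_eq_prefix intro!: loopless_prefix_matroid rank_catalan_prefix\<close>)

lemma left_KL_U: "left_KL (uniform_rank b n) {1..n * (a + b)} (uniform_Q a b n)"
  unfolding uniform_Q_def[abs_def] ground_U[symmetric]
  by (rule left_KL_inverse_KL_poly_rank[OF is_matroid_U])
    (use b in \<open>auto simp: U_matroid_eq_prefix intro!: loopless_prefix_matroid rank_uniform_prefix\<close>)

lemma catalan_Q_full: "catalan_Q a b n {1..n * (a + b)} = (-1) ^ (n * b) * inverse_KL_poly (catalan_matroid a b n)"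
  using block_defect_full[of b "a + b" n 0] restrict_ground[OF is_matroid_catalan, of n]
  by (simp add: catalan_Q_def catalan_rank_def blocks_from_0 ground_catalan del: of_nat_mult)

lemma uniform_Q_full: "uniform_Q a b n {1..n * (a + b)} = (-1) ^ (n * b) * inverse_KL_poly (U_matroid a b n)"
  using restrict_ground[OF is_matroid_U, of n]
  by (simp add: uniform_Q_def uniform_rank_def ground_U)

lemma catalan_rank_mono: "X \<subseteq> Y \<Longrightarrow> catalan_rank b c n X \<le> catalan_rank b c n Y"
  using block_defect_antimono[of X Y b c n 0] by (simp add: catalan_rank_def)

lemma uniform_rank_mono: "X \<subseteq> Y \<Longrightarrow> finite Y \<Longrightarrow> uniform_rank b n X \<le> uniform_rank b n Y"
  using card_mono[of Y X] by (auto simp: uniform_rank_def)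

lemma catalan_coeff:
  "coeff ((-1) ^ (n * b) * inverse_KL_poly (catalan_matroid a b n)) j =
    left_KL_coeff (n * b) (catalan_rank b (a + b) n) (blocks (a + b) 0 n) j"
proof -
  have "catalan_rank b (a + b) n {1..n * (a + b)} \<le> n * b"
    using block_defect_nonneg[of b "a + b" n 0 "{1..n * (a + b)}"]
      catalan_rank_eq[of b "a + b" n "{1..n * (a + b)}"] by linarith
  then show ?thesis
    unfolding catalan_Q_full[symmetric] blocks_from_0
    by (intro left_KL_coeff_eq[OF left_KL_catalan]) (simp_all add: catalan_rank_mono)
qed

lemma mixed_coeff:
  assumes m: "m \<le> n"
  shows "coeff ((-1) ^ (n * b) * (inverse_KL_poly (U_matroid a b m) * inverse_KL_poly (catalan_matroid a b (n - m)))) j =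
    left_KL_coeff (n * b) (mixed_rank b (a + b) n m) (blocks (a + b) 0 n) j"
proof -
  let ?c = "a + b"
  \<comment> \<open>Shifts the last \<open>m\<close> blocks down to the ground set of the uniform
    matroid. The truncated subtraction is injective on \<open>E2\<close>, whose elements all exceed
    \<open>(n - m) * ?c\<close>.\<close>
  define h where "h x = x - (n - m) * ?c" for x
  define E1 where "E1 = blocks ?c 0 (n - m)"
  define E2 where "E2 = blocks ?c (n - m) m"
  have E: "blocks ?c 0 n = E1 \<union> E2" and disj: "E1 \<inter> E2 = {}"
    using blocks_add[of ?c 0 "n - m" m] blocks_disjoint[of 0 "n - m" "n - m" ?c m] m
    by (simp_all add: E1_def E2_def)
  have fin: "finite E1" "finite E2" by (simp_all add: E1_def E2_def)
  have inj: "inj_on h E2" by (auto simp: inj_on_def h_def E2_def blocks_def)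
  have "E2 = (\<lambda>x. x + (n - m) * ?c) ` {1..m * ?c}"
    using blocks_image[of ?c 0 "n - m" m] unfolding blocks_from_0 add_0 E2_def .
  then have hE2: "h ` E2 = {1..m * ?c}" by (simp only: image_image h_def) simp
  have 1: "left_KL (catalan_rank b ?c (n - m)) E1 (catalan_Q a b (n - m))"
    using left_KL_catalan[of "n - m"] by (simp add: E1_def blocks_from_0)
  have "left_KL (\<lambda>X. uniform_rank b m (h ` X)) E2 (\<lambda>X. uniform_Q a b m (h ` X))"
    by (rule left_KL_image) (simp_all only: hE2 left_KL_U inj)
  then have 2: "left_KL (uniform_rank b m) E2 (\<lambda>X. uniform_Q a b m (h ` X))"
  proof (rule left_KL_cong)
    fix X assume "X \<subseteq> E2"
    then have "card (h ` X) = card X" using inj by (meson card_image inj_on_subset)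
    then show "uniform_rank b m (h ` X) = uniform_rank b m X" by (simp add: uniform_rank_def)
  qed simp
  have "left_KL (\<lambda>X. catalan_rank b ?c (n - m) (X \<inter> E1) + uniform_rank b m (X \<inter> E2)) (E1 \<union> E2)
      (\<lambda>X. catalan_Q a b (n - m) (X \<inter> E1) * uniform_Q a b m (h ` (X \<inter> E2)))"
    using left_KL_sum[OF 1 2 fin disj catalan_rank_mono uniform_rank_mono] fin finite_subset by blast
  then have L: "left_KL (mixed_rank b ?c n m) (blocks ?c 0 n)
      (\<lambda>X. catalan_Q a b (n - m) (X \<inter> E1) * uniform_Q a b m (h ` (X \<inter> E2)))"
    unfolding E by (simp only: mixed_rank_def[abs_def] E1_def E2_def)
  have "mixed_rank b ?c n m X \<le> mixed_rank b ?c n m Y" if "X \<subseteq> Y" for X Y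
    unfolding mixed_rank_def using that
    by (intro add_mono catalan_rank_mono uniform_rank_mono) auto
  then have "coeff (catalan_Q a b (n - m) (blocks ?c 0 n \<inter> E1) * uniform_Q a b m (h ` (blocks ?c 0 n \<inter> E2))) j =
      left_KL_coeff (n * b) (mixed_rank b ?c n m) (blocks ?c 0 n) j"
    by (intro left_KL_coeff_eq[OF L]) (simp_all add: mixed_rank_full m)
  also have "blocks ?c 0 n \<inter> E1 = {1..(n - m) * ?c}" using E by (auto simp: E1_def blocks_from_0)
  also have "blocks ?c 0 n \<inter> E2 = E2" using E by auto
  also have "(-1) ^ (n * b) = (-1 :: int poly) ^ (m * b) * (-1) ^ ((n - m) * b)"
    using m by (simp flip: power_add distrib_right)
  ultimately show ?thesis
    unfolding hE2 catalan_Q_full uniform_Q_full by (simp only: mult_ac)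
qed

lemma inverse_KL_catalan_recursion:
  "of_nat n * inverse_KL_poly (catalan_matroid a b n) =
    (\<Sum>i<n. inverse_KL_poly (U_matroid a b (Suc i)) * inverse_KL_poly (catalan_matroid a b (n - Suc i)))"
proof -
  \<comment> \<open>The Catalan matroid and all the direct sums have rank \<open>n * b\<close>, so a
    single sign converts between Q and the solutions of \<open>left_KL\<close>.\<close>
  let ?s = "(-1 :: int poly) ^ (n * b)"
  have "?s * (of_nat n * inverse_KL_poly (catalan_matroid a b n)) =
      ?s * (\<Sum>i<n. inverse_KL_poly (U_matroid a b (Suc i)) * inverse_KL_poly (catalan_matroid a b (n - Suc i)))"
  proof (rule poly_eqI)
    fix j
    have of_nat: "coeff (of_nat n * p) j = int n * coeff p j" for p
      by (simp add: of_nat_poly)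
    have "coeff (?s * (of_nat n * inverse_KL_poly (catalan_matroid a b n))) j =
        int n * coeff (?s * inverse_KL_poly (catalan_matroid a b n)) j"
      unfolding mult.left_commute[of ?s] of_nat ..
    also have "\<dots> = (\<Sum>i<n. coeff (?s * (inverse_KL_poly (U_matroid a b (Suc i)) *
        inverse_KL_poly (catalan_matroid a b (n - Suc i)))) j)"
      unfolding catalan_coeff left_KL_coeff_mixed[OF le_add2]
      by (intro sum.cong refl mixed_coeff[symmetric]) simp
    finally show "coeff (?s * (of_nat n * inverse_KL_poly (catalan_matroid a b n))) j =
      coeff (?s * (\<Sum>i<n. inverse_KL_poly (U_matroid a b (Suc i)) *
        inverse_KL_poly (catalan_matroid a b (n - Suc i)))) j"
      by (simp add: sum_distrib_left coeff_sum)
  qed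
  then show ?thesis by simp
qed

lemma inverse_KL_catalan_0: "inverse_KL_poly (catalan_matroid a b 0) = 1"
  using is_matroid_catalan[of 0] ground_catalan[of 0] by (intro inverse_KL_poly_empty) auto

end

section \<open>Sums over partitions\<close>

lemma z_partition_superset:
  assumes "finite A" "set_mset p \<subseteq> A"
  shows "z_partition p = (\<Prod>i\<in>A. i ^ count p i * fact (count p i))"
  unfolding z_partition_def using assms
  by (intro prod.mono_neutral_left) (auto simp: not_in_iff)

text \<open>Only the factor of \<open>m\<close> changes, from m^k k! to m^(k+1) (k+1)!.\<close>

lemma z_partition_add_mset: "z_partition (add_mset m p) = m * count (add_mset m p) m * z_partition p"
proof -
  let ?A = "insert m (set_mset p)"
  let ?f = "\<lambda>p i. i ^ count p i * fact (count p i) :: nat"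
  have "z_partition (add_mset m p) = ?f (add_mset m p) m * (\<Prod>i\<in>?A - {m}. ?f (add_mset m p) i)"
    by (rule trans[OF z_partition_superset prod.remove]) auto
  also have "(\<Prod>i\<in>?A - {m}. ?f (add_mset m p) i) = (\<Prod>i\<in>?A - {m}. ?f p i)"
    by (intro prod.cong) auto
  also have "?f (add_mset m p) m = m * count (add_mset m p) m * ?f p m"
    by (simp add: algebra_simps)
  also have "m * count (add_mset m p) m * ?f p m * (\<Prod>i\<in>?A - {m}. ?f p i) =
      m * count (add_mset m p) m * (\<Prod>i\<in>?A. ?f p i)"
    using prod.remove[of ?A m "?f p"] by simp
  also have "(\<Prod>i\<in>?A. ?f p i) = z_partition p"
    by (rule z_partition_superset[symmetric]) auto
  finally show ?thesis .
qed

lemma sum_mset_count: "sum_mset p = (\<Sum>m\<in>set_mset p. m * count p m)" for p :: "nat multiset"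
proof -
  \<comment> \<open>The index set is a fixed superset \<open>A\<close>, because
    \<open>set_mset p\<close> changes along the induction.\<close>
  have "sum_mset p = (\<Sum>m\<in>A. m * count p m)" if "finite A" "set_mset p \<subseteq> A" for A
    using that
  proof (induction p)
    case (add x p)
    have "(\<Sum>m\<in>A. m * count (add_mset x p) m) = (\<Sum>m\<in>A. (if m = x then m else 0) + m * count p m)"
      by (intro sum.cong) auto
    also have "\<dots> = x + (\<Sum>m\<in>A. m * count p m)" using add.prems by (simp add: sum.distrib)
    finally show ?case using add by simp
  qed simp
  then show ?thesis by simp
qed

lemma z_partition_pos: "p \<in> partitions_of n \<Longrightarrow> 0 < z_partition p"
  unfolding z_partition_def partitions_of_def by (intro prod_pos) auto

text \<open>The coefficient of x^n in exp(sum of q_m x^m / m), that is, the complete homogeneous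
  symmetric function written in power sums, with \<open>q m\<close> in place of p_m.\<close>

definition partition_sum :: "(nat \<Rightarrow> rat poly) \<Rightarrow> nat \<Rightarrow> rat poly" where
  "partition_sum q n = (\<Sum>p\<in>partitions_of n. smult (1 / of_nat (z_partition p)) (\<Prod>m\<in>#p. q m))"

lemma partition_sum_0: "partition_sum q 0 = 1"
proof -
  have "p = {#}" if "\<forall>i\<in>#p. 0 < i" "sum_mset p = 0" for p :: "nat multiset"
    using that by (metis less_irrefl multiset_nonemptyE sum_mset_0_iff)
  then have "partitions_of 0 = {{#}}" by (auto simp: partitions_of_def)
  then show ?thesis by (simp add: partition_sum_def z_partition_def)
qed

text \<open>Newton's identity n h_n = sum of p_m h_(n-m). Distribute the factor \<open>n\<close> of
  a partition \<open>p\<close> over its part sizes; the share \<open>m * count p m\<close>, divided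
  by \<open>z_partition p\<close>, is the reciprocal of
  \<open>z_partition (p - {#m#})\<close>.\<close>

lemma partition_sum_recursion:
  "of_nat n * partition_sum q n = (\<Sum>i<n. q (Suc i) * partition_sum q (n - Suc i))"
proof -
  define t where "t p = smult (1 / rat_of_nat (z_partition p)) (\<Prod>m\<in>#p. q m)" for p
  have step: "smult (of_nat (m * count p m)) (t p) = q m * t (p - {#m#})"
    if p: "p \<in> partitions_of n" and m: "m \<in># p" for p m
  proof -
    define p' where "p' = p - {#m#}"
    have p': "p = add_mset m p'" using m by (simp add: p'_def)
    have "z_partition p = m * count p m * z_partition p'" unfolding p' by (rule z_partition_add_mset)
    moreover have "0 < z_partition p" using z_partition_pos[OF p] .
    ultimately have "of_nat (m * count p m) * (1 / rat_of_nat (z_partition p)) = 1 / rat_of_nat (z_partition p')"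
      by (simp add: field_simps)
    moreover have "(\<Prod>m\<in>#p. q m) = q m * (\<Prod>m\<in>#p'. q m)" by (simp add: p')
    ultimately show ?thesis by (simp add: t_def p'_def)
  qed
  have n: "of_nat n * t p = (\<Sum>m\<in>set_mset p. q m * t (p - {#m#}))" if p: "p \<in> partitions_of n" for p
  proof -
    have "n = (\<Sum>m\<in>set_mset p. m * count p m)" using p sum_mset_count[of p] by (simp add: partitions_of_def)
    then have "of_nat n * t p = smult (of_nat (\<Sum>m\<in>set_mset p. m * count p m)) (t p)"
      by (simp add: of_nat_poly)
    also have "\<dots> = (\<Sum>m\<in>set_mset p. smult (of_nat (m * count p m)) (t p))"
      by (simp add: smult_sum del: of_nat_mult)
    also have "\<dots> = (\<Sum>m\<in>set_mset p. q m * t (p - {#m#}))"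
      by (intro sum.cong refl step p)
    finally show ?thesis .
  qed
  have "of_nat n * partition_sum q n = (\<Sum>p\<in>partitions_of n. \<Sum>m\<in>set_mset p. q m * t (p - {#m#}))"
    by (simp add: partition_sum_def sum_distrib_left n flip: t_def cong: sum.cong)
  also have "\<dots> = (\<Sum>(p, m)\<in>(SIGMA p:partitions_of n. set_mset p). q m * t (p - {#m#}))"
    by (rule sum.Sigma) (simp_all add: finite_partitions_of)
  \<comment> \<open>A partition of \<open>n\<close> with a marked part size is a positive number
    \<open>m = Suc i\<close> together with a partition of \<open>n - Suc i\<close>.\<close>
  also have "\<dots> = (\<Sum>(i, p)\<in>(SIGMA i:{..<n}. partitions_of (n - Suc i)). q (Suc i) * t p)"
  proof (rule sum.reindex_bij_witness[of _ "\<lambda>(i, p). (add_mset (Suc i) p, Suc i)" "\<lambda>(p, m). (m - 1, p - {#m#})"])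
    fix x assume "x \<in> (SIGMA p:partitions_of n. set_mset p)"
    then obtain p m where x: "x = (p, m)" "p \<in> partitions_of n" "m \<in># p" by auto
    define p' where "p' = p - {#m#}"
    have p': "p = add_mset m p'" using x by (simp add: p'_def)
    have "0 < m" "n = m + sum_mset p'" using x p' by (auto simp: partitions_of_def)
    then show "(case case x of (p, m) \<Rightarrow> (m - 1, p - {#m#}) of (i, p) \<Rightarrow> (add_mset (Suc i) p, Suc i)) = x"
      "(case x of (p, m) \<Rightarrow> (m - 1, p - {#m#})) \<in> (SIGMA i:{..<n}. partitions_of (n - Suc i))"
      "(case case x of (p, m) \<Rightarrow> (m - 1, p - {#m#}) of (i, p) \<Rightarrow> q (Suc i) * t p) =
        (case x of (p, m) \<Rightarrow> q m * t (p - {#m#}))"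
      using x p' by (auto simp: partitions_of_def)
  next
    fix y assume "y \<in> (SIGMA i:{..<n}. partitions_of (n - Suc i))"
    then obtain i p where y: "y = (i, p)" "i < n" "p \<in> partitions_of (n - Suc i)" by auto
    then show "(case case y of (i, p) \<Rightarrow> (add_mset (Suc i) p, Suc i) of (p, m) \<Rightarrow> (m - 1, p - {#m#})) = y"
      "(case y of (i, p) \<Rightarrow> (add_mset (Suc i) p, Suc i)) \<in> (SIGMA p:partitions_of n. set_mset p)"
      by (auto simp: partitions_of_def)
  qed
  also have "\<dots> = (\<Sum>i<n. \<Sum>p\<in>partitions_of (n - Suc i). q (Suc i) * t p)"
    by (rule sum.Sigma[symmetric]) (simp_all add: finite_partitions_of)
  finally show ?thesis by (simp add: partition_sum_def sum_distrib_left flip: t_def)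
qed

lemma partition_sum_unique:
  assumes "f 0 = 1" "\<And>n. of_nat n * f n = (\<Sum>i<n. q (Suc i) * f (n - Suc i))"
  shows "f n = partition_sum q n"
proof (induction n rule: less_induct)
  case (less n)
  show ?case
  proof (cases "n = 0")
    case False
    have "of_nat n * f n = of_nat n * partition_sum q n"
      unfolding assms(2) partition_sum_recursion by (intro sum.cong) (use less in auto)
    then show ?thesis using False by simp
  qed (simp add: assms partition_sum_0)
qed

lemma map_poly_of_int_mult:
  "map_poly rat_of_int (p * q) = map_poly rat_of_int p * map_poly rat_of_int q"
  by (intro poly_eqI) (simp add: coeff_map_poly coeff_mult)

lemma map_poly_of_int_sum:
  "map_poly rat_of_int (\<Sum>i\<in>I. f i) = (\<Sum>i\<in>I. map_poly rat_of_int (f i))"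
  by (intro poly_eqI) (simp add: coeff_map_poly coeff_sum)

lemma map_poly_of_int_of_nat: "map_poly rat_of_int (of_nat n) = of_nat n"
  by (intro poly_eqI) (simp add: coeff_map_poly of_nat_poly coeff_pCons split: nat.split)

theorem corollary4p10:
  fixes a b n :: nat
  assumes "a > 0" and "b > 0" and "n > 0"
  shows "map_poly rat_of_int (inverse_KL_poly (catalan_matroid a b n)) =
    (\<Sum>p\<in>partitions_of n.
       smult (1 / rat_of_nat (z_partition p))
         (\<Prod>m\<in>#p. map_poly rat_of_int (inverse_KL_poly (U_matroid a b m))))"
proof -
  have "map_poly rat_of_int (inverse_KL_poly (catalan_matroid a b n)) =
      partition_sum (\<lambda>m. map_poly rat_of_int (inverse_KL_poly (U_matroid a b m))) n" for n
  proof (rule partition_sum_unique)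
    show "map_poly rat_of_int (inverse_KL_poly (catalan_matroid a b 0)) = 1"
      by (simp add: inverse_KL_catalan_0[OF assms(2)])
    fix n
    show "of_nat n * map_poly rat_of_int (inverse_KL_poly (catalan_matroid a b n)) =
      (\<Sum>i<n. map_poly rat_of_int (inverse_KL_poly (U_matroid a b (Suc i))) *
        map_poly rat_of_int (inverse_KL_poly (catalan_matroid a b (n - Suc i))))"
      using arg_cong[OF inverse_KL_catalan_recursion[OF assms(2), of n], of "map_poly rat_of_int"]
      by (simp only: map_poly_of_int_mult map_poly_of_int_sum map_poly_of_int_of_nat)
  qed
  then show ?thesis by (simp only: partition_sum_def)
qed


end
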